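(* Let $\Sigma$ be a discrete-time linear system given by bounded Hilbert space operators $(A,B,C,D)$. Assume that $\Sigma$ is minimal and that its transfer function $F_\Sigma$ has an analytic continuation to a function in the Schur class $\mathcal S(\mathcal U,\mathcal Y)$. Let $H_a,H_r$ be the positive-definite operators defined in the context. (1) If $\Sigma$ is $\ell^2$-exactly controllable, then $H_a$ and $H_r$ are bounded. (2) If $\Sigma$ is $\ell^2$-exactly observable, then $H_a$ and $H_r$ are boundedly invertible. (3) If $\Sigma$ is $\ell^2$-exactly minimal, i.e., both $\ell^2$-exactly controllable and $\ell^2$-exactly observable, then $H_a$ and $H_r$ are both bounded and boundedly invertible.
   Context: System: $\mathcal U,\mathcal X,\mathcal Y$ Hilbert spaces, $A:\mathcal X\to\mathcal X$, $B:\mathcal U\to\mathcal X$, $C:\mathcal X\to\mathcal Y$, $D:\mathcal U\to\mathcal Y$ bounded; $\Sigma$: $\mathbf x(n+1)=A\mathbf x(n)+B\mathbf u(n)$, $\mathbf y(n)=C\mathbf x(n)+D\mathbf u(n)$; $F_\Sigma(\lambda)=D+\lambda C(I-\lambda A)^{-1}B$ near $0$. $\mathcal S(\mathcal U,\mathcal Y)$: holomorphic $F:\mathbb D\to\mathcal L(\mathcal U,\mathcal Y)$ with $\|F(\lambda)\|\le1$ on $\mathbb D$. Minimal: the linear spans of $\{\mathrm{Im}\,A^kB\}_{k\ge0}$ and of $\{\mathrm{Im}\,A^{*k}C^*\}_{k\ge0}$ are both dense in $\mathcal X$. $\mathbb Z_+=\{0,1,\dots\}$, $\mathbb Z_-=\{-1,-2,\dots\}$.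 $\mathbf W_o$: domain $\{x\in\mathcal X:\{CA^nx\}_{n\ge0}\in\ell^2_{\mathcal Y}(\mathbb Z_+)\}$, $\mathbf W_ox=\{CA^nx\}_{n\ge0}$. $\mathbf W_c^*$: domain $\{x\in\mathcal X:\{B^*A^{*(-n-1)}x\}_{n\le-1}\in\ell^2_{\mathcal U}(\mathbb Z_-)\}$, $\mathbf W_c^*x=\{B^*A^{*(-n-1)}x\}_{n\le-1}$. Under the assumptions both are closed and densely defined; $\mathbf W_c:=(\mathbf W_c^* )^*$, $\mathbf W_o^*$ is the adjoint of $\mathbf W_o$; $\mathrm{Im}\,\mathbf W_c\subset\mathcal D(\mathbf W_o)$ and $\mathrm{Im}\,\mathbf W_o^*\subset\mathcal D(\mathbf W_c^* )$. $\Sigma$ is $\ell^2$-exactly controllable if $\mathrm{Im}\,\mathbf W_c=\mathbf W_c\mathcal D(\mathbf W_c)=\mathcal X$, and $\ell^2$-exactly observable if $\mathrm{Im}\,\mathbf W_o^*=\mathbf W_o^*\mathcal D(\mathbf W_o^* )=\mathcal X$. With $F_0=D$, $F_n=CA^{n-1}B$ ($n\ge1$), the Toeplitz operators $\mathfrak T_{F_\Sigma}=[F_{i-j}]_{0\le j\le i}:\ell^2_{\mathcal U}(\mathbb Z_+)\to\ell^2_{\mathcal Y}(\mathbb Z_+)$ and $\widetilde{\mathfrak T}_{F_\Sigma}=[F_{i-j}]_{j\le i<0}:\ell^2_{\mathcal U}(\mathbb Z_-)\to\ell^2_{\mathcal Y}(\mathbb Z_-)$ are contractions; $D_X=(I-X^*X)^{1/2}$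 for a contraction $X$. There is a unique closable operator $X_a$ with domain $\mathrm{Im}\,\mathbf W_c$ mapping into $(\mathrm{Ker}\,D_{\mathfrak T_{F_\Sigma}^*})^\perp$ with $\mathbf W_o|_{\mathrm{Im}\,\mathbf W_c}=D_{\mathfrak T_{F_\Sigma}^*}X_a$, and a unique closable operator $X_r$ with domain $\mathrm{Im}\,\mathbf W_o^*$ mapping into $(\mathrm{Ker}\,D_{\widetilde{\mathfrak T}_{F_\Sigma}})^\perp$ with $\mathbf W_c^*|_{\mathrm{Im}\,\mathbf W_o^*}=D_{\widetilde{\mathfrak T}_{F_\Sigma}}X_r$; their closures $\overline X_a,\overline X_r$ are injective. Define $H_a=\overline X_a^*\overline X_a$ and $H_r=(\overline X_r^*\overline X_r)^{-1}$. *)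

theory Defs
  imports "HOL-Analysis.Analysis"
begin

section \<open>Complex Hilbert spaces\<close>

text \<open>
  The inner product is linear in its first argument. The real inner product inherited from
  \<^class>\<open>real_inner\<close> is the real part of the complex one, so norm and topology agree.
\<close>

class complex_inner = real_inner +
  fixes scaleC :: "complex \<Rightarrow> 'a \<Rightarrow> 'a"  (infixr \<open>*\<^sub>C\<close> 75)
    and cinner :: "'a \<Rightarrow> 'a \<Rightarrow> complex"
  assumes scaleC_add_right: "c *\<^sub>C (x + y) = c *\<^sub>C x + c *\<^sub>C y"
    and scaleC_add_left: "(c + d) *\<^sub>C x = c *\<^sub>C x + d *\<^sub>C x"
    and scaleC_scaleC: "c *\<^sub>C (d *\<^sub>C x) = (c * d) *\<^sub>C x"
    and scaleC_of_real: "complex_of_real r *\<^sub>C x = r *\<^sub>R x"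
    and cinner_add_left: "cinner (x + y) z = cinner x z + cinner y z"
    and cinner_scaleC_left: "cinner (c *\<^sub>C x) y = c * cinner x y"
    and cinner_commute: "cinner x y = cnj (cinner y x)"
    and inner_eq_Re_cinner: "inner x y = Re (cinner x y)"

class chilbert_space = complex_inner + complete_space
begin
subclass banach ..
end

instantiation complex :: chilbert_space
begin

definition scaleC_complex :: "complex \<Rightarrow> complex \<Rightarrow> complex" where
  "scaleC_complex c x = c * x"

definition cinner_complex :: "complex \<Rightarrow> complex \<Rightarrow> complex" where
  "cinner_complex x y = x * cnj y"

instance
  by standard
    (simp_all add: scaleC_complex_def cinner_complex_def inner_complex_def scaleR_conv_of_real algebra_simps)

end

global_interpretation complex_vector: vector_space "scaleC :: complex \<Rightarrow> 'a \<Rightarrow> 'a::complex_inner"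
proof
  fix x :: 'a
  show "1 *\<^sub>C x = x"
    using scaleC_of_real[of 1 x] by simp
qed (simp_all add: scaleC_add_right scaleC_add_left scaleC_scaleC)

lemma cinner_add_right: "cinner x (y + z) = cinner x y + cinner x z"
  by (metis cinner_add_left cinner_commute complex_cnj_add)

lemma cinner_scaleC_right: "cinner x (c *\<^sub>C y) = cnj c * cinner x y"
  by (metis cinner_commute cinner_scaleC_left complex_cnj_mult)

lemma cinner_self: "cinner x x = complex_of_real ((norm x)\<^sup>2)"
proof -
  have "Im (cinner x x) = 0"
    using cinner_commute[of x x] by (metis complex_cnj_cancel_iff complex_cnj_complex_of_real
        complex_is_Real_iff Reals_cnj_iff)
  then show ?thesis
    by (simp add: complex_eq_iff inner_eq_Re_cinner[symmetric] power2_norm_eq_inner)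
qed

lemma Re_cinner_self: "Re (cinner x x) = (norm x)\<^sup>2"
  by (metis cinner_self Re_complex_of_real)

lemma norm_scaleC: "norm (c *\<^sub>C x) = cmod c * norm x"
proof -
  have "complex_of_real ((norm (c *\<^sub>C x))\<^sup>2) = cnj c * (c * cinner x x)"
    by (simp only: cinner_self[symmetric] cinner_scaleC_left cinner_scaleC_right)
  also have "\<dots> = complex_of_real ((cmod c * norm x)\<^sup>2)"
    by (simp add: cinner_self power_mult_distrib complex_norm_square del: of_real_power)
  finally have "(norm (c *\<^sub>C x))\<^sup>2 = (cmod c * norm x)\<^sup>2"
    by (simp only: of_real_eq_iff)
  then show ?thesis
    by simp
qed

lemma norm_cinner_le: "cmod (cinner x y) \<le> norm x * norm y"
proof (cases "cinner x y = 0")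
  case False
  define c where "c = cnj (sgn (cinner x y))"
  have "cinner (c *\<^sub>C x) y = complex_of_real (cmod (cinner x y))"
    using False
    by (simp add: c_def cinner_scaleC_left sgn_eq mult.commute[of "cnj _"] complex_norm_square[symmetric]
        power2_eq_square)
  then have "cmod (cinner x y) = inner (c *\<^sub>C x) y"
    by (simp add: inner_eq_Re_cinner)
  also have "\<dots> \<le> norm (c *\<^sub>C x) * norm y"
    by (rule norm_cauchy_schwarz)
  also have "norm (c *\<^sub>C x) = norm x"
    using False by (simp add: norm_scaleC c_def norm_sgn)
  finally show ?thesis .
qed simp


section \<open>The Hilbert space of square-summable families\<close>

definition square_summable :: "('i \<Rightarrow> 'a::real_normed_vector) \<Rightarrow> bool" where
  "square_summable f \<longleftrightarrow> (\<lambda>i. (norm (f i))\<^sup>2) summable_on UNIV"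

lemma square_summable_zero: "square_summable (\<lambda>_. 0)"
  by (simp add: square_summable_def)

lemma square_summable_add:
  assumes "square_summable f" "square_summable g"
  shows "square_summable (\<lambda>i. f i + g i)"
  unfolding square_summable_def
proof (rule summable_on_comparison_test)
  show "(\<lambda>i. 2 * (norm (f i))\<^sup>2 + 2 * (norm (g i))\<^sup>2) summable_on UNIV"
    using assms unfolding square_summable_def by (intro summable_on_add summable_on_cmult_right)
  show "(norm (f i + g i))\<^sup>2 \<le> 2 * (norm (f i))\<^sup>2 + 2 * (norm (g i))\<^sup>2" for i
  proof -
    have "(norm (f i + g i))\<^sup>2 \<le> (norm (f i) + norm (g i))\<^sup>2"
      by (simp add: norm_triangle_ineq power_mono)
    also have "\<dots> \<le> 2 * (norm (f i))\<^sup>2 + 2 * (norm (g i))\<^sup>2"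
      using zero_le_power2[of "norm (f i) - norm (g i)"]
      by (simp add: power2_sum power2_diff)
    finally show ?thesis .
  qed
qed simp

lemma square_summable_scaleC:
  fixes f :: "'i \<Rightarrow> 'a::complex_inner"
  assumes "square_summable f"
  shows "square_summable (\<lambda>i. c *\<^sub>C f i)"
  using assms by (simp add: square_summable_def norm_scaleC power_mult_distrib summable_on_cmult_right)

lemma square_summable_scaleR:
  assumes "square_summable f"
  shows "square_summable (\<lambda>i. r *\<^sub>R f i)"
  using assms by (simp add: square_summable_def power_mult_distrib summable_on_cmult_right)

lemma square_summable_uminus: "square_summable f \<Longrightarrow> square_summable (\<lambda>i. - f i)"
  by (simp add: square_summable_def)

lemma square_summable_diff:
  "square_summable f \<Longrightarrow> square_summable g \<Longrightarrow> square_summable (\<lambda>i. f i - g i)"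
  using square_summable_add[OF _ square_summable_uminus, of f g] by simp

lemma abs_summable_cinner:
  fixes f g :: "'i \<Rightarrow> 'a::complex_inner"
  assumes "square_summable f" "square_summable g"
  shows "(\<lambda>i. norm (cinner (f i) (g i))) summable_on UNIV"
proof (rule Infinite_Sum.abs_summable_on_comparison_test')
  show "(\<lambda>i. (norm (f i))\<^sup>2 + (norm (g i))\<^sup>2) summable_on UNIV"
    using assms unfolding square_summable_def by (intro summable_on_add)
  show "norm (cinner (f i) (g i)) \<le> (norm (f i))\<^sup>2 + (norm (g i))\<^sup>2" for i
  proof -
    have "norm (cinner (f i) (g i)) \<le> norm (f i) * norm (g i)"
      by (rule norm_cinner_le)
    also have "\<dots> \<le> 2 * (norm (f i) * norm (g i))"
      by simp
    also have "\<dots> \<le> (norm (f i))\<^sup>2 + (norm (g i))\<^sup>2"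
      using zero_le_power2[of "norm (f i) - norm (g i)"] by (simp add: power2_diff)
    finally show ?thesis .
  qed
qed

lemma summable_cinner:
  fixes f g :: "'i \<Rightarrow> 'a::complex_inner"
  assumes "square_summable f" "square_summable g"
  shows "(\<lambda>i. cinner (f i) (g i)) summable_on UNIV"
  using abs_summable_cinner[OF assms] by (rule abs_summable_summable)

typedef (overloaded) ('i, 'a) ell2 = "{f :: 'i \<Rightarrow> 'a::complex_inner. square_summable f}"
  morphisms ell2_nth Abs_ell2
  using square_summable_zero by blast

setup_lifting type_definition_ell2

lemma square_summable_ell2_nth: "square_summable (ell2_nth u)"
  using ell2_nth[of u] by simp

lemma ell2_eqI: "(\<And>i. ell2_nth u i = ell2_nth v i) \<Longrightarrow> u = v"
  by (metis ell2_nth_inject ext)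

instantiation ell2 :: (type, complex_inner) complex_inner
begin

lift_definition zero_ell2 :: "('a, 'b) ell2" is "\<lambda>_. 0"
  by (rule square_summable_zero)

lift_definition plus_ell2 :: "('a, 'b) ell2 \<Rightarrow> ('a, 'b) ell2 \<Rightarrow> ('a, 'b) ell2"
  is "\<lambda>f g i. f i + g i"
  by (rule square_summable_add)

lift_definition minus_ell2 :: "('a, 'b) ell2 \<Rightarrow> ('a, 'b) ell2 \<Rightarrow> ('a, 'b) ell2"
  is "\<lambda>f g i. f i - g i"
  by (rule square_summable_diff)

lift_definition uminus_ell2 :: "('a, 'b) ell2 \<Rightarrow> ('a, 'b) ell2" is "\<lambda>f i. - f i"
  by (rule square_summable_uminus)

lift_definition scaleR_ell2 :: "real \<Rightarrow> ('a, 'b) ell2 \<Rightarrow> ('a, 'b) ell2" is "\<lambda>r f i. r *\<^sub>R f i"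
  by (rule square_summable_scaleR)

lift_definition scaleC_ell2 :: "complex \<Rightarrow> ('a, 'b) ell2 \<Rightarrow> ('a, 'b) ell2" is "\<lambda>c f i. c *\<^sub>C f i"
  by (rule square_summable_scaleC)

definition cinner_ell2 :: "('a, 'b) ell2 \<Rightarrow> ('a, 'b) ell2 \<Rightarrow> complex" where
  "cinner_ell2 u v = (\<Sum>\<^sub>\<infinity>i. cinner (ell2_nth u i) (ell2_nth v i))"

definition inner_ell2 :: "('a, 'b) ell2 \<Rightarrow> ('a, 'b) ell2 \<Rightarrow> real" where
  "inner_ell2 u v = Re (cinner u v)"

definition norm_ell2 :: "('a, 'b) ell2 \<Rightarrow> real" where
  "norm_ell2 u = sqrt (inner u u)"

definition sgn_ell2 :: "('a, 'b) ell2 \<Rightarrow> ('a, 'b) ell2" where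
  "sgn_ell2 u = inverse (norm u) *\<^sub>R u"

definition dist_ell2 :: "('a, 'b) ell2 \<Rightarrow> ('a, 'b) ell2 \<Rightarrow> real" where
  "dist_ell2 u v = norm (u - v)"

definition uniformity_ell2 :: "(('a, 'b) ell2 \<times> ('a, 'b) ell2) filter" where
  "uniformity_ell2 = (INF e\<in>{0<..}. principal {(x, y). dist x y < e})"

definition open_ell2 :: "('a, 'b) ell2 set \<Rightarrow> bool" where
  "open_ell2 S = (\<forall>x\<in>S. \<forall>\<^sub>F (x', y) in uniformity. x' = x \<longrightarrow> y \<in> S)"

instance
proof
  fix u v w :: "('a, 'b) ell2" and r s :: real and c d :: complex
  show "u + v + w = u + (v + w)" "u + v = v + u" "0 + u = u" "- u + u = 0" "u - v = u + - v"
    by (transfer; simp add: algebra_simps)+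
  show "r *\<^sub>R (u + v) = r *\<^sub>R u + r *\<^sub>R v" "(r + s) *\<^sub>R u = r *\<^sub>R u + s *\<^sub>R u"
    "r *\<^sub>R s *\<^sub>R u = (r * s) *\<^sub>R u" "1 *\<^sub>R u = u"
    by (transfer; simp add: algebra_simps)+
  show "c *\<^sub>C (u + v) = c *\<^sub>C u + c *\<^sub>C v" "(c + d) *\<^sub>C u = c *\<^sub>C u + d *\<^sub>C u"
    "c *\<^sub>C d *\<^sub>C u = (c * d) *\<^sub>C u" "complex_of_real r *\<^sub>C u = r *\<^sub>R u"
    by (transfer; simp add: scaleC_add_right scaleC_add_left scaleC_scaleC scaleC_of_real)+
  show sgn: "sgn u = inverse (norm u) *\<^sub>R u" and "dist u v = norm (u - v)"
    "(uniformity :: (('a, 'b) ell2 \<times> ('a, 'b) ell2) filter)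
      = (INF e\<in>{0<..}. principal {(x, y). dist x y < e})"
    by (rule sgn_ell2_def dist_ell2_def uniformity_ell2_def)+
  show "open S \<longleftrightarrow> (\<forall>x\<in>S. \<forall>\<^sub>F (x', y) in uniformity. x' = x \<longrightarrow> y \<in> S)" for S :: "('a, 'b) ell2 set"
    by (rule open_ell2_def)
  note sm = summable_cinner[OF square_summable_ell2_nth square_summable_ell2_nth]
  show cadd: "cinner (u + v) w = cinner u w + cinner v w"
    by (simp add: cinner_ell2_def plus_ell2.rep_eq cinner_add_left infsum_add sm)
  show cscale: "cinner (c *\<^sub>C u) v = c * cinner u v"
    for c and u v :: "('a, 'b) ell2"
    by (simp add: cinner_ell2_def scaleC_ell2.rep_eq cinner_scaleC_left infsum_cmult_right')
  show ccomm: "cinner u v = cnj (cinner v u)" for u v :: "('a, 'b) ell2"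
    unfolding cinner_ell2_def infsum_cnj[symmetric] by (simp add: cinner_commute[symmetric])
  show "inner u v = Re (cinner u v)" "norm u = sqrt (inner u u)"
    by (simp_all add: inner_ell2_def norm_ell2_def)
  show "inner u v = inner v u"
    using ccomm[of u v] by (simp add: inner_ell2_def)
  show "inner (u + v) w = inner u w + inner v w"
    by (simp add: inner_ell2_def cadd)
  have "r *\<^sub>R u = complex_of_real r *\<^sub>C u"
    by (transfer; simp add: scaleC_of_real)
  then show "inner (r *\<^sub>R u) v = r * inner u v"
    by (simp add: inner_ell2_def cscale)
  have self: "inner u u = (\<Sum>\<^sub>\<infinity>i. (norm (ell2_nth u i))\<^sup>2)"
    by (simp add: inner_ell2_def cinner_ell2_def infsum_Re[OF sm, symmetric] Re_cinner_self)
  show "0 \<le> inner u u"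
    unfolding self by (rule infsum_nonneg) simp
  show "inner u u = 0 \<longleftrightarrow> u = 0"
  proof
    assume "inner u u = 0"
    then have "(norm (ell2_nth u i))\<^sup>2 = 0" for i
      using square_summable_ell2_nth[of u] unfolding self square_summable_def
      by (intro nonneg_infsum_le_0D[where A = UNIV]) auto
    then show "u = 0"
      by (intro ell2_eqI) (simp add: zero_ell2.rep_eq)
  next
    assume "u = 0"
    then show "inner u u = 0"
      unfolding self by (simp add: zero_ell2.rep_eq)
  qed
qed

end

lemma norm_ell2_power2: "(norm u)\<^sup>2 = (\<Sum>\<^sub>\<infinity>i. (norm (ell2_nth u i))\<^sup>2)"
  unfolding power2_norm_eq_inner[of u] inner_ell2_def cinner_ell2_def
  by (simp add: Re_cinner_self
      infsum_Re[OF summable_cinner[OF square_summable_ell2_nth square_summable_ell2_nth], symmetric])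

lemma sum_norm_ell2_nth_le: "finite F \<Longrightarrow> (\<Sum>i\<in>F. (norm (ell2_nth u i))\<^sup>2) \<le> (norm u)\<^sup>2"
  unfolding norm_ell2_power2
  using square_summable_ell2_nth[of u] by (intro finite_sum_le_infsum) (auto simp: square_summable_def)

lemma norm_ell2_nth_le: "norm (ell2_nth u i) \<le> norm u"
  using sum_norm_ell2_nth_le[of "{i}" u] by (simp add: power2_le_iff_abs_le)

instance ell2 :: (type, chilbert_space) chilbert_space
proof
  fix X :: "nat \<Rightarrow> ('a, 'b) ell2"
  assume X: "Cauchy X"
  have "\<exists>l. (\<lambda>n. ell2_nth (X n) i) \<longlonglongrightarrow> l" for i
  proof -
    have "Cauchy (\<lambda>n. ell2_nth (X n) i)"
    proof (rule CauchyI)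
      fix e :: real
      assume "0 < e"
      then obtain M where M: "\<And>m n. m \<ge> M \<Longrightarrow> n \<ge> M \<Longrightarrow> norm (X m - X n) < e"
        using CauchyD[OF X] by blast
      have "norm (ell2_nth (X m) i - ell2_nth (X n) i) < e" if "m \<ge> M" "n \<ge> M" for m n
        using norm_ell2_nth_le[of "X m - X n" i] M[OF that] by (simp add: minus_ell2.rep_eq)
      then show "\<exists>M. \<forall>m\<ge>M. \<forall>n\<ge>M. norm (ell2_nth (X m) i - ell2_nth (X n) i) < e"
        by blast
    qed
    then show ?thesis
      by (simp add: Cauchy_convergent_iff convergent_def)
  qed
  then obtain l where l: "\<And>i. (\<lambda>n. ell2_nth (X n) i) \<longlonglongrightarrow> l i"
    by metis
  have bound: "\<exists>M. \<forall>n\<ge>M. \<forall>F. finite F \<longrightarrow> (\<Sum>i\<in>F. (norm (ell2_nth (X n) i - l i))\<^sup>2) \<le> e\<^sup>2"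
    if "0 < e" for e :: real
  proof -
    obtain M where M: "\<And>m n. m \<ge> M \<Longrightarrow> n \<ge> M \<Longrightarrow> norm (X m - X n) < e"
      using CauchyD[OF X \<open>0 < e\<close>] by blast
    have "(\<Sum>i\<in>F. (norm (ell2_nth (X n) i - l i))\<^sup>2) \<le> e\<^sup>2" if "n \<ge> M" "finite F" for n F
    proof (rule tendsto_upperbound)
      show "(\<lambda>m. \<Sum>i\<in>F. (norm (ell2_nth (X n) i - ell2_nth (X m) i))\<^sup>2)
          \<longlonglongrightarrow> (\<Sum>i\<in>F. (norm (ell2_nth (X n) i - l i))\<^sup>2)"
        by (intro tendsto_intros l)
      show "\<forall>\<^sub>F m in sequentially. (\<Sum>i\<in>F. (norm (ell2_nth (X n) i - ell2_nth (X m) i))\<^sup>2) \<le> e\<^sup>2"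
        unfolding eventually_sequentially
      proof (intro exI allI impI)
        fix m
        assume "M \<le> m"
        have "(\<Sum>i\<in>F. (norm (ell2_nth (X n) i - ell2_nth (X m) i))\<^sup>2) \<le> (norm (X n - X m))\<^sup>2"
          using sum_norm_ell2_nth_le[OF \<open>finite F\<close>, of "X n - X m"] by (simp add: minus_ell2.rep_eq)
        also have "\<dots> \<le> e\<^sup>2"
          using M[OF \<open>n \<ge> M\<close> \<open>M \<le> m\<close>] by (intro power_mono) auto
        finally show "(\<Sum>i\<in>F. (norm (ell2_nth (X n) i - ell2_nth (X m) i))\<^sup>2) \<le> e\<^sup>2" .
      qed
    qed simp
    then show ?thesis
      by blast
  qed
  have diff: "square_summable (\<lambda>i. ell2_nth (X n) i - l i)"
    if "\<forall>F. finite F \<longrightarrow> (\<Sum>i\<in>F. (norm (ell2_nth (X n) i - l i))\<^sup>2) \<le> e\<^sup>2" for n and e :: real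
    unfolding square_summable_def
    using that by (intro nonneg_bdd_above_summable_on bdd_aboveI2[where M = "e\<^sup>2"]) auto
  obtain M where "\<forall>F. finite F \<longrightarrow> (\<Sum>i\<in>F. (norm (ell2_nth (X M) i - l i))\<^sup>2) \<le> 1\<^sup>2"
    using bound[of 1] by auto
  from square_summable_diff[OF square_summable_ell2_nth[of "X M"] diff[OF this]]
  have L: "square_summable l"
    by simp
  define L where "L = Abs_ell2 l"
  have nthL: "ell2_nth L = l"
    using L by (simp add: L_def Abs_ell2_inverse)
  have "X \<longlonglongrightarrow> L"
  proof (rule LIMSEQ_I)
    fix r :: real
    assume "0 < r"
    then obtain M where M: "\<And>n F. n \<ge> M \<Longrightarrow> finite F \<Longrightarrow>
        (\<Sum>i\<in>F. (norm (ell2_nth (X n) i - l i))\<^sup>2) \<le> (r / 2)\<^sup>2"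
      using bound[of "r / 2"] by auto
    have "norm (X n - L) < r" if "n \<ge> M" for n
    proof -
      have "(norm (X n - L))\<^sup>2 \<le> (r / 2)\<^sup>2"
        unfolding norm_ell2_power2
        using M[OF that] square_summable_ell2_nth[of "X n - L"]
        by (intro infsum_le_finite_sums) (auto simp: square_summable_def minus_ell2.rep_eq nthL)
      then have "norm (X n - L) \<le> r / 2"
        using \<open>0 < r\<close> by (simp add: power2_le_iff_abs_le)
      then show ?thesis
        using \<open>0 < r\<close> by simp
    qed
    then show "\<exists>no. \<forall>n\<ge>no. norm (X n - L) < r"
      by blast
  qed
  then show "convergent X"
    by (auto simp: convergent_def)
qed


section \<open>Bounded operators\<close>

definition bounded_clinear :: "('a::complex_inner \<Rightarrow> 'b::complex_inner) \<Rightarrow> bool" where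
  "bounded_clinear f \<longleftrightarrow> bounded_linear f \<and> (\<forall>c x. f (c *\<^sub>C x) = c *\<^sub>C f x)"

definition cadjoint :: "('a::complex_inner \<Rightarrow> 'b::complex_inner) \<Rightarrow> 'b \<Rightarrow> 'a" where
  "cadjoint f = (THE g. \<forall>x y. cinner (f x) y = cinner x (g y))"

definition positive_op :: "('a::complex_inner \<Rightarrow> 'a) \<Rightarrow> bool" where
  "positive_op f \<longleftrightarrow> bounded_clinear f \<and> (\<forall>x. cinner (f x) x \<in> \<real>\<^sub>\<ge>\<^sub>0)"

definition sqrt_op :: "('a::complex_inner \<Rightarrow> 'a) \<Rightarrow> 'a \<Rightarrow> 'a" where
  "sqrt_op f = (THE g. positive_op g \<and> g \<circ> g = f)"

definition defect_op :: "('a::complex_inner \<Rightarrow> 'b::complex_inner) \<Rightarrow> 'a \<Rightarrow> 'a" where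
  "defect_op f = sqrt_op (\<lambda>x. x - cadjoint f (f x))"

definition kernel :: "('a \<Rightarrow> 'b::zero) \<Rightarrow> 'a set" where
  "kernel f = {x. f x = 0}"

definition orth_compl :: "'a::complex_inner set \<Rightarrow> 'a set" where
  "orth_compl S = {y. \<forall>x\<in>S. cinner x y = 0}"


section \<open>Unbounded operators\<close>

text \<open>
  A possibly unbounded, partially defined operator is represented by its graph. Then
  \<^const>\<open>Domain\<close> and \<^const>\<open>Range\<close> are its domain and image, \<^const>\<open>converse\<close> its inverse, the
  topological \<^const>\<open>closure\<close> of the graph its closure, and \<open>G O K\<close> is the composition
  "first \<open>G\<close>, then \<open>K\<close>" on its natural domain.
\<close>

definition op_graph :: "('a \<Rightarrow> 'b) \<Rightarrow> ('a \<times> 'b) set" where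
  "op_graph f = {(x, y). y = f x}"

definition restrict_op :: "('a \<times> 'b) set \<Rightarrow> 'a set \<Rightarrow> ('a \<times> 'b) set" where
  "restrict_op G S = {(x, y) \<in> G. x \<in> S}"

definition is_operator :: "('a::complex_inner \<times> 'b::complex_inner) set \<Rightarrow> bool" where
  "is_operator G \<longleftrightarrow> single_valued G \<and> (0, 0) \<in> G
    \<and> (\<forall>x y x' y'. (x, y) \<in> G \<longrightarrow> (x', y') \<in> G \<longrightarrow> (x + x', y + y') \<in> G)
    \<and> (\<forall>c x y. (x, y) \<in> G \<longrightarrow> (c *\<^sub>C x, c *\<^sub>C y) \<in> G)"

definition closable_operator :: "('a::complex_inner \<times> 'b::complex_inner) set \<Rightarrow> bool" where
  "closable_operator G \<longleftrightarrow> is_operator G \<and> is_operator (closure G)"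

text \<open>For densely defined \<open>G\<close> this is the graph of the usual Hilbert space adjoint.\<close>

definition graph_adjoint :: "('a::complex_inner \<times> 'b::complex_inner) set \<Rightarrow> ('b \<times> 'a) set" where
  "graph_adjoint G = {(y, z). \<forall>(x, w)\<in>G. cinner w y = cinner x z}"

definition bounded_operator :: "('a::complex_inner \<times> 'b::complex_inner) set \<Rightarrow> bool" where
  "bounded_operator G \<longleftrightarrow> (\<exists>f. bounded_clinear f \<and> G = op_graph f)"

definition boundedly_invertible :: "('a::complex_inner \<times> 'b::complex_inner) set \<Rightarrow> bool" where
  "boundedly_invertible G \<longleftrightarrow> is_operator G \<and> bounded_operator (G\<inverse>)"


section \<open>Schur class functions and linear systems\<close>

text \<open>Holomorphy with respect to the operator norm, on open sets.\<close>

definition op_holomorphic_on ::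
    "(complex \<Rightarrow> 'u::complex_inner \<Rightarrow> 'y::complex_inner) \<Rightarrow> complex set \<Rightarrow> bool" where
  "op_holomorphic_on F S \<longleftrightarrow> (\<forall>z\<in>S. bounded_clinear (F z)) \<and>
    (\<forall>z\<in>S. \<exists>F'. bounded_clinear F' \<and>
      ((\<lambda>h. onorm (\<lambda>u. inverse h *\<^sub>C (F (z + h) u - F z u) - F' u)) \<longlongrightarrow> 0) (at 0))"

definition schur_class :: "(complex \<Rightarrow> 'u::complex_inner \<Rightarrow> 'y::complex_inner) set" where
  "schur_class = {F. op_holomorphic_on F (ball 0 1) \<and> (\<forall>z\<in>ball 0 1. onorm (F z) \<le> 1)}"

text \<open>
  The inverse of \<open>I - z A\<close> is meaningful only where this operator is bijective, in particular
  for \<open>z\<close> near \<open>0\<close>.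
\<close>

definition transfer_function ::
    "('x::complex_inner \<Rightarrow> 'x) \<Rightarrow> ('u::complex_inner \<Rightarrow> 'x) \<Rightarrow> ('x \<Rightarrow> 'y::complex_inner) \<Rightarrow>
      ('u \<Rightarrow> 'y) \<Rightarrow> complex \<Rightarrow> 'u \<Rightarrow> 'y" where
  "transfer_function A B C D z u = D u + z *\<^sub>C C (inv (\<lambda>x. x - z *\<^sub>C A x) (B u))"

definition has_schur_continuation :: "(complex \<Rightarrow> 'u::complex_inner \<Rightarrow> 'y::complex_inner) \<Rightarrow> bool" where
  "has_schur_continuation G \<longleftrightarrow> (\<exists>F\<in>schur_class. \<forall>\<^sub>F z in nhds 0. F z = G z)"

definition minimal_system ::
    "('x::complex_inner \<Rightarrow> 'x) \<Rightarrow> ('u::complex_inner \<Rightarrow> 'x) \<Rightarrow> ('x \<Rightarrow> 'y::complex_inner) \<Rightarrow> bool" where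
  "minimal_system A B C \<longleftrightarrow>
    closure (complex_vector.span (\<Union>k. range ((A ^^ k) \<circ> B))) = UNIV \<and>
    closure (complex_vector.span (\<Union>k. range ((cadjoint A ^^ k) \<circ> cadjoint C))) = UNIV"


section \<open>Observability and controllability operators\<close>

text \<open>The index set \<open>{-1, -2, \<dots>}\<close>; for \<open>{0, 1, \<dots>}\<close> the type \<^typ>\<open>nat\<close> is used.\<close>

typedef negint = "{n :: int. n < 0}"
  morphisms int_of_negint negint_of_int
  by (rule exI[of _ "-1"]) simp

text \<open>
  Elements of \<^typ>\<open>('i, 'a) ell2\<close> are square-summable, so the domains of the following two graphs
  consist of those \<open>x\<close> for which the displayed sequence is square-summable.
\<close>

definition W_obs :: "('x::complex_inner \<Rightarrow> 'x) \<Rightarrow> ('x \<Rightarrow> 'y::complex_inner) \<Rightarrow>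
    ('x \<times> (nat, 'y) ell2) set" where
  "W_obs A C = {(x, y). \<forall>n. ell2_nth y n = C ((A ^^ n) x)}"

definition W_con_star :: "('x::complex_inner \<Rightarrow> 'x) \<Rightarrow> ('u::complex_inner \<Rightarrow> 'x) \<Rightarrow>
    ('x \<times> (negint, 'u) ell2) set" where
  "W_con_star A B = {(x, u). \<forall>n. ell2_nth u n =
      cadjoint B ((cadjoint A ^^ nat (- int_of_negint n - 1)) x)}"

definition W_con :: "('x::complex_inner \<Rightarrow> 'x) \<Rightarrow> ('u::complex_inner \<Rightarrow> 'x) \<Rightarrow>
    ((negint, 'u) ell2 \<times> 'x) set" where
  "W_con A B = graph_adjoint (W_con_star A B)"

definition W_obs_star :: "('x::complex_inner \<Rightarrow> 'x) \<Rightarrow> ('x \<Rightarrow> 'y::complex_inner) \<Rightarrow>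
    ((nat, 'y) ell2 \<times> 'x) set" where
  "W_obs_star A C = graph_adjoint (W_obs A C)"

definition ell2_exactly_controllable ::
    "('x::complex_inner \<Rightarrow> 'x) \<Rightarrow> ('u::complex_inner \<Rightarrow> 'x) \<Rightarrow> bool" where
  "ell2_exactly_controllable A B \<longleftrightarrow> Range (W_con A B) = UNIV"

definition ell2_exactly_observable ::
    "('x::complex_inner \<Rightarrow> 'x) \<Rightarrow> ('x \<Rightarrow> 'y::complex_inner) \<Rightarrow> bool" where
  "ell2_exactly_observable A C \<longleftrightarrow> Range (W_obs_star A C) = UNIV"

definition ell2_exactly_minimal ::
    "('x::complex_inner \<Rightarrow> 'x) \<Rightarrow> ('u::complex_inner \<Rightarrow> 'x) \<Rightarrow> ('x \<Rightarrow> 'y::complex_inner) \<Rightarrow> bool" where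
  "ell2_exactly_minimal A B C \<longleftrightarrow> ell2_exactly_controllable A B \<and> ell2_exactly_observable A C"


section \<open>Toeplitz operators\<close>

fun markov_param ::
    "('x \<Rightarrow> 'x) \<Rightarrow> ('u \<Rightarrow> 'x) \<Rightarrow> ('x \<Rightarrow> 'y) \<Rightarrow> ('u \<Rightarrow> 'y) \<Rightarrow> nat \<Rightarrow> 'u \<Rightarrow> 'y" where
  "markov_param A B C D 0 = D"
| "markov_param A B C D (Suc n) = C \<circ> (A ^^ n) \<circ> B"

text \<open>
  Both operators are total functions on sequence spaces; they are meaningful when the image
  sequences are square-summable, as is the case for Schur class transfer functions.
\<close>

definition toeplitz_plus ::
    "(nat \<Rightarrow> 'u::complex_inner \<Rightarrow> 'y::complex_inner) \<Rightarrow> (nat, 'u) ell2 \<Rightarrow> (nat, 'y) ell2" where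
  "toeplitz_plus F u = Abs_ell2 (\<lambda>i. \<Sum>j\<le>i. F (i - j) (ell2_nth u j))"

definition toeplitz_minus ::
    "(nat \<Rightarrow> 'u::complex_inner \<Rightarrow> 'y::complex_inner) \<Rightarrow> (negint, 'u) ell2 \<Rightarrow> (negint, 'y) ell2" where
  "toeplitz_minus F u = Abs_ell2 (\<lambda>i. \<Sum>\<^sub>\<infinity>j\<in>{j. int_of_negint j \<le> int_of_negint i}.
      F (nat (int_of_negint i - int_of_negint j)) (ell2_nth u j))"


section \<open>The operators $X_a$, $X_r$, $H_a$ and $H_r$\<close>

definition X_a ::
    "('x::complex_inner \<Rightarrow> 'x) \<Rightarrow> ('u::complex_inner \<Rightarrow> 'x) \<Rightarrow> ('x \<Rightarrow> 'y::complex_inner) \<Rightarrow>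
      ('u \<Rightarrow> 'y) \<Rightarrow> ('x \<times> (nat, 'y) ell2) set" where
  "X_a A B C D =
    (let \<Delta> = defect_op (cadjoint (toeplitz_plus (markov_param A B C D)))
     in THE X. closable_operator X \<and> Domain X = Range (W_con A B) \<and>
          Range X \<subseteq> orth_compl (kernel \<Delta>) \<and>
          restrict_op (W_obs A C) (Range (W_con A B)) = X O op_graph \<Delta>)"

definition X_r ::
    "('x::complex_inner \<Rightarrow> 'x) \<Rightarrow> ('u::complex_inner \<Rightarrow> 'x) \<Rightarrow> ('x \<Rightarrow> 'y::complex_inner) \<Rightarrow>
      ('u \<Rightarrow> 'y) \<Rightarrow> ('x \<times> (negint, 'u) ell2) set" where
  "X_r A B C D =
    (let \<Delta> = defect_op (toeplitz_minus (markov_param A B C D))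
     in THE X. closable_operator X \<and> Domain X = Range (W_obs_star A C) \<and>
          Range X \<subseteq> orth_compl (kernel \<Delta>) \<and>
          restrict_op (W_con_star A B) (Range (W_obs_star A C)) = X O op_graph \<Delta>)"

definition H_a ::
    "('x::complex_inner \<Rightarrow> 'x) \<Rightarrow> ('u::complex_inner \<Rightarrow> 'x) \<Rightarrow> ('x \<Rightarrow> 'y::complex_inner) \<Rightarrow>
      ('u \<Rightarrow> 'y) \<Rightarrow> ('x \<times> 'x) set" where
  "H_a A B C D = closure (X_a A B C D) O graph_adjoint (closure (X_a A B C D))"

definition H_r ::
    "('x::complex_inner \<Rightarrow> 'x) \<Rightarrow> ('u::complex_inner \<Rightarrow> 'x) \<Rightarrow> ('x \<Rightarrow> 'y::complex_inner) \<Rightarrow>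
      ('u \<Rightarrow> 'y) \<Rightarrow> ('x \<times> 'x) set" where
  "H_r A B C D = (closure (X_r A B C D) O graph_adjoint (closure (X_r A B C D)))\<inverse>"

end

theory Submission
  imports Defs "HOL-Complex_Analysis.Cauchy_Integral_Formula"
begin

text \<open>
  Both storage operators arise from one construction. Let \<open>Z v = \<Sum>\<^sub>i A\<^sup>*\<^sup>i C\<^sup>* v\<^sub>i\<close> and
  \<open>Z' u = \<Sum>\<^sub>k A\<^sup>k B u\<^sub>k\<close> on finitely supported sequences. Their adjoints are \<open>W\<^sub>o\<close> and \<open>W\<^sub>c\<^sup>*\<close>, and
  their ranges are dense by minimality. The matrix of \<open>W\<^sub>o Z'\<close> is the Hankel matrix of the Markov
  parameters \<open>F\<^sub>i\<^sub>+\<^sub>k\<^sub>+\<^sub>1\<close>, which together with the Toeplitz matrix of \<open>F\<close> forms a larger Toeplitz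
  matrix. Since the latter is a contraction (\<open>schur_continuation_toeplitz_contractive\<close>, by averaging
  over roots of unity), \<open>\<parallel>W\<^sub>c\<^sup>* Z v\<parallel>\<^sup>2 \<le> \<parallel>v\<parallel>\<^sup>2 - \<parallel>T\<^sup>* v\<parallel>\<^sup>2 = \<parallel>D v\<parallel>\<^sup>2\<close> for the defect operator \<open>D\<close> of
  \<open>T\<^sup>*\<close>, where \<open>T\<close> is the Toeplitz operator of \<open>F\<close> (\<open>finite_synthesis_dominated\<close>). By the Riesz
  theorem this inequality says precisely what is needed to solve \<open>D g = W\<^sub>o x\<close> for \<open>x\<close> in the image
  of \<open>W\<^sub>c\<close>; the solution orthogonal to the kernel of \<open>D\<close> is \<open>g = X\<^sub>a x\<close>. Exchanging the roles of
  \<open>(Z, W\<^sub>o)\<close> and \<open>(Z', W\<^sub>c\<^sup>*)\<close>, and of the symbols \<open>F\<^sub>n\<close> and \<open>F\<^sub>n\<^sup>*\<close>, gives \<open>X\<^sub>r\<close>. The common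
  construction is the locale \<open>defect_factorization\<close>.

  Two consequences of uniform boundedness hold there. If \<open>W\<^sub>c\<close> is onto, then \<open>X\<^sub>a\<close> is defined
  everywhere and bounded, and \<open>X\<^sub>a\<^sup>* X\<^sub>a\<close> is bounded and injective (\<open>bounded_if_range_UNIV\<close>). If
  \<open>W\<^sub>o\<^sup>*\<close> is onto, then \<open>W\<^sub>o\<close> is bounded below, and so is the closure of \<open>X\<^sub>a\<close> because
  \<open>W\<^sub>o x = D X\<^sub>a x\<close> with a contraction \<open>D\<close>; a closed operator that is bounded below has a boundedly
  invertible \<open>X\<^sub>a\<^sup>* X\<^sub>a\<close> (\<open>boundedly_invertible_if_adjoint_range_UNIV\<close>). For \<open>X\<^sub>r\<close> the two
  surjectivity conditions are exchanged, and \<open>H\<^sub>r\<close> is the inverse of \<open>X\<^sub>r\<^sup>* X\<^sub>r\<close>. Hence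
  controllability makes \<open>H\<^sub>a\<close> and \<open>H\<^sub>r\<close> bounded, and observability makes them boundedly invertible.
\<close>


section \<open>Bounded operators on complex Hilbert spaces\<close>

lemma cinner_scaleR_left: "cinner (r *\<^sub>R x) y = r *\<^sub>R cinner x y"
  by (metis cinner_scaleC_left scaleC_of_real scaleR_conv_of_real)

lemma cinner_scaleR_right: "cinner x (r *\<^sub>R y) = r *\<^sub>R cinner x y"
  by (metis cinner_scaleC_right complex_cnj_complex_of_real scaleC_of_real scaleR_conv_of_real)

lemma bounded_bilinear_cinner: "bounded_bilinear cinner"
  by standard (auto simp: cinner_add_left cinner_add_right cinner_scaleR_left cinner_scaleR_right
      intro!: exI[of _ 1] norm_cinner_le)

lemmas cinner_zero_left [simp] = bounded_bilinear.zero_left[OF bounded_bilinear_cinner]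
lemmas cinner_zero_right [simp] = bounded_bilinear.zero_right[OF bounded_bilinear_cinner]
lemmas cinner_diff_left = bounded_bilinear.diff_left[OF bounded_bilinear_cinner]
lemmas cinner_diff_right = bounded_bilinear.diff_right[OF bounded_bilinear_cinner]
lemmas cinner_sum_left = bounded_bilinear.sum_left[OF bounded_bilinear_cinner]
lemmas cinner_sum_right = bounded_bilinear.sum_right[OF bounded_bilinear_cinner]
lemmas tendsto_cinner = bounded_bilinear.tendsto[OF bounded_bilinear_cinner]

lemma continuous_on_cinner [continuous_intros]:
  "continuous_on S f \<Longrightarrow> continuous_on S g \<Longrightarrow> continuous_on S (\<lambda>x. cinner (f x) (g x))"
  unfolding continuous_on_def by (auto intro: tendsto_cinner)

lemma bounded_bilinear_scaleC: "bounded_bilinear (scaleC :: complex \<Rightarrow> 'a \<Rightarrow> 'a::complex_inner)"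
proof
  show "(r *\<^sub>R c) *\<^sub>C x = r *\<^sub>R c *\<^sub>C x" for r c and x :: 'a
    by (metis scaleC_of_real scaleC_scaleC scaleR_conv_of_real)
  show "c *\<^sub>C r *\<^sub>R x = r *\<^sub>R c *\<^sub>C x" for r c and x :: 'a
    by (metis mult.commute scaleC_of_real scaleC_scaleC)
  show "\<exists>K. \<forall>c (x::'a). norm (c *\<^sub>C x) \<le> norm c * norm x * K"
    by (rule exI[of _ 1]) (simp add: norm_scaleC)
qed (simp_all add: scaleC_add_left scaleC_add_right)

lemmas tendsto_scaleC = bounded_bilinear.tendsto[OF bounded_bilinear_scaleC]
lemmas scaleC_scaleR = bounded_bilinear.scaleR_right[OF bounded_bilinear_scaleC]
lemmas scaleC_sum_right = bounded_bilinear.sum_right[OF bounded_bilinear_scaleC]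
lemmas scaleC_diff_right = bounded_bilinear.diff_right[OF bounded_bilinear_scaleC]

lemma cinner_self_eq_0_iff [simp]: "cinner x x = 0 \<longleftrightarrow> x = 0"
  by (simp add: cinner_self)

lemma cinner_eqI:
  assumes "\<And>z. cinner z x = cinner z y"
  shows "x = y"
proof -
  have "cinner (x - y) (x - y) = 0"
    using assms[of "x - y"] by (simp add: cinner_diff_right)
  then show ?thesis
    by simp
qed

text \<open>Orthogonality to \<open>S\<close> is a closed condition, hence passes to the closure of \<open>S\<close>.\<close>

lemma orthogonal_to_dense_eq_0:
  assumes "closure S = UNIV" and "\<And>z. z \<in> S \<Longrightarrow> cinner z x = 0"
  shows "x = 0"
proof -
  have "closed {z. cinner z x = 0}"
    by (intro closed_Collect_eq continuous_intros)
  then have "closure S \<subseteq> {z. cinner z x = 0}"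
    using assms(2) by (intro closure_minimal) auto
  then show ?thesis
    using assms(1) cinner_self_eq_0_iff by blast
qed

lemma bounded_clinear_linear: "bounded_clinear f \<Longrightarrow> bounded_linear f"
  by (simp add: bounded_clinear_def)

lemma bounded_clinear_scaleC: "bounded_clinear f \<Longrightarrow> f (c *\<^sub>C x) = c *\<^sub>C f x"
  by (simp add: bounded_clinear_def)

lemmas bounded_clinear_add = linear_add[OF bounded_linear.linear[OF bounded_clinear_linear]]
lemmas bounded_clinear_diff = linear_diff[OF bounded_linear.linear[OF bounded_clinear_linear]]
lemmas bounded_clinear_zero = linear_0[OF bounded_linear.linear[OF bounded_clinear_linear]]
lemmas bounded_clinear_sum = linear_sum[OF bounded_linear.linear[OF bounded_clinear_linear]]
lemmas bounded_clinear_scaleR = linear_scale[OF bounded_linear.linear[OF bounded_clinear_linear]]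

lemma bounded_clinear_tendsto:
  "bounded_clinear f \<Longrightarrow> (g \<longlongrightarrow> x) F \<Longrightarrow> ((\<lambda>n. f (g n)) \<longlongrightarrow> f x) F"
  by (rule bounded_linear.tendsto[OF bounded_clinear_linear])

lemma bounded_clinear_continuous_on:
  "bounded_clinear f \<Longrightarrow> continuous_on S g \<Longrightarrow> continuous_on S (\<lambda>x. f (g x))"
  by (rule bounded_linear.continuous_on[OF bounded_clinear_linear])

lemma bounded_clinearI:
  assumes "\<And>x y. f (x + y) = f x + f y" and scale: "\<And>c x. f (c *\<^sub>C x) = c *\<^sub>C f x"
    and "\<And>x. norm (f x) \<le> K * norm x"
  shows "bounded_clinear f"
  unfolding bounded_clinear_def
proof (intro conjI allI scale)
  show "bounded_linear f"
    using assms(3) by (intro bounded_linear_intro[of _ K])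
      (auto simp: assms(1) scaleC_of_real[symmetric] scale mult.commute)
qed

lemma bounded_clinear_bound:
  assumes "bounded_clinear f"
  obtains K where "K > 0" and "\<And>x. norm (f x) \<le> K * norm x"
  using bounded_linear.pos_bounded[OF bounded_clinear_linear[OF assms]]
  by (metis mult.commute)

lemma bounded_clinear_ident: "bounded_clinear (\<lambda>x. x)"
  by (rule bounded_clinearI[of _ 1]) auto

lemma bounded_clinear_comp:
  "bounded_clinear f \<Longrightarrow> bounded_clinear g \<Longrightarrow> bounded_clinear (\<lambda>x. f (g x))"
  using bounded_linear_compose[of f g] by (auto simp: bounded_clinear_def)

lemma bounded_clinear_sub:
  "bounded_clinear f \<Longrightarrow> bounded_clinear g \<Longrightarrow> bounded_clinear (\<lambda>x. f x - g x)"
  using bounded_linear_sub[of f g] by (auto simp: bounded_clinear_def scaleC_diff_right)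

lemma bounded_clinear_plus:
  "bounded_clinear f \<Longrightarrow> bounded_clinear g \<Longrightarrow> bounded_clinear (\<lambda>x. f x + g x)"
  using bounded_linear_add[of f g] by (auto simp: bounded_clinear_def scaleC_add_right)

lemma bounded_clinear_half: "bounded_clinear f \<Longrightarrow> bounded_clinear (\<lambda>x. f x /\<^sub>R 2)"
  using bounded_linear_const_scaleR[of f "inverse 2"] by (auto simp: bounded_clinear_def scaleC_scaleR)

lemma bounded_clinear_funpow:
  fixes f :: "'a::complex_inner \<Rightarrow> 'a"
  shows "bounded_clinear f \<Longrightarrow> bounded_clinear (f ^^ n)"
proof (induction n)
  case 0
  have "f ^^ 0 = (\<lambda>x. x)"
    by auto
  then show ?case
    using bounded_clinear_ident by metis
next
  case (Suc n)
  then show ?case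
    using bounded_clinear_comp[of f "f ^^ n"] by (simp add: o_def)
qed


section \<open>Linear relations and the Riesz representation\<close>

text \<open>
  Graphs are handled as linear subspaces of the product space. Single-valuedness is kept apart,
  since for closures and inverses it is the property that has to be proved.
\<close>

definition linear_relation :: "('a::complex_inner \<times> 'b::complex_inner) set \<Rightarrow> bool" where
  "linear_relation G \<longleftrightarrow> (0, 0) \<in> G
    \<and> (\<forall>x y x' y'. (x, y) \<in> G \<longrightarrow> (x', y') \<in> G \<longrightarrow> (x + x', y + y') \<in> G)
    \<and> (\<forall>c x y. (x, y) \<in> G \<longrightarrow> (c *\<^sub>C x, c *\<^sub>C y) \<in> G)"

lemma is_operator_iff: "is_operator G \<longleftrightarrow> single_valued G \<and> linear_relation G"
  by (simp add: is_operator_def linear_relation_def)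

lemma linear_relation_zero: "linear_relation G \<Longrightarrow> (0, 0) \<in> G"
  by (simp add: linear_relation_def)

lemma linear_relation_add:
  "linear_relation G \<Longrightarrow> (x, y) \<in> G \<Longrightarrow> (x', y') \<in> G \<Longrightarrow> (x + x', y + y') \<in> G"
  by (simp add: linear_relation_def)

lemma linear_relation_scaleC:
  "linear_relation G \<Longrightarrow> (x, y) \<in> G \<Longrightarrow> (c *\<^sub>C x, c *\<^sub>C y) \<in> G"
  by (simp add: linear_relation_def)

lemma linear_relation_scaleR:
  "linear_relation G \<Longrightarrow> (x, y) \<in> G \<Longrightarrow> (r *\<^sub>R x, r *\<^sub>R y) \<in> G"
  by (metis linear_relation_scaleC scaleC_of_real)

lemma linear_relation_diff:
  assumes "linear_relation G" "(x, y) \<in> G" "(x', y') \<in> G"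
  shows "(x - x', y - y') \<in> G"
  using linear_relation_add[OF assms(1,2) linear_relation_scaleR[OF assms(1,3), of "-1"]] by simp

lemma linear_relation_single_valuedI:
  assumes "linear_relation G" and "\<And>y. (0, y) \<in> G \<Longrightarrow> y = 0"
  shows "single_valued G"
proof (rule single_valuedI)
  fix x y z
  assume "(x, y) \<in> G" "(x, z) \<in> G"
  from linear_relation_diff[OF assms(1) this] show "y = z"
    using assms(2)[of "y - z"] by simp
qed

lemma linear_relation_closure:
  assumes G: "linear_relation G"
  shows "linear_relation (closure G)"
  unfolding linear_relation_def
proof (intro conjI allI impI)
  show "(0, 0) \<in> closure G"
    using linear_relation_zero[OF G] closure_subset by blast
next
  fix x y x' y'
  assume "(x, y) \<in> closure G" "(x', y') \<in> closure G"
  then obtain p q where p: "\<And>n. p n \<in> G" "p \<longlonglongrightarrow> (x, y)" and q: "\<And>n. q n \<in> G" "q \<longlonglongrightarrow> (x', y')"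
    unfolding closure_sequential by blast
  have "(\<lambda>n. p n + q n) \<longlonglongrightarrow> (x + x', y + y')"
    using tendsto_add[OF p(2) q(2)] by simp
  moreover have "p n + q n \<in> G" for n
    using linear_relation_add[OF G, of "fst (p n)" "snd (p n)" "fst (q n)" "snd (q n)"] p(1) q(1)
    by (simp add: plus_prod_def)
  ultimately show "(x + x', y + y') \<in> closure G"
    unfolding closure_sequential by (intro exI[of _ "\<lambda>n. p n + q n"]) auto
next
  fix c x y
  assume "(x, y) \<in> closure G"
  then obtain p where p: "\<And>n. p n \<in> G" "p \<longlonglongrightarrow> (x, y)"
    unfolding closure_sequential by blast
  have "(\<lambda>n. (c *\<^sub>C fst (p n), c *\<^sub>C snd (p n))) \<longlonglongrightarrow> (c *\<^sub>C x, c *\<^sub>C y)"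
    using tendsto_fst[OF p(2)] tendsto_snd[OF p(2)]
    by (intro tendsto_Pair tendsto_scaleC tendsto_const) auto
  moreover have "(c *\<^sub>C fst (p n), c *\<^sub>C snd (p n)) \<in> G" for n
    using p(1)[of n] linear_relation_scaleC[OF G] by simp
  ultimately show "(c *\<^sub>C x, c *\<^sub>C y) \<in> closure G"
    unfolding closure_sequential
    by (intro exI[of _ "\<lambda>n. (c *\<^sub>C fst (p n), c *\<^sub>C snd (p n))"]) auto
qed

lemma linear_relation_graph_adjoint: "linear_relation (graph_adjoint G)"
  unfolding linear_relation_def graph_adjoint_def
  by (fastforce simp: cinner_add_right cinner_scaleC_right)

lemma linear_relation_converse: "linear_relation G \<Longrightarrow> linear_relation (G\<inverse>)"
  by (auto simp: linear_relation_def)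

lemma linear_relation_relcomp:
  assumes "linear_relation G" and "linear_relation K"
  shows "linear_relation (G O K)"
  unfolding linear_relation_def
proof (intro conjI allI impI)
  show "(0, 0) \<in> G O K"
    by (rule relcompI[OF linear_relation_zero[OF assms(1)] linear_relation_zero[OF assms(2)]])
  show "(x + x', y + y') \<in> G O K" if xy: "(x, y) \<in> G O K" "(x', y') \<in> G O K" for x y x' y'
  proof -
    obtain m m' where "(x, m) \<in> G" "(m, y) \<in> K" "(x', m') \<in> G" "(m', y') \<in> K"
      using xy by blast
    then show ?thesis
      by (intro relcompI[where b = "m + m'"] linear_relation_add[OF assms(1)] linear_relation_add[OF assms(2)])
  qed
  show "(c *\<^sub>C x, c *\<^sub>C y) \<in> G O K" if xy: "(x, y) \<in> G O K" for c x y
  proof -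
    obtain m where "(x, m) \<in> G" "(m, y) \<in> K"
      using xy by blast
    then show ?thesis
      by (rule relcompI[OF linear_relation_scaleC[OF assms(1)] linear_relation_scaleC[OF assms(2)]])
  qed
qed

lemma graph_adjoint_single_valued:
  assumes "closure (Domain G) = UNIV"
  shows "single_valued (graph_adjoint G)"
proof (rule linear_relation_single_valuedI[OF linear_relation_graph_adjoint])
  fix z
  assume "(0, z) \<in> graph_adjoint G"
  then have "cinner x z = 0" if "x \<in> Domain G" for x
    using that by (force simp: graph_adjoint_def)
  then show "z = 0"
    by (rule orthogonal_to_dense_eq_0[OF assms])
qed

lemma quadratic_nonneg_linear_coeff_zero:
  fixes d s :: real
  assumes "0 \<le> s" and "\<And>t. 0 \<le> 2 * t * d + t\<^sup>2 * s"
  shows "d = 0"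
proof (rule ccontr)
  assume "d \<noteq> 0"
  then have "d\<^sup>2 > 0"
    by simp
  \<comment> \<open>Stands in for the minimizer \<open>- d / s\<close>, which is undefined for \<open>s = 0\<close>.\<close>
  define t where "t = - d / (s + 1)"
  have t: "t * (s + 1) = - d"
    using assms(1) by (simp add: t_def)
  have "(2 * t * d + t\<^sup>2 * s) * (s + 1)\<^sup>2 = 2 * (t * (s + 1)) * (s + 1) * d + (t * (s + 1))\<^sup>2 * s"
    by (simp add: power2_eq_square algebra_simps)
  also have "\<dots> = - (d\<^sup>2 * (s + 2))"
    unfolding t by (simp add: power2_eq_square algebra_simps)
  finally have "0 \<le> - (d\<^sup>2 * (s + 2))"
    using assms(2)[of t] by (metis mult_nonneg_nonneg zero_le_power2)
  then show False
    using \<open>d\<^sup>2 > 0\<close> assms(1) by (smt (verit) mult_pos_pos)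
qed

text \<open>
  The Riesz representation theorem for a bounded functional that is given only on a subspace, as
  the linear relation of its values. The representing vector is the limit of a minimizing
  sequence of \<open>\<parallel>x\<parallel>\<^sup>2 - 2 Re c\<close> over the pairs \<open>(x, c)\<close>, so it lies in the closure of the subspace.
\<close>

theorem riesz_representation:
  fixes S :: "('a::chilbert_space \<times> complex) set"
  assumes S: "linear_relation S"
    and bound: "\<And>x c. (x, c) \<in> S \<Longrightarrow> cmod c \<le> M * norm x"
  obtains w where "w \<in> closure (Domain S)" and "\<And>x c. (x, c) \<in> S \<Longrightarrow> c = cinner x w"
proof -
  define J where "J p = (norm (fst p))\<^sup>2 - 2 * Re (snd p)" for p :: "'a \<times> complex"
  have lower: "- (M\<^sup>2) \<le> J p" if "p \<in> S" for p
  proof -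
    have "Re (snd p) \<le> M * norm (fst p)"
      using bound[of "fst p" "snd p"] that complex_Re_le_cmod[of "snd p"] by simp
    then show ?thesis
      using zero_le_power2[of "norm (fst p) - M"] by (simp add: J_def power2_diff mult.commute)
  qed
  define m where "m = Inf (J ` S)"
  have bdd: "bdd_below (J ` S)"
    using lower by (auto intro!: bdd_belowI[of _ "- (M\<^sup>2)"])
  have ne: "J ` S \<noteq> {}"
    using linear_relation_zero[OF S] by auto
  have m_le: "m \<le> J p" if "p \<in> S" for p
    unfolding m_def using bdd that by (intro cInf_lower) auto
  have "\<exists>p\<in>S. J p < m + inverse (real (Suc n))" for n
    using cInf_lessD[OF ne, of "m + inverse (real (Suc n))"] by (auto simp: m_def)
  then obtain p where pS: "\<And>n. p n \<in> S" and pJ: "\<And>n. J (p n) < m + inverse (real (Suc n))"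
    by metis
  have close: "(norm (fst (p n) - fst (p k)))\<^sup>2 \<le> 2 * inverse (real (Suc n)) + 2 * inverse (real (Suc k))"
    for n k
  proof -
    obtain x c where xc: "p n = (x, c)" by fastforce
    obtain y d where yd: "p k = (y, d)" by fastforce
    have "norm ((1/2) *\<^sub>R (x + y)) = norm (x + y) / 2"
      by simp
    then have half: "(norm ((1/2) *\<^sub>R (x + y)))\<^sup>2 = (norm (x + y))\<^sup>2 / 4"
      by (simp only: power_divide) simp
    have "((1/2) *\<^sub>R (x + y), (1/2) *\<^sub>R (c + d)) \<in> S"
      using linear_relation_scaleR[OF S linear_relation_add[OF S]] pS[of n] pS[of k] xc yd by metis
    from m_le[OF this] have "m \<le> (1/4) * (norm (x + y))\<^sup>2 - (Re c + Re d)"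
      unfolding J_def fst_conv snd_conv half by (simp add: add_divide_distrib)
    moreover have "(norm (x + y))\<^sup>2 + (norm (x - y))\<^sup>2 = 2 * (norm x)\<^sup>2 + 2 * (norm y)\<^sup>2"
      by (simp add: power2_norm_eq_inner inner_simps inner_commute)
    ultimately show ?thesis
      using pJ[of n] pJ[of k] xc yd by (simp add: J_def)
  qed
  have "Cauchy (\<lambda>n. fst (p n))"
  proof (rule CauchyI)
    fix e :: real
    assume e: "0 < e"
    then obtain N where N: "inverse (real (Suc N)) < e\<^sup>2 / 4"
      using reals_Archimedean[of "e\<^sup>2 / 4"] by auto
    have "norm (fst (p n) - fst (p k)) < e" if "n \<ge> N" "k \<ge> N" for n k
    proof -
      have "inverse (real (Suc n)) \<le> inverse (real (Suc N))" "inverse (real (Suc k)) \<le> inverse (real (Suc N))"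
        using that by (auto intro!: le_imp_inverse_le)
      then have "(norm (fst (p n) - fst (p k)))\<^sup>2 < e\<^sup>2"
        using close[of n k] N by linarith
      then show ?thesis
        using e by (simp add: power_less_imp_less_base)
    qed
    then show "\<exists>N. \<forall>n\<ge>N. \<forall>k\<ge>N. norm (fst (p n) - fst (p k)) < e"
      by blast
  qed
  then obtain w where w: "(\<lambda>n. fst (p n)) \<longlonglongrightarrow> w"
    using Cauchy_convergent_iff convergent_def by blast
  have "fst (p n) \<in> Domain S" for n
    using pS[of n] by (metis Domain.DomainI prod.collapse)
  then have w_in: "w \<in> closure (Domain S)"
    using w unfolding closure_sequential by (intro exI[of _ "\<lambda>n. fst (p n)"]) auto
  have Jlim: "(\<lambda>n. J (p n)) \<longlonglongrightarrow> m"
  proof (rule tendsto_sandwich[of "\<lambda>_. m" _ _ "\<lambda>n. m + inverse (real (Suc n))"])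
    show "(\<lambda>n. m + inverse (real (Suc n))) \<longlonglongrightarrow> m"
      using tendsto_add[OF tendsto_const LIMSEQ_inverse_real_of_nat, of m] by simp
  qed (auto intro!: eventuallyI m_le pS less_imp_le[OF pJ] simp del: of_nat_Suc)
  have re: "Re c = Re (cinner x w)" if xc: "(x, c) \<in> S" for x c
  proof -
    have "0 \<le> 2 * t * (Re (cinner x w) - Re c) + t\<^sup>2 * (norm x)\<^sup>2" for t
    proof (rule LIMSEQ_le[of "\<lambda>n. m - J (p n)" 0
          "\<lambda>n. 2 * t * (Re (cinner x (fst (p n))) - Re c) + t\<^sup>2 * (norm x)\<^sup>2"])
      show "(\<lambda>n. m - J (p n)) \<longlonglongrightarrow> 0"
        using tendsto_diff[OF tendsto_const Jlim, of m] by simp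
      show "(\<lambda>n. 2 * t * (Re (cinner x (fst (p n))) - Re c) + t\<^sup>2 * (norm x)\<^sup>2)
          \<longlonglongrightarrow> 2 * t * (Re (cinner x w) - Re c) + t\<^sup>2 * (norm x)\<^sup>2"
        by (intro tendsto_intros tendsto_cinner w)
      have "m - J (p n) \<le> 2 * t * (Re (cinner x (fst (p n))) - Re c) + t\<^sup>2 * (norm x)\<^sup>2" for n
      proof -
        obtain y d where yd: "p n = (y, d)" by fastforce
        have "(y + t *\<^sub>R x, d + t *\<^sub>R c) \<in> S"
          using linear_relation_add[OF S _ linear_relation_scaleR[OF S xc]] pS[of n] yd by metis
        from m_le[OF this] have "m \<le> (norm (y + t *\<^sub>R x))\<^sup>2 - 2 * (Re d + t * Re c)"
          by (simp add: J_def)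
        also have "(norm (y + t *\<^sub>R x))\<^sup>2 = (norm y)\<^sup>2 + 2 * t * Re (cinner x y) + t\<^sup>2 * (norm x)\<^sup>2"
          unfolding power2_norm_eq_inner inner_eq_Re_cinner[symmetric]
          by (simp add: inner_add_left inner_add_right inner_commute power2_eq_square)
        finally show ?thesis
          by (simp add: J_def yd algebra_simps)
      qed
      then show "\<exists>N. \<forall>n\<ge>N. m - J (p n)
          \<le> 2 * t * (Re (cinner x (fst (p n))) - Re c) + t\<^sup>2 * (norm x)\<^sup>2"
        by blast
    qed
    from quadratic_nonneg_linear_coeff_zero[OF _ this] show ?thesis
      by simp
  qed
  have "c = cinner x w" if xc: "(x, c) \<in> S" for x c
  proof -
    have "(\<i> *\<^sub>C x, \<i> *\<^sub>C c) \<in> S"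
      by (rule linear_relation_scaleC[OF S xc])
    from re[OF this] re[OF xc] show ?thesis
      by (simp add: complex_eq_iff scaleC_complex_def cinner_scaleC_left)
  qed
  with w_in that show ?thesis
    by blast
qed

text \<open>
  By Baire's theorem, one of the closed sets on which all the functionals are bounded by \<open>n\<close>
  contains a ball.
\<close>

theorem uniform_boundedness:
  fixes S :: "'a::chilbert_space set"
  assumes pointwise: "\<And>z. \<exists>M. \<forall>s\<in>S. cmod (cinner s z) \<le> M"
  obtains K where "K > 0" and "\<And>s. s \<in> S \<Longrightarrow> norm s \<le> K"
proof -
  define E where "E n = {z. \<forall>s\<in>S. cmod (cinner s z) \<le> real n}" for n
  have closed: "closed (E n)" for n
  proof -
    have "E n = (\<Inter>s\<in>S. {z. cmod (cinner s z) \<le> real n})"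
      by (auto simp: E_def)
    then show ?thesis
      by (auto intro!: closed_INT closed_Collect_le continuous_intros)
  qed
  have cover: "\<exists>n. z \<in> E n" for z
  proof -
    obtain M where "\<forall>s\<in>S. cmod (cinner s z) \<le> M"
      using pointwise by blast
    moreover obtain n where "M \<le> real n"
      using real_arch_simple by blast
    ultimately show ?thesis
      by (auto simp: E_def intro: order_trans)
  qed
  have "\<exists>n. interior (E n) \<noteq> {}"
  proof (rule ccontr)
    assume "\<not> ?thesis"
    then have "Met_TC.mtopology interior_of (\<Union>(range E)) = {}"
      using closed complete_UNIV
      by (intro Met_TC.metric_Baire_category_alt) auto
    moreover have "\<Union>(range E) = UNIV"
      using cover by auto
    ultimately show False
      by simp
  qed
  then obtain n z0 where "z0 \<in> interior (E n)"
    by blast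
  then obtain r where r: "r > 0" "ball z0 r \<subseteq> E n"
    using open_contains_ball[of "interior (E n)"] interior_subset by blast
  have "norm s \<le> 4 * real n / r" if "s \<in> S" for s
  proof (cases "s = 0")
    case False
    define h where "h = (r / 2 / norm s) *\<^sub>R s"
    have "norm h = r / 2"
      using False r by (simp add: h_def)
    then have "z0 + h \<in> E n" "z0 \<in> E n"
      using r by (auto simp: dist_norm subset_eq)
    then have "cmod (cinner s (z0 + h)) \<le> real n" "cmod (cinner s z0) \<le> real n"
      using that by (auto simp: E_def)
    moreover have "cinner s h = cinner s (z0 + h) - cinner s z0"
      by (simp add: cinner_add_right)
    ultimately have "cmod (cinner s h) \<le> 2 * real n"
      using norm_triangle_ineq4[of "cinner s (z0 + h)" "cinner s z0"] by simp
    moreover have "cmod (cinner s h) = r / 2 * norm s"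
      using False r by (simp add: h_def cinner_scaleR_right cinner_self norm_mult power2_eq_square)
    ultimately show ?thesis
      using r by (simp add: field_simps)
  qed (use r in simp)
  then have "norm s \<le> 4 * real n / r + 1" if "s \<in> S" for s
    using that by (smt (verit))
  moreover have "4 * real n / r + 1 > 0"
    using r by (smt (verit) divide_nonneg_pos of_nat_0_le_iff)
  ultimately show ?thesis
    using that by blast
qed

lemma cadjoint_unique:
  assumes "\<And>x y. cinner (f x) y = cinner x (g y)"
  shows "cadjoint f = g"
  unfolding cadjoint_def
proof (rule the_equality)
  fix h
  assume "\<forall>x y. cinner (f x) y = cinner x (h y)"
  then have "cinner x (h y) = cinner x (g y)" for x y
    using assms by metis
  then show "h = g"
    using cinner_eqI[of "h _" "g _"] by (intro ext) blast
qed (use assms in blast)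

text \<open>\<open>cadjoint\<close> is a definite description; the Riesz theorem provides the object it describes.\<close>

lemma cinner_cadjoint:
  fixes f :: "'a::chilbert_space \<Rightarrow> 'b::complex_inner"
  assumes f: "bounded_clinear f"
  shows "cinner (f x) y = cinner x (cadjoint f y)"
proof -
  obtain K where K: "\<And>x. norm (f x) \<le> K * norm x"
    using bounded_clinear_bound[OF f] by metis
  have "\<exists>w. \<forall>x. cinner (f x) y = cinner x w" for y
  proof -
    define S where "S = range (\<lambda>x. (x, cinner (f x) y))"
    have "linear_relation S"
      unfolding linear_relation_def S_def
      by (auto simp: bounded_clinear_zero[OF f] bounded_clinear_add[OF f] bounded_clinear_scaleC[OF f]
          cinner_add_left cinner_scaleC_left scaleC_complex_def)
    moreover have "cmod c \<le> (K * norm y) * norm x" if "(x, c) \<in> S" for x c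
    proof -
      have "cmod c \<le> norm (f x) * norm y"
        using that norm_cinner_le by (auto simp: S_def)
      also have "\<dots> \<le> K * norm x * norm y"
        by (intro mult_right_mono K) simp
      finally show ?thesis
        by (simp add: algebra_simps)
    qed
    ultimately obtain w where "\<And>x c. (x, c) \<in> S \<Longrightarrow> c = cinner x w"
      using riesz_representation by metis
    then have "\<forall>x. cinner (f x) y = cinner x w"
      unfolding S_def by blast
    then show ?thesis ..
  qed
  then obtain g where g: "\<And>x y. cinner (f x) y = cinner x (g y)"
    by metis
  then show ?thesis
    using cadjoint_unique[of f g] by simp
qed

lemma cinner_cadjoint_left:
  fixes f :: "'a::chilbert_space \<Rightarrow> 'b::complex_inner"
  assumes "bounded_clinear f"
  shows "cinner (cadjoint f y) x = cinner y (f x)"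
  using cinner_cadjoint[OF assms] by (metis cinner_commute)

lemma norm_cadjoint_le:
  fixes f :: "'a::chilbert_space \<Rightarrow> 'b::complex_inner"
  assumes f: "bounded_clinear f" and K: "\<And>x. norm (f x) \<le> K * norm x" and "0 \<le> K"
  shows "norm (cadjoint f y) \<le> K * norm y"
proof (cases "cadjoint f y = 0")
  case False
  have "(norm (cadjoint f y))\<^sup>2 = cmod (cinner (f (cadjoint f y)) y)"
    by (simp add: cinner_cadjoint[OF f] cinner_self norm_power)
  also have "\<dots> \<le> K * norm (cadjoint f y) * norm y"
    using norm_cinner_le mult_right_mono[OF K norm_ge_zero] order_trans by blast
  finally show ?thesis
    using False by (simp add: power2_eq_square algebra_simps)
qed (use \<open>0 \<le> K\<close> in simp)

lemma bounded_clinear_cadjoint: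
  fixes f :: "'a::chilbert_space \<Rightarrow> 'b::complex_inner"
  assumes f: "bounded_clinear f"
  shows "bounded_clinear (cadjoint f)"
proof -
  obtain K where K: "K > 0" "\<And>x. norm (f x) \<le> K * norm x"
    using bounded_clinear_bound[OF f] by metis
  show ?thesis
  proof (rule bounded_clinearI)
    show "cadjoint f (x + y) = cadjoint f x + cadjoint f y" for x y
      by (rule cinner_eqI) (simp add: cinner_cadjoint[OF f, symmetric] cinner_add_right)
    show "cadjoint f (c *\<^sub>C x) = c *\<^sub>C cadjoint f x" for c x
      by (rule cinner_eqI) (simp add: cinner_cadjoint[OF f, symmetric] cinner_scaleC_right)
    show "norm (cadjoint f x) \<le> K * norm x" for x
      using K by (intro norm_cadjoint_le f) auto
  qed
qed

lemma cadjoint_cadjoint: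
  fixes f :: "'a::chilbert_space \<Rightarrow> 'b::complex_inner"
  assumes "bounded_clinear f"
  shows "cadjoint (cadjoint f) = f"
  by (rule cadjoint_unique) (rule cinner_cadjoint_left[OF assms])


section \<open>Square roots and defect operators\<close>

definition self_adjoint :: "('a::complex_inner \<Rightarrow> 'a) \<Rightarrow> bool" where
  "self_adjoint f \<longleftrightarrow> (\<forall>x y. cinner (f x) y = cinner x (f y))"

text \<open>Over the complex numbers, real diagonal values force self-adjointness, by polarization.\<close>

lemma positive_op_self_adjoint:
  assumes "positive_op f"
  shows "self_adjoint f"
  unfolding self_adjoint_def
proof (intro allI)
  fix x y
  have f: "bounded_clinear f" and pos: "\<And>x. cinner (f x) x \<in> \<real>\<^sub>\<ge>\<^sub>0"
    using assms by (auto simp: positive_op_def)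
  have diag: "cinner (f x) x = cinner x (f x)" for x
    using pos[of x] cinner_commute[of x "f x"] by (auto simp: nonneg_Reals_def)
  have "cinner (f x) y + cinner (f y) x = cinner x (f y) + cinner y (f x)"
    using diag[of "x + y"] diag[of x] diag[of y]
    by (simp add: bounded_clinear_add[OF f] cinner_add_left cinner_add_right add.commute)
  moreover have "\<i> * cinner (f y) x - \<i> * cinner (f x) y = \<i> * cinner y (f x) - \<i> * cinner x (f y)"
    using diag[of "x + \<i> *\<^sub>C y"] diag[of x] diag[of y]
    by (simp add: bounded_clinear_add[OF f] bounded_clinear_scaleC[OF f] cinner_add_left
        cinner_add_right cinner_scaleC_left cinner_scaleC_right algebra_simps)
  then have "cinner (f y) x - cinner (f x) y = cinner y (f x) - cinner x (f y)"
    by (simp add: right_diff_distrib[symmetric])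
  ultimately show "cinner (f x) y = cinner x (f y)"
    unfolding complex_eq_iff plus_complex.sel minus_complex.sel by linarith
qed

lemma positive_op_Re_nonneg: "positive_op f \<Longrightarrow> 0 \<le> Re (cinner (f x) x)"
  by (simp add: positive_op_def complex_nonneg_Reals_iff)

text \<open>
  The form \<open>\<langle>f x, x\<rangle>\<close> is minimal where it vanishes, so its derivative \<open>2 Re \<langle>f x, z\<rangle>\<close> is zero there.
\<close>

lemma positive_op_eq_0:
  assumes "positive_op f" and "Re (cinner (f x) x) = 0"
  shows "f x = 0"
proof -
  have f: "bounded_clinear f"
    using assms by (auto simp: positive_op_def)
  define z where "z = f x"
  have sa: "cinner (f z) x = cnj (cinner (f x) z)"
    using positive_op_self_adjoint[OF assms(1)] cinner_commute[of z "f x"] by (auto simp: self_adjoint_def)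
  have "0 \<le> 2 * t * Re (cinner (f x) z) + t\<^sup>2 * Re (cinner (f z) z)" for t
    using positive_op_Re_nonneg[OF assms(1), of "x + t *\<^sub>R z"] assms(2)
    by (simp add: bounded_clinear_add[OF f] bounded_clinear_scaleR[OF f] cinner_add_left sa
        cinner_add_right cinner_scaleR_left cinner_scaleR_right power2_eq_square algebra_simps)
  then have "Re (cinner (f x) z) = 0"
    by (rule quadratic_nonneg_linear_coeff_zero[rotated]) (rule positive_op_Re_nonneg[OF assms(1)])
  then show ?thesis
    by (simp add: z_def Re_cinner_self)
qed

text \<open>
  The iteration \<open>Y \<mapsto> (P + Y\<^sup>2) / 2\<close> approaches \<open>I - (I - P)\<^bsup>1/2\<^esup>\<close>: a fixed point \<open>S\<close> satisfies
  \<open>(I - S)\<^sup>2 = I - P\<close>. Its scalar counterpart for \<open>P = 1\<close> majorizes norms and increments.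
\<close>

fun sqrt_iter :: "('a::real_vector \<Rightarrow> 'a) \<Rightarrow> nat \<Rightarrow> 'a \<Rightarrow> 'a" where
  "sqrt_iter P 0 x = 0"
| "sqrt_iter P (Suc n) x = (P x + sqrt_iter P n (sqrt_iter P n x)) /\<^sub>R 2"

fun sqrt_iter_bound :: "nat \<Rightarrow> real" where
  "sqrt_iter_bound 0 = 0"
| "sqrt_iter_bound (Suc n) = (1 + (sqrt_iter_bound n)\<^sup>2) / 2"

lemma sqrt_iter_bound_range: "0 \<le> sqrt_iter_bound n \<and> sqrt_iter_bound n \<le> 1"
proof (induction n)
  case (Suc n)
  then have "(sqrt_iter_bound n)\<^sup>2 \<le> 1"
    by (simp add: power_le_one)
  then show ?case
    by simp
qed simp

lemma sqrt_iter_bound_mono: "sqrt_iter_bound n \<le> sqrt_iter_bound (Suc n)"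
proof -
  have "sqrt_iter_bound (Suc n) - sqrt_iter_bound n = (1 - sqrt_iter_bound n)\<^sup>2 / 2"
    by (simp add: power2_eq_square field_simps)
  then show ?thesis
    using zero_le_power2[of "1 - sqrt_iter_bound n"] by linarith
qed

lemma bounded_clinear_sqrt_iter:
  "bounded_clinear P \<Longrightarrow> bounded_clinear (sqrt_iter P n)"
proof (induction n)
  case 0
  then show ?case
    by (intro bounded_clinearI[of _ 0]) auto
next
  case (Suc n)
  have "sqrt_iter P (Suc n) = (\<lambda>x. (P x + sqrt_iter P n (sqrt_iter P n x)) /\<^sub>R 2)"
    by (rule ext) simp
  then show ?case
    using bounded_clinear_half[OF bounded_clinear_plus[OF Suc.prems
          bounded_clinear_comp[OF Suc.IH[OF Suc.prems] Suc.IH[OF Suc.prems]]]] by metis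
qed

text \<open>The iterates are polynomials in \<open>P\<close>, so they commute with whatever commutes with \<open>P\<close>.\<close>

lemma sqrt_iter_commute:
  assumes g: "bounded_clinear g" and "\<And>x. g (P x) = P (g x)"
  shows "g (sqrt_iter P n x) = sqrt_iter P n (g x)"
  by (induction n arbitrary: x)
    (simp_all add: bounded_clinear_zero[OF g] bounded_clinear_scaleR[OF g] bounded_clinear_add[OF g] assms(2))

locale contractive_self_adjoint =
  fixes P :: "'a::chilbert_space \<Rightarrow> 'a"
  assumes P: "bounded_clinear P" and P_sa: "self_adjoint P" and P_le: "norm (P x) \<le> norm x"
begin

abbreviation "Y \<equiv> sqrt_iter P"
abbreviation "q \<equiv> sqrt_iter_bound"

lemmas Y = bounded_clinear_sqrt_iter[OF P]

lemma Y_self_adjoint: "cinner (Y n x) y = cinner x (Y n y)"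
proof (induction n arbitrary: x y)
  case (Suc n)
  then show ?case
    using P_sa by (simp add: self_adjoint_def cinner_scaleR_left cinner_scaleR_right cinner_add_left
        cinner_add_right)
qed simp

lemma Y_commute: "Y m (Y n x) = Y n (Y m x)"
  by (rule sqrt_iter_commute[OF Y]) (rule sqrt_iter_commute[OF P, symmetric], simp)

lemma Y_norm: "norm (Y n x) \<le> q n * norm x"
proof (induction n arbitrary: x)
  case (Suc n)
  have "norm (Y n (Y n x)) \<le> q n * (q n * norm x)"
    by (rule order_trans[OF Suc]) (intro mult_left_mono Suc, use sqrt_iter_bound_range in blast)
  then have "norm (P x + Y n (Y n x)) \<le> norm x + q n * (q n * norm x)"
    using norm_triangle_ineq[of "P x" "Y n (Y n x)"] P_le[of x] by linarith
  moreover have "norm (Y (Suc n) x) = norm (P x + Y n (Y n x)) / 2"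
    unfolding sqrt_iter.simps norm_scaleR by simp
  ultimately show ?case
    by (simp add: power2_eq_square algebra_simps del: sqrt_iter.simps)
qed simp

lemma Y_norm_le: "norm (Y n x) \<le> norm x"
  using Y_norm[of n x] sqrt_iter_bound_range[of n] mult_right_mono[of "q n" 1 "norm x"] by simp

text \<open>
  The iterates commute, hence \<open>2 (Y\<^sub>n\<^sub>+\<^sub>2 - Y\<^sub>n\<^sub>+\<^sub>1) = (Y\<^sub>n\<^sub>+\<^sub>1 + Y\<^sub>n) (Y\<^sub>n\<^sub>+\<^sub>1 - Y\<^sub>n)\<close>, and the scalar iterates
  satisfy the same identity.
\<close>

lemma Y_increment: "norm (Y (Suc n) x - Y n x) \<le> (q (Suc n) - q n) * norm x"
proof (induction n arbitrary: x)
  case 0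
  then show ?case
    using P_le[of x] by simp
next
  case (Suc n)
  define d where "d = Y (Suc n) x - Y n x"
  have "Y (Suc (Suc n)) x - Y (Suc n) x
      = (Y (Suc n) (Y (Suc n) x) - Y n (Y n x)) /\<^sub>R 2"
    using sqrt_iter.simps(2)[of P "Suc n" x] sqrt_iter.simps(2)[of P n x]
    by (simp del: sqrt_iter.simps add: algebra_simps)
  also have "\<dots> = (Y (Suc n) d + Y n d) /\<^sub>R 2"
    unfolding d_def bounded_clinear_diff[OF Y] using Y_commute[of n "Suc n" x]
    by (simp del: sqrt_iter.simps)
  finally have "norm (Y (Suc (Suc n)) x - Y (Suc n) x) = norm (Y (Suc n) d + Y n d) / 2"
    by simp
  also have "\<dots> \<le> (q (Suc n) * norm d + q n * norm d) / 2"
    using norm_triangle_ineq[of "Y (Suc n) d" "Y n d"] Y_norm[of "Suc n" d] Y_norm[of n d] by simp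
  also have "\<dots> = (q (Suc n) + q n) / 2 * norm d"
    by (simp add: algebra_simps)
  also have "\<dots> \<le> (q (Suc n) + q n) / 2 * ((q (Suc n) - q n) * norm x)"
    unfolding d_def using sqrt_iter_bound_range[of n] sqrt_iter_bound_range[of "Suc n"]
    by (intro mult_left_mono Suc) auto
  also have "\<dots> = (q (Suc (Suc n)) - q (Suc n)) * norm x"
    using sqrt_iter_bound.simps(2)[of n] sqrt_iter_bound.simps(2)[of "Suc n"]
    by (simp del: sqrt_iter_bound.simps add: power2_eq_square field_simps)
  finally show ?case .
qed

lemma Y_diff: "m \<ge> n \<Longrightarrow> norm (Y m x - Y n x) \<le> (q m - q n) * norm x"
proof (induction m rule: dec_induct)
  case (step m)
  have "norm (Y (Suc m) x - Y n x) \<le> norm (Y (Suc m) x - Y m x) + norm (Y m x - Y n x)"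
    using norm_triangle_ineq[of "Y (Suc m) x - Y m x" "Y m x - Y n x"] by simp
  also have "\<dots> \<le> (q (Suc m) - q m) * norm x + (q m - q n) * norm x"
    by (intro add_mono Y_increment step)
  finally show ?case
    by (simp add: algebra_simps)
qed simp

lemma Y_convergent: "convergent (\<lambda>n. Y n x)"
proof -
  have "mono q"
    unfolding mono_iff_le_Suc using sqrt_iter_bound_mono by blast
  then have "convergent q"
    using sqrt_iter_bound_range
    by (metis incseq_convergent convergent_def)
  then have "convergent (\<lambda>n. q n * norm x)"
    by (intro convergent_mult convergent_const)
  then have q: "Cauchy (\<lambda>n. q n * norm x)"
    by (rule convergent_Cauchy)
  have "Cauchy (\<lambda>n. Y n x)"
  proof (rule CauchyI)
    fix e :: real
    assume "0 < e"
    then obtain N where N: "\<And>m n. m \<ge> N \<Longrightarrow> n \<ge> N \<Longrightarrow> norm (q m * norm x - q n * norm x) < e"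
      using CauchyD[OF q] by blast
    have *: "norm (Y m x - Y n x) < e" if "n \<ge> N" "m \<ge> n" for m n
    proof -
      have "norm (Y m x - Y n x) \<le> q m * norm x - q n * norm x"
        using Y_diff[OF that(2), of x] by (simp add: left_diff_distrib)
      also have "\<dots> \<le> norm (q m * norm x - q n * norm x)"
        by simp
      also have "\<dots> < e"
        using that by (intro N) auto
      finally show ?thesis .
    qed
    have "norm (Y m x - Y n x) < e" if "n \<ge> N" "m \<ge> N" for m n
      using *[of n m] *[of m n] that by (cases "m \<ge> n") (auto simp: norm_minus_commute)
    then show "\<exists>M. \<forall>m\<ge>M. \<forall>n\<ge>M. norm (Y m x - Y n x) < e"
      by blast
  qed
  then show ?thesis
    by (simp add: Cauchy_convergent_iff)
qed

text \<open>The positive square root of \<open>I - P\<close>.\<close>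

definition defect_root :: "'a \<Rightarrow> 'a" where
  "defect_root x = x - lim (\<lambda>n. Y n x)"

lemma Y_tendsto: "(\<lambda>n. Y n x) \<longlonglongrightarrow> x - defect_root x"
  using Y_convergent[of x] by (simp add: defect_root_def convergent_LIMSEQ_iff)

lemma defect_root_residual_norm: "norm (x - defect_root x) \<le> norm x"
  by (rule LIMSEQ_le_const2[OF tendsto_norm[OF Y_tendsto]]) (use Y_norm_le in blast)

lemma defect_root_tendsto: "(\<lambda>n. x - Y n x) \<longlonglongrightarrow> defect_root x"
  using tendsto_diff[OF tendsto_const Y_tendsto, of x x] by simp

lemma bounded_clinear_defect_root: "bounded_clinear defect_root"
proof (rule bounded_clinearI)
  show "defect_root (x + y) = defect_root x + defect_root y" for x y
    by (rule LIMSEQ_unique[OF defect_root_tendsto])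
      (use tendsto_add[OF defect_root_tendsto[of x] defect_root_tendsto[of y]] in
        \<open>simp add: bounded_clinear_add[OF Y] algebra_simps\<close>)
  show "defect_root (c *\<^sub>C x) = c *\<^sub>C defect_root x" for c x
    by (rule LIMSEQ_unique[OF defect_root_tendsto])
      (use tendsto_scaleC[OF tendsto_const defect_root_tendsto[of x]] in
        \<open>simp add: bounded_clinear_scaleC[OF Y] scaleC_diff_right\<close>)
  show "norm (defect_root x) \<le> 2 * norm x" for x
    using norm_triangle_ineq4[of x "x - defect_root x"] defect_root_residual_norm[of x] by simp
qed

lemma defect_root_self_adjoint: "cinner (defect_root x) y = cinner x (defect_root y)"
proof (rule LIMSEQ_unique)
  show "(\<lambda>n. cinner (x - Y n x) y) \<longlonglongrightarrow> cinner (defect_root x) y"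
    by (intro tendsto_cinner defect_root_tendsto tendsto_const)
  have "(\<lambda>n. cinner x (y - Y n y)) \<longlonglongrightarrow> cinner x (defect_root y)"
    by (intro tendsto_cinner defect_root_tendsto tendsto_const)
  then show "(\<lambda>n. cinner (x - Y n x) y) \<longlonglongrightarrow> cinner x (defect_root y)"
    by (simp add: cinner_diff_left cinner_diff_right Y_self_adjoint)
qed

lemma defect_root_commute:
  assumes g: "bounded_clinear g" and "\<And>x. g (P x) = P (g x)"
  shows "g (defect_root x) = defect_root (g x)"
proof (rule LIMSEQ_unique)
  show "(\<lambda>n. g (x - Y n x)) \<longlonglongrightarrow> g (defect_root x)"
    by (intro bounded_clinear_tendsto[OF g] defect_root_tendsto)
  show "(\<lambda>n. g (x - Y n x)) \<longlonglongrightarrow> defect_root (g x)"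
    using defect_root_tendsto[of "g x"]
    by (simp add: bounded_clinear_diff[OF g] sqrt_iter_commute[of g P, OF g assms(2)])
qed

lemma defect_root_defect_root: "defect_root (defect_root x) = x - P x"
proof -
  define S where "S x = x - defect_root x" for x
  have S: "(\<lambda>n. Y n x) \<longlonglongrightarrow> S x" for x
    using Y_tendsto by (simp add: S_def)
  have "(\<lambda>n. Y n (Y n x - S x)) \<longlonglongrightarrow> 0"
  proof (rule Lim_null_comparison)
    show "\<forall>\<^sub>F n in sequentially. norm (Y n (Y n x - S x)) \<le> norm (Y n x - S x)"
      by (intro eventuallyI Y_norm_le)
    show "(\<lambda>n. norm (Y n x - S x)) \<longlonglongrightarrow> 0"
      using tendsto_norm[OF tendsto_diff[OF S[of x] tendsto_const[of "S x"]]] by simp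
  qed
  from tendsto_add[OF this S[of "S x"]] have "(\<lambda>n. Y n (Y n x)) \<longlonglongrightarrow> S (S x)"
    by (simp add: bounded_clinear_diff[OF Y])
  then have "(\<lambda>n. (P x + Y n (Y n x)) /\<^sub>R 2) \<longlonglongrightarrow> (P x + S (S x)) /\<^sub>R 2"
    by (intro tendsto_intros)
  moreover have "(\<lambda>n. (P x + Y n (Y n x)) /\<^sub>R 2) \<longlonglongrightarrow> S x"
    using LIMSEQ_Suc[OF S[of x]] by simp
  ultimately have "(P x + S (S x)) /\<^sub>R 2 = S x"
    using LIMSEQ_unique by blast
  then have "2 *\<^sub>R ((P x + S (S x)) /\<^sub>R 2) = 2 *\<^sub>R S x"
    by simp
  then have "P x + S (S x) = S x + S x"
    by (simp add: scaleR_2)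
  then show ?thesis
    by (simp add: S_def bounded_clinear_diff[OF bounded_clinear_defect_root] algebra_simps)
qed

text \<open>Positivity follows from \<open>\<langle>(I - R) x, x\<rangle> \<le> \<parallel>x\<parallel>\<^sup>2\<close> for \<open>R = defect_root\<close>, as \<open>I - R\<close> is a contraction.\<close>

lemma positive_defect_root: "positive_op defect_root"
proof -
  have "cinner (defect_root x) x \<in> \<real>\<^sub>\<ge>\<^sub>0" for x
  proof -
    have "cinner (defect_root x) x = cnj (cinner (defect_root x) x)"
      using defect_root_self_adjoint[of x x] cinner_commute[of x "defect_root x"] by simp
    then have "Im (cinner (defect_root x) x) = 0"
      by (metis Reals_cnj_iff complex_is_Real_iff)
    moreover have "Re (cinner (x - defect_root x) x) \<le> norm x * norm x"
      using complex_Re_le_cmod[of "cinner (x - defect_root x) x"] norm_cinner_le[of "x - defect_root x" x]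
        mult_right_mono[OF defect_root_residual_norm[of x] norm_ge_zero[of x]] by linarith
    then have "0 \<le> Re (cinner (defect_root x) x)"
      by (simp add: cinner_diff_left Re_cinner_self power2_eq_square)
    ultimately show ?thesis
      by (simp add: complex_nonneg_Reals_iff)
  qed
  then show ?thesis
    by (simp add: positive_op_def bounded_clinear_defect_root)
qed

text \<open>
  A positive square root \<open>g\<close> commutes with \<open>g\<^sup>2 = I - P\<close>, hence with \<open>R = defect_root\<close>. With
  \<open>y = (R - g) x\<close> this gives \<open>\<langle>R y, y\<rangle> + \<langle>g y, y\<rangle> = \<langle>(R\<^sup>2 - g\<^sup>2) x, y\<rangle> = 0\<close>, so \<open>R y = g y = 0\<close> and
  \<open>\<parallel>y\<parallel>\<^sup>2 = \<langle>(R - g) y, x\<rangle> = 0\<close>.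
\<close>

lemma defect_root_unique:
  assumes g: "positive_op g" and gg: "g \<circ> g = (\<lambda>x. x - P x)"
  shows "g = defect_root"
proof (rule ext)
  fix x
  have lin: "bounded_clinear g"
    using g by (simp add: positive_op_def)
  have gg': "g (g x) = x - P x" for x
    using gg by (metis comp_apply)
  have "g (P x) = P (g x)" for x
  proof -
    have "P x = x - g (g x)" "P (g x) = g x - g (g (g x))"
      using gg'[of x] gg'[of "g x"] by simp_all
    then show ?thesis
      by (simp add: bounded_clinear_diff[OF lin])
  qed
  then have comm: "g (defect_root x) = defect_root (g x)" for x
    by (rule defect_root_commute[OF lin])
  define y where "y = defect_root x - g x"
  have "defect_root y + g y = 0"
    by (simp add: y_def bounded_clinear_diff[OF lin] bounded_clinear_diff[OF bounded_clinear_defect_root]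
        comm defect_root_defect_root gg')
  then have "cinner (defect_root y) y + cinner (g y) y = 0"
    by (metis cinner_add_left cinner_zero_left)
  then have "Re (cinner (defect_root y) y) + Re (cinner (g y) y) = 0"
    by (metis plus_complex.simps(1) zero_complex.simps(1))
  then have "Re (cinner (defect_root y) y) = 0" "Re (cinner (g y) y) = 0"
    using positive_op_Re_nonneg[OF positive_defect_root, of y] positive_op_Re_nonneg[OF g, of y] by linarith+
  then have "defect_root y = 0" "g y = 0"
    using positive_op_eq_0 positive_defect_root g by blast+
  have "cinner y y = cinner (defect_root x) y - cinner (g x) y"
    by (simp add: y_def cinner_diff_left)
  also have "\<dots> = 0"
    using positive_op_self_adjoint[OF g] \<open>defect_root y = 0\<close> \<open>g y = 0\<close>
    by (simp add: self_adjoint_def defect_root_self_adjoint)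
  finally show "g x = defect_root x"
    by (simp add: y_def)
qed

lemma sqrt_op_eq_defect_root: "sqrt_op (\<lambda>x. x - P x) = defect_root"
  unfolding sqrt_op_def
proof (rule the_equality)
  show "positive_op defect_root \<and> defect_root \<circ> defect_root = (\<lambda>x. x - P x)"
    using positive_defect_root defect_root_defect_root by (auto simp: o_def)
qed (use defect_root_unique in blast)

end

theorem defect_op_contraction:
  fixes f :: "'a::chilbert_space \<Rightarrow> 'b::complex_inner"
  assumes f: "bounded_clinear f" and le: "\<And>x. norm (f x) \<le> norm x"
  shows "bounded_clinear (defect_op f)" and "self_adjoint (defect_op f)"
    and "(norm (defect_op f x))\<^sup>2 = (norm x)\<^sup>2 - (norm (f x))\<^sup>2"
proof -
  interpret contractive_self_adjoint "\<lambda>x. cadjoint f (f x)"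
  proof
    show "bounded_clinear (\<lambda>x. cadjoint f (f x))"
      by (rule bounded_clinear_comp[OF bounded_clinear_cadjoint[OF f] f])
    show "self_adjoint (\<lambda>x. cadjoint f (f x))"
      by (simp add: self_adjoint_def cinner_cadjoint[OF f, symmetric] cinner_cadjoint_left[OF f])
    show "norm (cadjoint f (f x)) \<le> norm x" for x
      using norm_cadjoint_le[OF f, of 1 "f x"] le order_trans by fastforce
  qed
  have eq: "defect_op f = defect_root"
    by (simp add: defect_op_def sqrt_op_eq_defect_root)
  show "bounded_clinear (defect_op f)" "self_adjoint (defect_op f)"
    by (simp_all add: eq bounded_clinear_defect_root self_adjoint_def defect_root_self_adjoint)
  have "(norm (defect_root x))\<^sup>2 = Re (cinner (defect_root (defect_root x)) x)"
    by (simp add: defect_root_self_adjoint[of "defect_root x" x] Re_cinner_self)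
  also have "\<dots> = (norm x)\<^sup>2 - (norm (f x))\<^sup>2"
    by (simp add: defect_root_defect_root cinner_diff_left Re_cinner_self cinner_cadjoint_left[OF f])
  finally show "(norm (defect_op f x))\<^sup>2 = (norm x)\<^sup>2 - (norm (f x))\<^sup>2"
    by (simp add: eq)
qed


section \<open>Factorization of an unbounded operator through a defect operator\<close>

lemma closed_orth_compl: "closed (orth_compl S)"
proof -
  have "orth_compl S = (\<Inter>x\<in>S. {y. cinner x y = 0})"
    by (auto simp: orth_compl_def)
  then show ?thesis
    by (auto intro!: closed_INT closed_Collect_eq continuous_intros)
qed

lemma orth_compl_diff:
  "y \<in> orth_compl S \<Longrightarrow> z \<in> orth_compl S \<Longrightarrow> y - z \<in> orth_compl S"
  by (simp add: orth_compl_def cinner_diff_right)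

lemma graph_adjoint_op_graph:
  fixes f :: "'a::chilbert_space \<Rightarrow> 'b::complex_inner"
  assumes f: "bounded_clinear f"
  shows "graph_adjoint (op_graph f) = op_graph (cadjoint f)"
proof -
  have "(\<forall>x. cinner (f x) y = cinner x z) \<longleftrightarrow> z = cadjoint f y" for y z
    using cinner_eqI[of z "cadjoint f y"] by (auto simp: cinner_cadjoint[OF f])
  then show ?thesis
    by (auto simp: graph_adjoint_def op_graph_def)
qed

text \<open>
  For a closed operator \<open>T\<close> that is bounded below, solving \<open>T\<^sup>* T x = z\<close> means representing the
  functional \<open>T x \<mapsto> \<langle>x, z\<rangle>\<close>, which is bounded, by an element of the closed subspace \<open>Ran T\<close>.
\<close>

theorem boundedly_invertible_adjoint_square:
  fixes T :: "('a::chilbert_space \<times> 'b::chilbert_space) set"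
  assumes lin: "linear_relation T" and closed: "closed T" and dense: "closure (Domain T) = UNIV"
    and sv: "single_valued T"
    and below: "\<And>x y. (x, y) \<in> T \<Longrightarrow> norm x \<le> K * norm y" and K: "K > 0"
  shows "boundedly_invertible (T O graph_adjoint T)"
proof -
  define H where "H = T O graph_adjoint T"
  have adj: "cinner w y = cinner x z" if "(x, w) \<in> T" "(y, z) \<in> graph_adjoint T" for x w y z
    using that by (auto simp: graph_adjoint_def)
  have lin_H: "linear_relation H"
    unfolding H_def by (intro linear_relation_relcomp lin linear_relation_graph_adjoint)
  have "single_valued H"
    unfolding H_def by (intro single_valued_relcomp sv graph_adjoint_single_valued dense)
  then have op: "is_operator H"
    using lin_H by (simp add: is_operator_iff)
  have bound: "norm x \<le> K\<^sup>2 * norm z" if xz: "(x, z) \<in> H" for x z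
  proof -
    obtain y where y: "(x, y) \<in> T" "(y, z) \<in> graph_adjoint T"
      using xz by (auto simp: H_def)
    have "norm y * norm y = cmod (cinner x z)"
      using adj[OF y] by (simp add: cinner_self norm_power power2_eq_square norm_mult flip: adj[OF y])
    also have "\<dots> \<le> norm x * norm z"
      by (rule norm_cinner_le)
    also have "\<dots> \<le> K * norm y * norm z"
      by (intro mult_right_mono below y) simp
    finally have "norm y \<le> K * norm z"
      by (cases "y = 0") (use K in \<open>auto simp: algebra_simps\<close>)
    then have "K * norm y \<le> K * (K * norm z)"
      using K by (intro mult_left_mono) auto
    then show ?thesis
      using below[OF y(1)] by (simp add: power2_eq_square algebra_simps)
  qed
  have closed_range: "w \<in> Range T" if w: "w \<in> closure (Range T)" for w
  proof -
    obtain y where y: "\<And>n. y n \<in> Range T" "y \<longlonglongrightarrow> w"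
      using w unfolding closure_sequential by blast
    then obtain x where x: "\<And>n. (x n, y n) \<in> T"
      unfolding Range_iff by metis
    have "Cauchy x"
    proof (rule CauchyI)
      fix e :: real
      assume "0 < e"
      then obtain N where N: "\<And>m n. m \<ge> N \<Longrightarrow> n \<ge> N \<Longrightarrow> norm (y m - y n) < e / K"
        using CauchyD[OF LIMSEQ_imp_Cauchy[OF y(2)], of "e / K"] K by auto
      have "norm (x m - x n) < e" if "m \<ge> N" "n \<ge> N" for m n
      proof -
        have "norm (x m - x n) \<le> K * norm (y m - y n)"
          by (rule below[OF linear_relation_diff[OF lin x x]])
        also have "\<dots> < e"
          using N[OF that] K by (simp add: field_simps)
        finally show ?thesis .
      qed
      then show "\<exists>N. \<forall>m\<ge>N. \<forall>n\<ge>N. norm (x m - x n) < e"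
        by blast
    qed
    then obtain l where "x \<longlonglongrightarrow> l"
      using Cauchy_convergent_iff convergent_def by blast
    then have "(\<lambda>n. (x n, y n)) \<longlonglongrightarrow> (l, w)"
      using y by (intro tendsto_Pair)
    then have "(l, w) \<in> T"
      using closed x by (meson closed_sequentially)
    then show ?thesis
      by blast
  qed
  have onto: "\<exists>x. (x, z) \<in> H" for z
  proof -
    define S where "S = {(y, cinner x z) | x y. (x, y) \<in> T}"
    have "linear_relation S"
      unfolding linear_relation_def
    proof (intro conjI allI impI)
      show "(0, 0) \<in> S"
        using linear_relation_zero[OF lin] by (force simp: S_def)
      show "(y + y', c + c') \<in> S" if yc: "(y, c) \<in> S" "(y', c') \<in> S" for y c y' c'
      proof -
        obtain x x' where "(x, y) \<in> T" "(x', y') \<in> T" "c = cinner x z" "c' = cinner x' z"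
          using yc by (auto simp: S_def)
        then show ?thesis
          using linear_relation_add[OF lin] cinner_add_left[of x x' z]
          unfolding S_def by force
      qed
      show "(k *\<^sub>C y, k *\<^sub>C c) \<in> S" if yc: "(y, c) \<in> S" for k y c
      proof -
        obtain x where "(x, y) \<in> T" "c = cinner x z"
          using yc by (auto simp: S_def)
        then show ?thesis
          using linear_relation_scaleC[OF lin, of x y k] cinner_scaleC_left[of k x z]
          unfolding S_def scaleC_complex_def by force
      qed
    qed
    moreover have "cmod c \<le> (K * norm z) * norm y" if yc: "(y, c) \<in> S" for y c
    proof -
      obtain x where x: "(x, y) \<in> T" "c = cinner x z"
        using yc by (auto simp: S_def)
      have "cmod c \<le> norm x * norm z"
        using x norm_cinner_le by blast
      also have "\<dots> \<le> K * norm y * norm z"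
        by (intro mult_right_mono below x) simp
      finally show ?thesis
        by (simp add: algebra_simps)
    qed
    ultimately obtain w where w: "w \<in> closure (Domain S)" and rep: "\<And>y c. (y, c) \<in> S \<Longrightarrow> c = cinner y w"
      using riesz_representation by metis
    have "Domain S = Range T"
      by (auto simp: S_def)
    then obtain x where x: "(x, w) \<in> T"
      using closed_range[of w] w by (metis Range_iff)
    have "(w, z) \<in> graph_adjoint T"
      using rep by (force simp: S_def graph_adjoint_def)
    then show ?thesis
      using x by (auto simp: H_def)
  qed
  have sv': "single_valued (H\<inverse>)"
    using bound by (intro linear_relation_single_valuedI linear_relation_converse lin_H) fastforce
  obtain f where f: "\<And>z. (f z, z) \<in> H"
    using onto by metis
  have H_eq: "H\<inverse> = op_graph f"
    using f sv' by (auto simp: op_graph_def single_valued_def)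
  then have eqI: "x = f z" if "(x, z) \<in> H" for x z
    using that by (auto simp: op_graph_def)
  have "bounded_clinear f"
    using linear_relation_add[OF lin_H f f] linear_relation_scaleC[OF lin_H f] bound[OF f]
    by (intro bounded_clinearI[of f "K\<^sup>2"]) (auto intro: eqI[symmetric])
  then show ?thesis
    using op H_eq by (auto simp: boundedly_invertible_def bounded_operator_def H_def)
qed

text \<open>
  \<open>Z\<close> is a densely defined operator with dense range and \<open>W\<close> its adjoint. Each \<open>x\<close> in the range
  of \<open>V\<^sup>*\<close> satisfies \<open>|\<langle>z, x\<rangle>| \<le> C\<^sub>x \<parallel>\<Delta> v\<parallel>\<close> for \<open>(v, z) \<in> Z\<close>, by the assumption that
  \<open>\<parallel>V Z v\<parallel> \<le> \<parallel>\<Delta> v\<parallel>\<close>. This is the inequality that puts \<open>W x\<close> into the range of \<open>\<Delta>\<close>.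
\<close>

locale defect_factorization =
  fixes Z :: "('k::chilbert_space \<times> 'x::chilbert_space) set"
    and V :: "('x \<times> 'l::chilbert_space) set" and \<Delta> :: "'k \<Rightarrow> 'k"
  assumes Z: "linear_relation Z"
    and Z_domain: "closure (Domain Z) = UNIV" and Z_range: "closure (Range Z) = UNIV"
    and V_range: "closure (Range (graph_adjoint V)) = UNIV"
    and \<Delta>: "bounded_clinear \<Delta>" and \<Delta>_sa: "self_adjoint \<Delta>" and \<Delta>_le: "norm (\<Delta> v) \<le> norm v"
    and dominated: "(v, z) \<in> Z \<Longrightarrow> \<exists>w. (z, w) \<in> V \<and> norm w \<le> norm (\<Delta> v)"
begin

text \<open>
  \<open>X\<close> solves \<open>\<Delta> (X x) = W x\<close> on \<open>R\<close>. Restricting its values to the orthogonal complement of the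
  kernel of \<open>\<Delta>\<close> makes the solution unique.
\<close>

definition W :: "('x \<times> 'k) set" where
  "W = graph_adjoint Z"

definition R :: "'x set" where
  "R = Range (graph_adjoint V)"

definition X :: "('x \<times> 'k) set" where
  "X = {(x, g). x \<in> R \<and> g \<in> orth_compl (kernel \<Delta>) \<and> (x, \<Delta> g) \<in> W}"

lemma W_iff: "(x, y) \<in> W \<longleftrightarrow> (\<forall>(v, z)\<in>Z. cinner z x = cinner v y)"
  by (simp add: W_def graph_adjoint_def)

lemma W_operator: "linear_relation W" "single_valued W"
  unfolding W_def by (intro linear_relation_graph_adjoint graph_adjoint_single_valued Z_domain)+

lemma \<Delta>_orth_kernel: "\<Delta> ` S \<subseteq> orth_compl (kernel \<Delta>)"
  using \<Delta>_sa by (auto simp: orth_compl_def kernel_def self_adjoint_def)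
    (metis cinner_zero_left)

lemma \<Delta>_eq_0D: "g \<in> orth_compl (kernel \<Delta>) \<Longrightarrow> \<Delta> g = 0 \<Longrightarrow> g = 0"
  by (auto simp: orth_compl_def kernel_def)

lemma \<Delta>_injD:
  assumes "g \<in> orth_compl (kernel \<Delta>)" "g' \<in> orth_compl (kernel \<Delta>)" "\<Delta> g = \<Delta> g'"
  shows "g = g'"
  using \<Delta>_eq_0D[OF orth_compl_diff[OF assms(1,2)]] assms(3)
  by (simp add: bounded_clinear_diff[OF \<Delta>])

text \<open>
  The functional \<open>\<Delta> v \<mapsto> \<langle>z, x\<rangle>\<close>, for \<open>(v, z) \<in> Z\<close>, is well defined and bounded because
  \<open>x = V\<^sup>* p\<close> gives \<open>|\<langle>z, x\<rangle>| = |\<langle>V z, p\<rangle>| \<le> \<parallel>\<Delta> v\<parallel> \<parallel>p\<parallel>\<close>. Its representing vector is the factor.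
\<close>

lemma factor_exists:
  assumes "x \<in> R"
  obtains g where "g \<in> closure (\<Delta> ` Domain Z)" "(x, \<Delta> g) \<in> W"
proof -
  obtain p where p: "(p, x) \<in> graph_adjoint V"
    using assms by (auto simp: R_def)
  define S where "S = {(\<Delta> v, cinner z x) | v z. (v, z) \<in> Z}"
  have "linear_relation S"
    unfolding linear_relation_def
  proof (intro conjI allI impI)
    show "(0, 0) \<in> S"
      using linear_relation_zero[OF Z] bounded_clinear_zero[OF \<Delta>] by (force simp: S_def)
    show "(y + y', c + c') \<in> S" if yc: "(y, c) \<in> S" "(y', c') \<in> S" for y c y' c'
    proof -
      obtain v z v' z' where "(v, z) \<in> Z" "(v', z') \<in> Z" "c = cinner z x" "c' = cinner z' x"
        "y = \<Delta> v" "y' = \<Delta> v'"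
        using yc by (auto simp: S_def)
      then show ?thesis
        using linear_relation_add[OF Z, of v z v' z'] cinner_add_left[of z z' x]
          bounded_clinear_add[OF \<Delta>, of v v'] unfolding S_def by force
    qed
    show "(k *\<^sub>C y, k *\<^sub>C c) \<in> S" if yc: "(y, c) \<in> S" for k y c
    proof -
      obtain v z where "(v, z) \<in> Z" "c = cinner z x" "y = \<Delta> v"
        using yc by (auto simp: S_def)
      then show ?thesis
        using linear_relation_scaleC[OF Z, of v z k] cinner_scaleC_left[of k z x]
          bounded_clinear_scaleC[OF \<Delta>, of k v] unfolding S_def scaleC_complex_def by force
    qed
  qed
  moreover have "cmod c \<le> norm p * norm y" if yc: "(y, c) \<in> S" for y c
  proof -
    obtain v z where v: "(v, z) \<in> Z" "c = cinner z x" "y = \<Delta> v"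
      using yc by (auto simp: S_def)
    obtain w where w: "(z, w) \<in> V" "norm w \<le> norm (\<Delta> v)"
      using dominated[OF v(1)] by blast
    have "c = cinner w p"
      using p w(1) v(2) by (auto simp: graph_adjoint_def)
    then have "cmod c \<le> norm w * norm p"
      using norm_cinner_le by blast
    also have "\<dots> \<le> norm (\<Delta> v) * norm p"
      by (intro mult_right_mono w) simp
    finally show ?thesis
      by (simp add: v(3) mult.commute)
  qed
  ultimately obtain g where g: "g \<in> closure (Domain S)" and rep: "\<And>y c. (y, c) \<in> S \<Longrightarrow> c = cinner y g"
    using riesz_representation by metis
  have "Domain S = \<Delta> ` Domain Z"
    by (auto simp: S_def)
  moreover have "cinner z x = cinner v (\<Delta> g)" if "(v, z) \<in> Z" for v z
    using rep[of "\<Delta> v" "cinner z x"] that \<Delta>_sa by (auto simp: S_def self_adjoint_def)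
  then have "(x, \<Delta> g) \<in> W"
    by (auto simp: W_iff)
  ultimately show ?thesis
    using that g by simp
qed

lemma closure_image_orth_kernel: "closure (\<Delta> ` S) \<subseteq> orth_compl (kernel \<Delta>)"
  by (rule closure_minimal[OF \<Delta>_orth_kernel closed_orth_compl])

lemma linear_relation_X: "linear_relation X"
  unfolding linear_relation_def
proof (intro conjI allI impI)
  note lin_V = linear_relation_graph_adjoint[of V]
  show "(0, 0) \<in> X"
    using linear_relation_zero[OF lin_V] linear_relation_zero[OF W_operator(1)]
    by (auto simp: X_def R_def orth_compl_def bounded_clinear_zero[OF \<Delta>])
  show "(x + x', g + g') \<in> X" if xg: "(x, g) \<in> X" "(x', g') \<in> X" for x g x' g'
  proof -
    obtain p p' where "(p, x) \<in> graph_adjoint V" "(p', x') \<in> graph_adjoint V"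
      using xg by (auto simp: X_def R_def)
    from linear_relation_add[OF lin_V this] have "x + x' \<in> R"
      by (auto simp: R_def)
    then show ?thesis
      using xg linear_relation_add[OF W_operator(1), of x "\<Delta> g" x' "\<Delta> g'"]
      by (simp add: X_def orth_compl_def cinner_add_right bounded_clinear_add[OF \<Delta>])
  qed
  show "(c *\<^sub>C x, c *\<^sub>C g) \<in> X" if xg: "(x, g) \<in> X" for c x g
  proof -
    obtain p where "(p, x) \<in> graph_adjoint V"
      using xg by (auto simp: X_def R_def)
    from linear_relation_scaleC[OF lin_V this, of c] have "c *\<^sub>C x \<in> R"
      by (auto simp: R_def)
    then show ?thesis
      using xg linear_relation_scaleC[OF W_operator(1), of x "\<Delta> g" c]
      by (simp add: X_def orth_compl_def cinner_scaleC_right bounded_clinear_scaleC[OF \<Delta>])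
  qed
qed

lemma Domain_X: "Domain X = R"
proof
  show "R \<subseteq> Domain X"
  proof
    fix x
    assume "x \<in> R"
    moreover obtain g where "g \<in> closure (\<Delta> ` Domain Z)" "(x, \<Delta> g) \<in> W"
      using factor_exists \<open>x \<in> R\<close> by blast
    ultimately show "x \<in> Domain X"
      using closure_image_orth_kernel by (auto simp: X_def)
  qed
qed (auto simp: X_def)

text \<open>
  The equation \<open>\<Delta> g = W x\<close> says that \<open>\<langle>z, x\<rangle> = \<langle>v, \<Delta> g\<rangle>\<close> on \<open>Z\<close>, a condition that is closed in
  \<open>(x, g)\<close>. So it survives in the closure of \<open>X\<close>, where it still determines \<open>g\<close>.
\<close>

lemma closure_XD:
  assumes "(x, g) \<in> closure X"
  shows "g \<in> orth_compl (kernel \<Delta>)" and "(x, \<Delta> g) \<in> W"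
proof -
  have "closed {p. snd p \<in> orth_compl (kernel \<Delta>)}"
    using closed_vimage[OF closed_orth_compl continuous_on_snd[OF continuous_on_id]]
    by (simp add: vimage_def)
  then have "closure X \<subseteq> {p. snd p \<in> orth_compl (kernel \<Delta>)}"
    by (intro closure_minimal) (auto simp: X_def)
  then show "g \<in> orth_compl (kernel \<Delta>)"
    using assms by auto
  have "cinner z x = cinner v (\<Delta> g)" if "(v, z) \<in> Z" for v z
  proof -
    have "closed {p. cinner z (fst p) = cinner v (\<Delta> (snd p))}"
      by (intro closed_Collect_eq continuous_intros bounded_clinear_continuous_on[OF \<Delta>])
    then have "closure X \<subseteq> {p. cinner z (fst p) = cinner v (\<Delta> (snd p))}"
      using that by (intro closure_minimal) (auto simp: X_def W_iff)
    then show ?thesis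
      using assms by auto
  qed
  then show "(x, \<Delta> g) \<in> W"
    by (auto simp: W_iff)
qed

lemma single_valued_closure_X: "single_valued (closure X)"
proof (rule single_valuedI)
  fix x g g'
  assume "(x, g) \<in> closure X" "(x, g') \<in> closure X"
  then show "g = g'"
    using closure_XD \<Delta>_injD single_valuedD[OF W_operator(2)] by metis
qed

lemma closable_X: "closable_operator X"
  using single_valued_closure_X linear_relation_X linear_relation_closure[OF linear_relation_X]
    single_valued_subset[OF closure_subset[of X]]
  by (auto simp: closable_operator_def is_operator_iff)

theorem X_eq_THE:
  "(THE X. closable_operator X \<and> Domain X = R \<and> Range X \<subseteq> orth_compl (kernel \<Delta>) \<and>
      restrict_op W R = X O op_graph \<Delta>) = X"
proof (rule the_equality)
  have "restrict_op W R \<subseteq> X O op_graph \<Delta>"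
  proof (clarsimp simp: restrict_op_def)
    fix x y
    assume xy: "(x, y) \<in> W" "x \<in> R"
    then obtain g where g: "(x, g) \<in> X"
      using Domain_X by blast
    then have "y = \<Delta> g"
      using xy single_valuedD[OF W_operator(2)] by (auto simp: X_def)
    then show "(x, y) \<in> X O op_graph \<Delta>"
      using g by (auto simp: op_graph_def)
  qed
  then show "closable_operator X \<and> Domain X = R \<and> Range X \<subseteq> orth_compl (kernel \<Delta>) \<and>
      restrict_op W R = X O op_graph \<Delta>"
    using closable_X Domain_X by (auto simp: X_def restrict_op_def op_graph_def)
next
  fix X'
  assume X': "closable_operator X' \<and> Domain X' = R \<and> Range X' \<subseteq> orth_compl (kernel \<Delta>) \<and>
      restrict_op W R = X' O op_graph \<Delta>"
  have sub: "(x, g) \<in> X" if "(x, g) \<in> X'" for x g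
  proof -
    have "(x, \<Delta> g) \<in> restrict_op W R"
      using X' that by (auto simp: op_graph_def)
    then show ?thesis
      using X' that by (auto simp: X_def restrict_op_def)
  qed
  have "(x, g) \<in> X'" if xg: "(x, g) \<in> X" for x g
  proof -
    obtain g' where g': "(x, g') \<in> X'"
      using X' xg Domain_X by blast
    have "g' = g"
      using sub[OF g'] xg closable_X by (auto simp: closable_operator_def is_operator_iff dest: single_valuedD)
    with g' show ?thesis
      by simp
  qed
  then show "X' = X"
    using sub by auto
qed

abbreviation H :: "('x \<times> 'x) set" where
  "H \<equiv> closure X O graph_adjoint (closure X)"

text \<open>
  If \<open>V\<^sup>*\<close> is onto, \<open>X\<close> is defined everywhere. The vectors \<open>z\<close> with \<open>(v, z) \<in> Z\<close> and
  \<open>\<parallel>\<Delta> v\<parallel> \<le> 1\<close> represent the functionals \<open>x \<mapsto> \<langle>\<Delta> v, X x\<rangle>\<close>, which are bounded pointwise by \<open>\<parallel>X x\<parallel>\<close>.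
  Uniform boundedness turns this into a bound on \<open>X\<close>. Moreover \<open>H x = 0\<close> means \<open>X x = 0\<close>, so \<open>x\<close>
  is orthogonal to the dense range of \<open>Z\<close>.
\<close>

theorem bounded_if_range_UNIV:
  assumes R: "R = UNIV"
  shows "bounded_operator H" and "is_operator (H\<inverse>)"
proof -
  define S where "S = {z. \<exists>v. (v, z) \<in> Z \<and> norm (\<Delta> v) \<le> 1}"
  have ex: "\<exists>g. g \<in> closure (\<Delta> ` Domain Z) \<and> (x, \<Delta> g) \<in> W" for x
    using factor_exists[of x] R by auto
  then obtain f where f: "\<And>x. f x \<in> closure (\<Delta> ` Domain Z)" and fW: "\<And>x. (x, \<Delta> (f x)) \<in> W"
    by metis
  have pair: "cinner z x = cinner (\<Delta> v) (f x)" if "(v, z) \<in> Z" for v z x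
    using fW[of x] that \<Delta>_sa by (auto simp: W_iff self_adjoint_def)
  have "\<exists>M. \<forall>z\<in>S. cmod (cinner z x) \<le> M" for x
  proof (intro exI[of _ "norm (f x)"] ballI)
    fix z
    assume "z \<in> S"
    then obtain v where v: "(v, z) \<in> Z" "norm (\<Delta> v) \<le> 1"
      by (auto simp: S_def)
    have "cmod (cinner z x) \<le> norm (\<Delta> v) * norm (f x)"
      using pair[OF v(1)] norm_cinner_le by simp
    then show "cmod (cinner z x) \<le> norm (f x)"
      using mult_right_mono[OF v(2) norm_ge_zero[of "f x"]] by simp
  qed
  then obtain K where K: "K > 0" "\<And>z. z \<in> S \<Longrightarrow> norm z \<le> K"
    using uniform_boundedness by blast
  have Z_le: "norm z \<le> K * norm (\<Delta> v)" if vz: "(v, z) \<in> Z" for v z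
  proof (cases "\<Delta> v = 0")
    case True
    then have "cinner z z = 0"
      using pair[OF vz, of z] by simp
    then show ?thesis
      using True by simp
  next
    case False
    define r where "r = inverse (norm (\<Delta> v))"
    have "(r *\<^sub>R v, r *\<^sub>R z) \<in> Z"
      by (rule linear_relation_scaleR[OF Z vz])
    then have "r *\<^sub>R z \<in> S"
      using False by (auto simp: S_def bounded_clinear_scaleR[OF \<Delta>] r_def)
    from K(2)[OF this] show ?thesis
      using False by (simp add: r_def field_simps)
  qed
  have f_le: "norm (f x) \<le> K * norm x" for x
  proof -
    have "\<Delta> ` Domain Z \<subseteq> {q. cmod (cinner q (f x)) \<le> K * norm q * norm x}"
    proof clarsimp
      fix v z
      assume vz: "(v, z) \<in> Z"
      have "cmod (cinner (\<Delta> v) (f x)) \<le> norm z * norm x"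
        using pair[OF vz, of x] norm_cinner_le by metis
      also have "\<dots> \<le> K * norm (\<Delta> v) * norm x"
        by (intro mult_right_mono Z_le vz) simp
      finally show "cmod (cinner (\<Delta> v) (f x)) \<le> K * norm (\<Delta> v) * norm x" .
    qed
    moreover have "closed {q. cmod (cinner q (f x)) \<le> K * norm q * norm x}"
      by (intro closed_Collect_le continuous_intros)
    ultimately have "closure (\<Delta> ` Domain Z) \<subseteq> {q. cmod (cinner q (f x)) \<le> K * norm q * norm x}"
      by (rule closure_minimal)
    then have "cmod (cinner (f x) (f x)) \<le> K * norm (f x) * norm x"
      using f by blast
    then show ?thesis
      using K(1) by (cases "f x = 0") (simp_all add: cinner_self norm_mult power2_eq_square algebra_simps)
  qed
  have fX: "(x, f x) \<in> X" for x
    using fW f closure_image_orth_kernel R by (auto simp: X_def)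
  then have f_cl: "(x, f x) \<in> closure X" for x
    using closure_subset by blast
  have cl_eq: "closure X = op_graph f"
    using f_cl single_valuedD[OF single_valued_closure_X _ f_cl] by (auto simp: op_graph_def)
  have eqI: "y = f x" if "(x, y) \<in> X" for x y
    using that cl_eq closure_subset[of X] by (auto simp: op_graph_def)
  have f_lin: "bounded_clinear f"
    using linear_relation_add[OF linear_relation_X fX fX] linear_relation_scaleC[OF linear_relation_X fX] f_le
    by (intro bounded_clinearI[of f K]) (auto intro: eqI[symmetric])
  have H_eq: "H = op_graph (\<lambda>x. cadjoint f (f x))"
    unfolding cl_eq graph_adjoint_op_graph[OF f_lin] by (auto simp: op_graph_def)
  have lin: "bounded_clinear (\<lambda>x. cadjoint f (f x))"
    by (rule bounded_clinear_comp[OF bounded_clinear_cadjoint[OF f_lin] f_lin])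
  then show "bounded_operator H"
    using H_eq by (auto simp: bounded_operator_def)
  have lin_H: "linear_relation H"
    by (intro linear_relation_relcomp linear_relation_closure linear_relation_X linear_relation_graph_adjoint)
  have "x = 0" if x: "(x, 0) \<in> H" for x
  proof -
    have "cadjoint f (f x) = 0"
      using x by (simp add: H_eq op_graph_def)
    then have "cinner (f x) (f x) = 0"
      using cinner_cadjoint[OF f_lin, of x "f x"] by simp
    then have "f x = 0"
      by simp
    have "cinner z x = 0" if "z \<in> Range Z" for z
      using that pair[of _ z x] \<open>f x = 0\<close> by auto
    then show ?thesis
      by (rule orthogonal_to_dense_eq_0[OF Z_range])
  qed
  then have "single_valued (H\<inverse>)"
    by (intro linear_relation_single_valuedI linear_relation_converse lin_H) auto
  then show "is_operator (H\<inverse>)"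
    using linear_relation_converse[OF lin_H] by (simp add: is_operator_iff)
qed

text \<open>
  If \<open>W\<^sup>*\<close> is onto, uniform boundedness makes \<open>W\<close> bounded below; since \<open>W = \<Delta> X\<close> with \<open>\<Delta>\<close> a
  contraction, so is the closure of \<open>X\<close>.
\<close>

theorem boundedly_invertible_if_adjoint_range_UNIV:
  assumes onto: "Range (graph_adjoint W) = UNIV"
  shows "boundedly_invertible H"
proof -
  define S where "S = {x. \<exists>y. (x, y) \<in> W \<and> norm y \<le> 1}"
  have "\<exists>M. \<forall>x\<in>S. cmod (cinner x z) \<le> M" for z
  proof -
    obtain p where p: "(p, z) \<in> graph_adjoint W"
      using onto by blast
    have "cmod (cinner x z) \<le> norm p" if xS: "x \<in> S" for x
    proof -
      obtain y where y: "(x, y) \<in> W" "norm y \<le> 1"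
        using xS by (auto simp: S_def)
      have "cinner x z = cinner y p"
        using p y(1) by (auto simp: graph_adjoint_def)
      then show ?thesis
        using norm_cinner_le[of y p] mult_right_mono[OF y(2) norm_ge_zero[of p]] by simp
    qed
    then show ?thesis
      by blast
  qed
  then obtain K where K: "K > 0" "\<And>x. x \<in> S \<Longrightarrow> norm x \<le> K"
    using uniform_boundedness by blast
  have W_below: "norm x \<le> K * norm y" if xy: "(x, y) \<in> W" for x y
  proof (cases "y = 0")
    case True
    then have "cinner z x = 0" if "z \<in> Range Z" for z
      using xy that by (force simp: W_iff)
    then have "x = 0"
      by (rule orthogonal_to_dense_eq_0[OF Z_range])
    then show ?thesis
      using K(1) by simp
  next
    case False
    have "(inverse (norm y) *\<^sub>R x, inverse (norm y) *\<^sub>R y) \<in> W"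
      by (rule linear_relation_scaleR[OF W_operator(1) xy])
    then have "inverse (norm y) *\<^sub>R x \<in> S"
      using False by (auto simp: S_def)
    from K(2)[OF this] show ?thesis
      using False by (simp add: field_simps)
  qed
  have below: "norm x \<le> K * norm g" if "(x, g) \<in> closure X" for x g
  proof -
    have "norm x \<le> K * norm (\<Delta> g)"
      by (rule W_below[OF closure_XD(2)[OF that]])
    also have "\<dots> \<le> K * norm g"
      using K(1) \<Delta>_le by simp
    finally show ?thesis .
  qed
  have "R \<subseteq> Domain (closure X)"
    using Domain_X closure_subset by blast
  then have "closure (Domain (closure X)) = UNIV"
    using V_range closure_mono unfolding R_def by blast
  then show ?thesis
    using linear_relation_closure[OF linear_relation_X] single_valued_closure_X below K(1)
    by (intro boundedly_invertible_adjoint_square[of _ K]) auto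
qed

end


section \<open>Square-summable sequences\<close>

lemma bounded_clinear_ell2_nth: "bounded_clinear (\<lambda>u :: ('i, 'a::complex_inner) ell2. ell2_nth u i)"
  by (rule bounded_clinearI[of _ 1]) (simp_all add: plus_ell2.rep_eq scaleC_ell2.rep_eq norm_ell2_nth_le)

text \<open>An index set is used through an enumeration \<open>e\<close>, so that partial sums make sense.\<close>

lemma ell2_of_bounded_sums:
  fixes e :: "nat \<Rightarrow> 'i" and f :: "nat \<Rightarrow> 'a::complex_inner"
  assumes e: "bij e" and M: "\<And>N. (\<Sum>k<N. (norm (f k))\<^sup>2) \<le> M"
  obtains w :: "('i, 'a) ell2" where "\<And>k. ell2_nth w (e k) = f k" and "(norm w)\<^sup>2 \<le> M"
proof -
  define g where "g i = f (inv e i)" for i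
  have g_e: "g (e k) = f k" for k
    using e by (simp add: g_def bij_is_inj)
  have fin: "sum (\<lambda>k. (norm (f k))\<^sup>2) F \<le> M" if "finite F" for F
  proof -
    obtain N where "F \<subseteq> {..<N}"
      using \<open>finite F\<close> finite_nat_bounded by blast
    then have "sum (\<lambda>k. (norm (f k))\<^sup>2) F \<le> (\<Sum>k<N. (norm (f k))\<^sup>2)"
      by (intro sum_mono2) auto
    then show ?thesis
      using M[of N] by linarith
  qed
  have summ: "(\<lambda>k. (norm (f k))\<^sup>2) summable_on UNIV"
    using fin by (intro nonneg_bdd_above_summable_on) (auto intro!: bdd_aboveI[of _ M])
  have reindex: "(\<lambda>k. (norm (g (e k)))\<^sup>2) summable_on UNIV \<longleftrightarrow> (\<lambda>i. (norm (g i))\<^sup>2) summable_on UNIV"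
    using e by (intro summable_on_reindex_bij_betw)
  have ss: "square_summable g"
    using summ reindex by (simp add: square_summable_def g_e)
  define w where "w = Abs_ell2 g"
  have w: "ell2_nth w = g"
    using ss by (simp add: w_def Abs_ell2_inverse)
  have "(norm w)\<^sup>2 = (\<Sum>\<^sub>\<infinity>k. (norm (f k))\<^sup>2)"
    unfolding norm_ell2_power2 w using infsum_reindex_bij_betw[OF e, of "\<lambda>i. (norm (g i))\<^sup>2"]
    by (simp add: g_e)
  also have "\<dots> \<le> M"
    using fin summ by (intro infsum_le_finite_sums) auto
  finally show ?thesis
    using that[of w] by (simp add: w g_e)
qed

lemma cinner_ell2_finite_support:
  fixes e :: "nat \<Rightarrow> 'i" and v :: "('i, 'a::complex_inner) ell2"
  assumes e: "bij e" and "\<And>k. k \<ge> N \<Longrightarrow> ell2_nth v (e k) = 0"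
  shows "cinner v w = (\<Sum>k<N. cinner (ell2_nth v (e k)) (ell2_nth w (e k)))"
proof -
  have "cinner v w = (\<Sum>\<^sub>\<infinity>k. cinner (ell2_nth v (e k)) (ell2_nth w (e k)))"
    unfolding cinner_ell2_def by (rule infsum_reindex_bij_betw[OF e, symmetric])
  also have "\<dots> = (\<Sum>\<^sub>\<infinity>k\<in>{..<N}. cinner (ell2_nth v (e k)) (ell2_nth w (e k)))"
    by (rule infsum_cong_neutral) (auto simp: assms(2))
  finally show ?thesis
    by simp
qed

lemma norm_ell2_finite_support:
  fixes e :: "nat \<Rightarrow> 'i" and v :: "('i, 'a::complex_inner) ell2"
  assumes e: "bij e" and "\<And>k. k \<ge> N \<Longrightarrow> ell2_nth v (e k) = 0"
  shows "(norm v)\<^sup>2 = (\<Sum>k<N. (norm (ell2_nth v (e k)))\<^sup>2)"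
proof -
  have "Re (cinner v v) = Re (\<Sum>k<N. cinner (ell2_nth v (e k)) (ell2_nth v (e k)))"
    by (rule arg_cong[where f = Re]) (rule cinner_ell2_finite_support[OF assms])
  then show ?thesis
    by (simp add: Re_cinner_self)
qed

lemma norm_ell2_partial_sum_le:
  fixes e :: "nat \<Rightarrow> 'i"
  assumes e: "bij e"
  shows "(\<Sum>k<N. (norm (ell2_nth v (e k)))\<^sup>2) \<le> (norm v)\<^sup>2"
  using sum_norm_ell2_nth_le[of "e ` {..<N}" v] inj_on_subset[OF bij_is_inj[OF e] subset_UNIV]
  by (simp add: sum.reindex)

definition ell2_single :: "'i \<Rightarrow> 'a \<Rightarrow> ('i, 'a::complex_inner) ell2" where
  "ell2_single i a = Abs_ell2 (\<lambda>j. if j = i then a else 0)"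

lemma ell2_nth_single: "ell2_nth (ell2_single i a) j = (if j = i then a else 0)"
proof -
  have "(\<lambda>j. (norm (if j = i then a else 0))\<^sup>2) summable_on UNIV
      \<longleftrightarrow> (\<lambda>j. (norm a)\<^sup>2) summable_on {i}"
    by (rule summable_on_cong_neutral) auto
  then have "square_summable (\<lambda>j. if j = i then a else 0)"
    by (simp add: square_summable_def)
  then show ?thesis
    by (simp add: ell2_single_def Abs_ell2_inverse)
qed

lemma cinner_single_left: "cinner (ell2_single i a) w = cinner a (ell2_nth w i)"
proof -
  have "cinner (ell2_single i a) w = (\<Sum>\<^sub>\<infinity>j\<in>{i}. cinner a (ell2_nth w i))"
    unfolding cinner_ell2_def by (rule infsum_cong_neutral) (auto simp: ell2_nth_single)
  then show ?thesis
    by simp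
qed

lemma ell2_nth_sum: "ell2_nth (\<Sum>x\<in>F. u x) i = (\<Sum>x\<in>F. ell2_nth (u x) i)"
  by (rule bounded_clinear_sum[OF bounded_clinear_ell2_nth])

text \<open>
  Convergence of the basis expansion over all finite index sets, not only over initial segments,
  is what matches the unordered sums in \<^const>\<open>toeplitz_minus\<close>.
\<close>

lemma ell2_single_has_sum: "((\<lambda>i. ell2_single i (ell2_nth u i)) has_sum u) UNIV"
proof -
  define s where "s F = (\<Sum>i\<in>F. ell2_single i (ell2_nth u i))" for F
  have nth: "ell2_nth (s F) i = ell2_nth u i" if "finite F" "i \<in> F" for F i
    using that by (simp add: s_def ell2_nth_sum ell2_nth_single)
  have err: "(norm (s F - u))\<^sup>2 = (norm u)\<^sup>2 - (\<Sum>i\<in>F. (norm (ell2_nth u i))\<^sup>2)" if "finite F" for F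
  proof -
    have su: "Re (cinner (s F) u) = (\<Sum>i\<in>F. (norm (ell2_nth u i))\<^sup>2)"
      by (simp add: s_def cinner_sum_left cinner_single_left Re_cinner_self)
    have "cinner (s F) (s F) = (\<Sum>i\<in>F. cinner (ell2_nth u i) (ell2_nth (s F) i))"
      by (subst (1) s_def) (simp add: cinner_sum_left cinner_single_left)
    also have "\<dots> = (\<Sum>i\<in>F. cinner (ell2_nth u i) (ell2_nth u i))"
      using that nth by (intro sum.cong) auto
    finally have "(norm (s F))\<^sup>2 = (\<Sum>i\<in>F. (norm (ell2_nth u i))\<^sup>2)"
      by (metis (no_types, lifting) Re_cinner_self Re_sum sum.cong)
    then show ?thesis
      using su by (simp add: power2_norm_eq_inner inner_diff_left inner_diff_right inner_commute[of u "s F"]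
          inner_eq_Re_cinner[of "s F" u])
  qed
  have "((\<lambda>F. \<Sum>i\<in>F. (norm (ell2_nth u i))\<^sup>2) \<longlongrightarrow> (norm u)\<^sup>2) (finite_subsets_at_top UNIV)"
    unfolding norm_ell2_power2 using square_summable_ell2_nth[of u]
    by (intro infsum_tendsto) (simp add: square_summable_def)
  from tendsto_real_sqrt[OF tendsto_diff[OF tendsto_const this, of "(norm u)\<^sup>2"]]
  have "((\<lambda>F. sqrt ((norm u)\<^sup>2 - (\<Sum>i\<in>F. (norm (ell2_nth u i))\<^sup>2))) \<longlongrightarrow> 0) (finite_subsets_at_top UNIV)"
    by simp
  moreover have "\<forall>\<^sub>F F in finite_subsets_at_top UNIV.
      sqrt ((norm u)\<^sup>2 - (\<Sum>i\<in>F. (norm (ell2_nth u i))\<^sup>2)) = norm (s F - u)"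
    using err by (auto intro!: eventually_finite_subsets_at_top_weakI simp flip: err)
  ultimately have "((\<lambda>F. norm (s F - u)) \<longlongrightarrow> 0) (finite_subsets_at_top UNIV)"
    using tendsto_cong by fast
  then have "(s \<longlongrightarrow> u) (finite_subsets_at_top UNIV)"
    using LIM_zero_iff tendsto_norm_zero_iff by blast
  then show ?thesis
    by (simp add: has_sum_def s_def[abs_def])
qed

lemma dense_finite_support:
  assumes e: "bij (e :: nat \<Rightarrow> 'i)"
  shows "closure {v :: ('i, 'a::complex_inner) ell2. \<exists>N. \<forall>k\<ge>N. ell2_nth v (e k) = 0} = UNIV"
    (is "closure ?S = UNIV")
proof -
  have "u \<in> closure ?S" for u :: "('i, 'a) ell2"
  proof (rule Lim_in_closed_set[OF closed_closure])
    show "((\<lambda>F. \<Sum>i\<in>F. ell2_single i (ell2_nth u i)) \<longlongrightarrow> u) (finite_subsets_at_top UNIV)"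
      using ell2_single_has_sum by (simp add: has_sum_def)
    have "(\<Sum>i\<in>F. ell2_single i (ell2_nth u i)) \<in> ?S" if F: "finite F" for F
    proof -
      have "finite (inv e ` F)"
        using F by simp
      then obtain N where N: "inv e ` F \<subseteq> {..<N}"
        using finite_nat_bounded by blast
      have "e k \<notin> F" if k: "k \<ge> N" for k
      proof
        assume "e k \<in> F"
        then have "inv e (e k) \<in> {..<N}"
          using N by blast
        then show False
          using k e by (simp add: bij_is_inj)
      qed
      then show ?thesis
        using F by (auto simp: ell2_nth_sum ell2_nth_single intro!: exI[of _ N])
    qed
    then show "\<forall>\<^sub>F F in finite_subsets_at_top UNIV.
        (\<Sum>i\<in>F. ell2_single i (ell2_nth u i)) \<in> closure ?S"
      using closure_subset[of ?S] by (intro eventually_finite_subsets_at_top_weakI) blast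
  qed simp
  then show ?thesis
    by blast
qed

definition ell2_reindex :: "('j \<Rightarrow> 'i) \<Rightarrow> ('i, 'a::complex_inner) ell2 \<Rightarrow> ('j, 'a) ell2" where
  "ell2_reindex f u = Abs_ell2 (\<lambda>j. ell2_nth u (f j))"

lemma ell2_nth_reindex:
  assumes "bij f"
  shows "ell2_nth (ell2_reindex f u) j = ell2_nth u (f j)"
proof -
  have "square_summable (\<lambda>j. ell2_nth u (f j))"
    using square_summable_ell2_nth[of u]
      summable_on_reindex_bij_betw[OF assms, of "\<lambda>i. (norm (ell2_nth u i))\<^sup>2"]
    by (simp add: square_summable_def)
  then show ?thesis
    by (simp add: ell2_reindex_def Abs_ell2_inverse)
qed

lemma norm_ell2_reindex:
  assumes "bij f"
  shows "norm (ell2_reindex f u) = norm u"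
proof -
  have "(norm (ell2_reindex f u))\<^sup>2 = (norm u)\<^sup>2"
    unfolding norm_ell2_power2 ell2_nth_reindex[OF assms]
    by (rule infsum_reindex_bij_betw[OF assms])
  then show ?thesis
    by simp
qed

lemma bounded_clinear_ell2_reindex:
  assumes "bij f"
  shows "bounded_clinear (ell2_reindex f)"
  by (rule bounded_clinearI[of _ 1])
    (auto intro!: ell2_eqI simp: ell2_nth_reindex[OF assms] norm_ell2_reindex[OF assms]
      plus_ell2.rep_eq scaleC_ell2.rep_eq)


section \<open>Synthesis operators on finitely supported sequences\<close>

text \<open>
  The map \<open>v \<mapsto> \<Sum>\<^sub>k G\<^sub>k v\<^sub>k\<close>, on finitely supported sequences. With \<open>G\<^sub>k = A\<^sup>*\<^sup>k C\<^sup>*\<close> or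
  \<open>G\<^sub>k = A\<^sup>k B\<close>, its adjoint is the observability operator or the adjoint of the controllability
  operator.
\<close>

definition finite_synthesis ::
    "(nat \<Rightarrow> 'i) \<Rightarrow> (nat \<Rightarrow> 'a \<Rightarrow> 'x::complex_inner) \<Rightarrow> (('i, 'a::complex_inner) ell2 \<times> 'x) set" where
  "finite_synthesis e G = {(v, z). \<exists>N. (\<forall>k\<ge>N. ell2_nth v (e k) = 0) \<and>
      z = (\<Sum>k<N. G k (ell2_nth v (e k)))}"

locale synthesis =
  fixes e :: "nat \<Rightarrow> 'i" and G :: "nat \<Rightarrow> 'a::complex_inner \<Rightarrow> 'x::complex_inner"
  assumes e: "bij e" and G: "bounded_clinear (G k)"
begin

lemma e_inj: "e k = e l \<longleftrightarrow> k = l"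
  using e by (simp add: bij_is_inj inj_eq)

lemma finite_synthesis_extend:
  assumes "(v, z) \<in> finite_synthesis e G"
  obtains N where "\<And>M k. M \<ge> N \<Longrightarrow> k \<ge> M \<Longrightarrow> ell2_nth v (e k) = 0"
    and "\<And>M. M \<ge> N \<Longrightarrow> z = (\<Sum>k<M. G k (ell2_nth v (e k)))"
proof -
  obtain N where N: "\<And>k. k \<ge> N \<Longrightarrow> ell2_nth v (e k) = 0" "z = (\<Sum>k<N. G k (ell2_nth v (e k)))"
    using assms by (auto simp: finite_synthesis_def)
  have "z = (\<Sum>k<M. G k (ell2_nth v (e k)))" if "M \<ge> N" for M
    unfolding N(2) using that
    by (intro sum.mono_neutral_left) (auto simp: N(1) bounded_clinear_zero[OF G])
  then show ?thesis
    using that[of N] N(1) by fastforce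
qed

lemma finite_synthesis_linear: "linear_relation (finite_synthesis e G)"
  unfolding linear_relation_def
proof (intro conjI allI impI)
  show "(0, 0) \<in> finite_synthesis e G"
    by (auto simp: finite_synthesis_def zero_ell2.rep_eq intro!: exI[of _ 0])
  show "(v + v', z + z') \<in> finite_synthesis e G"
    if v: "(v, z) \<in> finite_synthesis e G" "(v', z') \<in> finite_synthesis e G" for v z v' z'
  proof -
    obtain N where N: "\<And>M k. M \<ge> N \<Longrightarrow> k \<ge> M \<Longrightarrow> ell2_nth v (e k) = 0"
        "\<And>M. M \<ge> N \<Longrightarrow> z = (\<Sum>k<M. G k (ell2_nth v (e k)))"
      using finite_synthesis_extend[OF v(1)] by blast
    obtain N' where N': "\<And>M k. M \<ge> N' \<Longrightarrow> k \<ge> M \<Longrightarrow> ell2_nth v' (e k) = 0"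
        "\<And>M. M \<ge> N' \<Longrightarrow> z' = (\<Sum>k<M. G k (ell2_nth v' (e k)))"
      using finite_synthesis_extend[OF v(2)] by blast
    define M where "M = max N N'"
    have "ell2_nth (v + v') (e k) = 0" if "k \<ge> M" for k
      using N(1)[of M k] N'(1)[of M k] that by (simp add: plus_ell2.rep_eq M_def)
    moreover have "z + z' = (\<Sum>k<M. G k (ell2_nth (v + v') (e k)))"
      using N(2)[of M] N'(2)[of M]
      by (simp add: plus_ell2.rep_eq M_def bounded_clinear_add[OF G] sum.distrib)
    ultimately show ?thesis
      by (auto simp: finite_synthesis_def)
  qed
  show "(c *\<^sub>C v, c *\<^sub>C z) \<in> finite_synthesis e G" if v: "(v, z) \<in> finite_synthesis e G" for c v z
  proof -
    obtain N where "\<And>k. k \<ge> N \<Longrightarrow> ell2_nth v (e k) = 0" "z = (\<Sum>k<N. G k (ell2_nth v (e k)))"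
      using v by (auto simp: finite_synthesis_def)
    then show ?thesis
      by (auto simp: finite_synthesis_def scaleC_ell2.rep_eq bounded_clinear_scaleC[OF G]
          scaleC_sum_right intro!: exI[of _ N])
  qed
qed

lemma finite_synthesis_dense_domain: "closure (Domain (finite_synthesis e G)) = UNIV"
proof -
  have "Domain (finite_synthesis e G) = {v. \<exists>N. \<forall>k\<ge>N. ell2_nth v (e k) = 0}"
    by (auto simp: finite_synthesis_def)
  then show ?thesis
    using dense_finite_support[OF e] by simp
qed

lemma single_in_finite_synthesis: "(ell2_single (e k) a, G k a) \<in> finite_synthesis e G"
proof -
  have "(\<Sum>l<Suc k. G l (ell2_nth (ell2_single (e k) a) (e l))) = (\<Sum>l<Suc k. if l = k then G k a else 0)"
    by (rule sum.cong) (auto simp: ell2_nth_single e_inj bounded_clinear_zero[OF G])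
  then show ?thesis
    unfolding finite_synthesis_def
    by (auto simp: ell2_nth_single e_inj intro!: exI[of _ "Suc k"])
qed

lemma finite_synthesis_dense_range:
  assumes "closure (complex_vector.span (\<Union>k. range (G k))) = UNIV"
  shows "closure (Range (finite_synthesis e G)) = UNIV"
proof -
  have "complex_vector.subspace (Range (finite_synthesis e G))"
    unfolding complex_vector.subspace_def
    using linear_relation_zero[OF finite_synthesis_linear] linear_relation_add[OF finite_synthesis_linear]
      linear_relation_scaleC[OF finite_synthesis_linear]
    by (meson Range.intros RangeE)
  then have "complex_vector.span (\<Union>k. range (G k)) \<subseteq> Range (finite_synthesis e G)"
    using single_in_finite_synthesis by (intro complex_vector.span_minimal) auto
  then show ?thesis
    using closure_mono assms by blast
qed

text \<open>Testing against sequences with a single entry identifies the entries of the adjoint.\<close>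

lemma graph_adjoint_finite_synthesis:
  assumes adj: "\<And>k a x. cinner (G k a) x = cinner a (G' k x)"
  shows "graph_adjoint (finite_synthesis e G) = {(x, y). \<forall>k. ell2_nth y (e k) = G' k x}"
proof (intro set_eqI iffI; clarify)
  fix x y k
  assume xy: "(x, y) \<in> graph_adjoint (finite_synthesis e G)"
  have "cinner (G k a) x = cinner (ell2_single (e k) a) y" for a
    using xy single_in_finite_synthesis[of k a] by (auto simp: graph_adjoint_def)
  then have "cinner a (ell2_nth y (e k)) = cinner a (G' k x)" for a
    by (simp add: cinner_single_left adj)
  then show "ell2_nth y (e k) = G' k x"
    by (rule cinner_eqI)
next
  fix x y
  assume y: "\<forall>k. ell2_nth y (e k) = G' k x"
  have "cinner z x = cinner v y" if vz: "(v, z) \<in> finite_synthesis e G" for v z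
  proof -
    obtain N where N: "\<And>k. k \<ge> N \<Longrightarrow> ell2_nth v (e k) = 0" "z = (\<Sum>k<N. G k (ell2_nth v (e k)))"
      using vz by (auto simp: finite_synthesis_def)
    show ?thesis
      using y by (simp add: cinner_ell2_finite_support[OF e N(1)] N(2) cinner_sum_left adj)
  qed
  then show "(x, y) \<in> graph_adjoint (finite_synthesis e G)"
    by (auto simp: graph_adjoint_def)
qed

end


section \<open>Contractive Toeplitz operators\<close>

definition toeplitz_contractive ::
    "(nat \<Rightarrow> 'u::real_normed_vector \<Rightarrow> 'y::real_normed_vector) \<Rightarrow> bool" where
  "toeplitz_contractive F \<longleftrightarrow>
    (\<forall>N p. (\<Sum>i<N. (norm (\<Sum>j\<le>i. F (i - j) (p j)))\<^sup>2) \<le> (\<Sum>j<N. (norm (p j))\<^sup>2))"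

lemma sum_cinner_le_half:
  "Re (\<Sum>i\<in>I. cinner (a i) (b i)) \<le> ((\<Sum>i\<in>I. (norm (a i))\<^sup>2) + (\<Sum>i\<in>I. (norm (b i))\<^sup>2)) / 2"
proof -
  have "Re (cinner (a i) (b i)) \<le> ((norm (a i))\<^sup>2 + (norm (b i))\<^sup>2) / 2" for i
    using zero_le_power2[of "norm (a i) - norm (b i)"] norm_cinner_le[of "a i" "b i"]
      complex_Re_le_cmod[of "cinner (a i) (b i)"] by (simp add: power2_diff)
  then have "(\<Sum>i\<in>I. Re (cinner (a i) (b i))) \<le> (\<Sum>i\<in>I. ((norm (a i))\<^sup>2 + (norm (b i))\<^sup>2) / 2)"
    by (rule sum_mono)
  then show ?thesis
    by (simp add: sum.distrib sum_divide_distrib[symmetric])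
qed

text \<open>It suffices to bound the bilinear form, as one may pair \<open>T p\<close> with itself.\<close>

lemma toeplitz_contractiveI:
  assumes "\<And>N p q. Re (\<Sum>i<N. \<Sum>j\<le>i. cinner (F (i - j) (p j)) (q i))
      \<le> ((\<Sum>j<N. (norm (p j))\<^sup>2) + (\<Sum>i<N. (norm (q i))\<^sup>2)) / 2"
  shows "toeplitz_contractive F"
  unfolding toeplitz_contractive_def
proof (intro allI)
  fix N p
  define q where "q i = (\<Sum>j\<le>i. F (i - j) (p j))" for i
  have "Re (\<Sum>i<N. \<Sum>j\<le>i. cinner (F (i - j) (p j)) (q i)) = (\<Sum>i<N. (norm (q i))\<^sup>2)"
    by (simp add: cinner_sum_left[symmetric] q_def[symmetric] Re_cinner_self del: Re_sum)
      (simp add: Re_cinner_self)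
  then show "(\<Sum>i<N. (norm (\<Sum>j\<le>i. F (i - j) (p j)))\<^sup>2) \<le> (\<Sum>j<N. (norm (p j))\<^sup>2)"
    using assms[where N = N and p = p and q = q] by (simp add: q_def)
qed

text \<open>
  Reversing the order of the indices turns the adjoint of the truncated Toeplitz matrix of \<open>F\<close> into
  the truncated Toeplitz matrix of the adjoint symbols.
\<close>

lemma toeplitz_contractive_cadjoint:
  fixes F :: "nat \<Rightarrow> 'u::chilbert_space \<Rightarrow> 'y::complex_inner"
  assumes F: "\<And>n. bounded_clinear (F n)" and contr: "toeplitz_contractive F"
  shows "toeplitz_contractive (\<lambda>n. cadjoint (F n))"
proof (rule toeplitz_contractiveI)
  fix N :: nat and p :: "nat \<Rightarrow> 'y" and q :: "nat \<Rightarrow> 'u"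
  define p' q' where "p' b = p (N - 1 - b)" and "q' a = q (N - 1 - a)" for a b
  have "(\<Sum>i<N. \<Sum>j\<le>i. cinner (cadjoint (F (i - j)) (p j)) (q i))
      = (\<Sum>(i, j)\<in>Sigma {..<N} (\<lambda>i. {..i}). cinner (p j) (F (i - j) (q i)))"
    by (simp add: sum.Sigma cinner_cadjoint_left[OF F])
  also have "\<dots> = (\<Sum>(b, a)\<in>Sigma {..<N} (\<lambda>b. {..b}). cinner (p' b) (F (b - a) (q' a)))"
    by (rule sum.reindex_bij_witness[of _ "\<lambda>(b, a). (N - 1 - a, N - 1 - b)"
          "\<lambda>(i, j). (N - 1 - j, N - 1 - i)"]) (auto simp: p'_def q'_def)
  also have "\<dots> = (\<Sum>b<N. cinner (p' b) (\<Sum>a\<le>b. F (b - a) (q' a)))"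
    by (simp add: sum.Sigma cinner_sum_right)
  finally have form: "(\<Sum>i<N. \<Sum>j\<le>i. cinner (cadjoint (F (i - j)) (p j)) (q i))
      = (\<Sum>b<N. cinner (p' b) (\<Sum>a\<le>b. F (b - a) (q' a)))" .
  have "Re (\<Sum>i<N. \<Sum>j\<le>i. cinner (cadjoint (F (i - j)) (p j)) (q i))
      \<le> ((\<Sum>b<N. (norm (p' b))\<^sup>2) + (\<Sum>b<N. (norm (\<Sum>a\<le>b. F (b - a) (q' a)))\<^sup>2)) / 2"
    unfolding form by (rule sum_cinner_le_half)
  also have "\<dots> \<le> ((\<Sum>b<N. (norm (p' b))\<^sup>2) + (\<Sum>b<N. (norm (q' b))\<^sup>2)) / 2"
    using contr by (simp add: toeplitz_contractive_def)
  also have "(\<Sum>b<N. (norm (p' b))\<^sup>2) = (\<Sum>j<N. (norm (p j))\<^sup>2)"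
    unfolding p'_def using sum.nat_diff_reindex[of "\<lambda>j. (norm (p j))\<^sup>2" N] by simp
  also have "(\<Sum>b<N. (norm (q' b))\<^sup>2) = (\<Sum>j<N. (norm (q j))\<^sup>2)"
    unfolding q'_def using sum.nat_diff_reindex[of "\<lambda>j. (norm (q j))\<^sup>2" N] by simp
  finally show "Re (\<Sum>i<N. \<Sum>j\<le>i. cinner (cadjoint (F (i - j)) (p j)) (q i))
      \<le> ((\<Sum>j<N. (norm (p j))\<^sup>2) + (\<Sum>i<N. (norm (q i))\<^sup>2)) / 2" .
qed

locale toeplitz_symbols =
  fixes F :: "nat \<Rightarrow> 'u::chilbert_space \<Rightarrow> 'y::chilbert_space"
  assumes F: "bounded_clinear (F n)" and contr: "toeplitz_contractive F"
begin

lemma toeplitz_partial_le: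
  "(\<Sum>i<N. (norm (\<Sum>j\<le>i. F (i - j) (p j)))\<^sup>2) \<le> (\<Sum>j<N. (norm (p j))\<^sup>2)"
  using contr by (simp add: toeplitz_contractive_def)

lemma toeplitz_plus_properties:
  shows ell2_nth_toeplitz_plus:
      "ell2_nth (toeplitz_plus F u) i = (\<Sum>j\<le>i. F (i - j) (ell2_nth u j))"
    and norm_toeplitz_plus: "norm (toeplitz_plus F u) \<le> norm u"
proof -
  define f where "f i = (\<Sum>j\<le>i. F (i - j) (ell2_nth u j))" for i
  have "(\<Sum>k<N. (norm (f k))\<^sup>2) \<le> (norm u)\<^sup>2" for N
    using toeplitz_partial_le[of "ell2_nth u" N] norm_ell2_partial_sum_le[OF bij_id, of u N]
    by (simp add: f_def)
  then obtain w where w: "\<And>k. ell2_nth w k = f k" "(norm w)\<^sup>2 \<le> (norm u)\<^sup>2"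
    using ell2_of_bounded_sums[OF bij_id, of f] by (metis id_apply)
  have "f = ell2_nth w"
    using w(1) by auto
  then have "toeplitz_plus F u = w"
    by (simp add: toeplitz_plus_def f_def[symmetric] ell2_nth_inverse)
  then show "ell2_nth (toeplitz_plus F u) i = (\<Sum>j\<le>i. F (i - j) (ell2_nth u j))"
      "norm (toeplitz_plus F u) \<le> norm u"
    using w by (auto simp: f_def intro: power2_le_imp_le)
qed

lemma bounded_clinear_toeplitz_plus: "bounded_clinear (toeplitz_plus F)"
  by (rule bounded_clinearI[of _ 1])
    (auto intro!: ell2_eqI simp: ell2_nth_toeplitz_plus norm_toeplitz_plus plus_ell2.rep_eq
      scaleC_ell2.rep_eq bounded_clinear_add[OF F] bounded_clinear_scaleC[OF F] sum.distrib scaleC_sum_right)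

lemma norm_cadjoint_toeplitz_plus: "norm (cadjoint (toeplitz_plus F) v) \<le> norm v"
  using norm_cadjoint_le[OF bounded_clinear_toeplitz_plus, of 1 v] norm_toeplitz_plus by simp

lemma cadjoint_toeplitz_plus_single:
  "ell2_nth (cadjoint (toeplitz_plus F) (ell2_single i b)) m
    = (if m \<le> i then cadjoint (F (i - m)) b else 0)" (is "?l = ?r")
proof (rule cinner_eqI)
  fix a
  have "cinner a ?l = cinner (toeplitz_plus F (ell2_single m a)) (ell2_single i b)"
    by (simp add: cinner_single_left[symmetric] cinner_cadjoint[OF bounded_clinear_toeplitz_plus])
  also have "\<dots> = cinner (ell2_nth (toeplitz_plus F (ell2_single m a)) i) b"
    by (metis cinner_commute cinner_single_left)
  also have "ell2_nth (toeplitz_plus F (ell2_single m a)) i = (\<Sum>j\<le>i. if j = m then F (i - m) a else 0)"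
    unfolding ell2_nth_toeplitz_plus
    by (rule sum.cong) (auto simp: ell2_nth_single bounded_clinear_zero[OF F])
  also have "\<dots> = (if m \<le> i then F (i - m) a else 0)"
    by simp
  finally show "cinner a ?l = cinner a ?r"
    by (simp add: cinner_cadjoint[OF F])
qed

text \<open>
  The rows of the adjoint are infinite. Their sums converge because the adjoint is bounded and may
  be applied termwise to the basis expansion of \<open>v\<close>.
\<close>

lemma cadjoint_toeplitz_plus_has_sum:
  "((\<lambda>i. cadjoint (F (i - m)) (ell2_nth v i)) has_sum ell2_nth (cadjoint (toeplitz_plus F) v) m) {m..}"
proof -
  have "bounded_linear (\<lambda>v. ell2_nth (cadjoint (toeplitz_plus F) v) m)"
    by (intro bounded_clinear_linear bounded_clinear_comp[OF bounded_clinear_ell2_nth]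
        bounded_clinear_cadjoint bounded_clinear_toeplitz_plus)
  from has_sum_bounded_linear[OF this ell2_single_has_sum[of v]]
  have "((\<lambda>i. if m \<le> i then cadjoint (F (i - m)) (ell2_nth v i) else 0)
      has_sum ell2_nth (cadjoint (toeplitz_plus F) v) m) UNIV"
    by (simp add: o_def cadjoint_toeplitz_plus_single)
  then show ?thesis
    by (rule has_sum_cong_neutral[THEN iffD1, rotated -1]) auto
qed

text \<open>
  For \<open>v\<close> supported on the first \<open>N\<close> indices, the reversed sequence \<open>p\<^sub>l = v\<^sub>N\<^sub>-\<^sub>1\<^sub>-\<^sub>l\<close> has a Toeplitz
  image whose first \<open>N\<close> entries are those of \<open>y\<close>, in reversed order, and whose further
  entries form the Hankel part \<open>\<Sum>\<^sub>i F\<^sub>i\<^sub>+\<^sub>k\<^sub>+\<^sub>1 v\<^sub>i\<close>. Contractivity bounds both together.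
\<close>

lemma hankel_bound:
  fixes v :: "('i, 'u) ell2" and y :: "('j, 'y) ell2"
  assumes e: "bij e" and e': "bij e'" and N: "\<And>k. k \<ge> N \<Longrightarrow> ell2_nth v (e k) = 0"
    and y: "\<And>m. ((\<lambda>i. F (i - m) (ell2_nth v (e i))) has_sum ell2_nth y (e' m)) {m..}"
  shows "(\<Sum>k<M. (norm (\<Sum>i<N. F (i + k + 1) (ell2_nth v (e i))))\<^sup>2) \<le> (norm v)\<^sup>2 - (norm y)\<^sup>2"
proof -
  define f where "f i = ell2_nth v (e i)" for i
  have f0: "f k = 0" if "k \<ge> N" for k
    using N that by (simp add: f_def)
  define p where "p l = (if l < N then f (N - 1 - l) else 0)" for l
  have y_eq: "ell2_nth y (e' m) = (\<Sum>i\<in>{m..<N}. F (i - m) (f i))" for m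
  proof -
    have "((\<lambda>i. F (i - m) (f i)) has_sum ell2_nth y (e' m)) {m..<N}"
      using y[of m] unfolding f_def[symmetric]
      by (rule has_sum_cong_neutral[THEN iffD1, rotated -1])
        (auto simp: f0 bounded_clinear_zero[OF F])
    then show ?thesis
      by (simp add: has_sum_finite_iff)
  qed
  then have norm_y: "(norm y)\<^sup>2 = (\<Sum>m<N. (norm (\<Sum>i\<in>{m..<N}. F (i - m) (f i)))\<^sup>2)"
    by (subst norm_ell2_finite_support[OF e', of N]) auto
  have norm_v: "(norm v)\<^sup>2 = (\<Sum>i<N. (norm (f i))\<^sup>2)"
    unfolding f_def by (rule norm_ell2_finite_support[OF e N])
  have row_y: "(\<Sum>l\<le>N - 1 - m. F (N - 1 - m - l) (p l)) = (\<Sum>i\<in>{m..<N}. F (i - m) (f i))"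
    if "m < N" for m
    by (rule sum.reindex_bij_witness[of _ "\<lambda>i. N - 1 - i" "\<lambda>l. N - 1 - l"])
      (use that in \<open>auto simp: p_def add.commute\<close>)
  have row_h: "(\<Sum>l\<le>N + k. F (N + k - l) (p l)) = (\<Sum>i<N. F (i + k + 1) (f i))" for k
  proof -
    have "(\<Sum>l\<le>N + k. F (N + k - l) (p l)) = (\<Sum>l<N. F (N + k - l) (p l))"
      by (rule sum.mono_neutral_right) (auto simp: p_def bounded_clinear_zero[OF F])
    also have "\<dots> = (\<Sum>i<N. F (i + k + 1) (f i))"
      by (rule sum.reindex_bij_witness[of _ "\<lambda>i. N - 1 - i" "\<lambda>l. N - 1 - l"])
        (auto simp: p_def intro!: arg_cong2[where f = F])
    finally show ?thesis .
  qed
  have "(\<Sum>m<N + M. (norm (\<Sum>l\<le>m. F (m - l) (p l)))\<^sup>2)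
      = (\<Sum>m<N. (norm (\<Sum>l\<le>m. F (m - l) (p l)))\<^sup>2) + (\<Sum>k<M. (norm (\<Sum>l\<le>N + k. F (N + k - l) (p l)))\<^sup>2)"
    by (induction M) simp_all
  also have "(\<Sum>m<N. (norm (\<Sum>l\<le>m. F (m - l) (p l)))\<^sup>2)
      = (\<Sum>m<N. (norm (\<Sum>l\<le>N - 1 - m. F (N - 1 - m - l) (p l)))\<^sup>2)"
    using sum.nat_diff_reindex[of "\<lambda>m. (norm (\<Sum>l\<le>m. F (m - l) (p l)))\<^sup>2" N] by simp
  also have "\<dots> = (norm y)\<^sup>2"
    unfolding norm_y using row_y by (intro sum.cong) auto
  finally have "(norm y)\<^sup>2 + (\<Sum>k<M. (norm (\<Sum>i<N. F (i + k + 1) (f i)))\<^sup>2)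
      \<le> (\<Sum>j<N + M. (norm (p j))\<^sup>2)"
    using toeplitz_partial_le[of p "N + M"] by (simp add: row_h)
  also have "\<dots> = (\<Sum>j<N. (norm (p j))\<^sup>2)"
    by (rule sum.mono_neutral_right) (auto simp: p_def)
  also have "\<dots> = (\<Sum>j<N. (norm (f (N - Suc j)))\<^sup>2)"
    by (rule sum.cong) (auto simp: p_def)
  also have "\<dots> = (norm v)\<^sup>2"
    unfolding norm_v by (rule sum.nat_diff_reindex)
  finally show ?thesis
    by (simp add: f_def)
qed

text \<open>
  In the application \<open>Q\<^sub>k G\<^sub>i = F\<^sub>i\<^sub>+\<^sub>k\<^sub>+\<^sub>1\<close> is the factorization of the Hankel matrix through the
  state space, and \<open>T v\<close> is the Toeplitz part.
\<close>

lemma finite_synthesis_dominated: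
  fixes T :: "('i, 'u) ell2 \<Rightarrow> ('j, 'y) ell2" and G :: "nat \<Rightarrow> 'u \<Rightarrow> 'x::complex_inner"
  assumes e: "bij e" and e': "bij e'" and e'': "bij (e'' :: nat \<Rightarrow> 'l)"
    and T: "bounded_clinear T" "\<And>v. norm (T v) \<le> norm v"
    and T_sum: "\<And>v m. ((\<lambda>i. F (i - m) (ell2_nth v (e i))) has_sum ell2_nth (T v) (e' m)) {m..}"
    and Q: "\<And>k. bounded_clinear (Q k)" and QG: "\<And>k i a. Q k (G i a) = F (i + k + 1) a"
    and vz: "(v, z) \<in> finite_synthesis e G"
  shows "\<exists>w :: ('l, 'y) ell2. (\<forall>k. ell2_nth w (e'' k) = Q k z) \<and> norm w \<le> norm (defect_op T v)"
proof -
  obtain N where N: "\<And>k. k \<ge> N \<Longrightarrow> ell2_nth v (e k) = 0" "z = (\<Sum>k<N. G k (ell2_nth v (e k)))"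
    using vz by (auto simp: finite_synthesis_def)
  have Qz: "Q k z = (\<Sum>i<N. F (i + k + 1) (ell2_nth v (e i)))" for k
    by (simp add: N(2) bounded_clinear_sum[OF Q] QG)
  have "(\<Sum>k<M. (norm (Q k z))\<^sup>2) \<le> (norm (defect_op T v))\<^sup>2" for M
    unfolding Qz defect_op_contraction(3)[OF T] by (rule hankel_bound[OF e e' N(1) T_sum])
  then obtain w :: "('l, 'y) ell2" where "\<And>k. ell2_nth w (e'' k) = Q k z"
      "(norm w)\<^sup>2 \<le> (norm (defect_op T v))\<^sup>2"
    using ell2_of_bounded_sums[OF e''] by metis
  then show ?thesis
    by (metis norm_ge_zero power2_le_imp_le)
qed

end

definition negint_of_nat :: "nat \<Rightarrow> negint" where
  "negint_of_nat k = negint_of_int (- 1 - int k)"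

definition nat_of_negint :: "negint \<Rightarrow> nat" where
  "nat_of_negint n = nat (- int_of_negint n - 1)"

lemma int_of_negint_of_nat: "int_of_negint (negint_of_nat k) = - 1 - int k"
  by (simp add: negint_of_nat_def negint_of_int_inverse)

lemma nat_of_negint_of_nat [simp]: "nat_of_negint (negint_of_nat k) = k"
  by (simp add: nat_of_negint_def int_of_negint_of_nat)

lemma negint_of_nat_of_negint [simp]: "negint_of_nat (nat_of_negint n) = n"
proof -
  have "int_of_negint n < 0"
    using int_of_negint[of n] by simp
  then show ?thesis
    by (simp add: nat_of_negint_def negint_of_nat_def int_of_negint_inverse)
qed

lemma bij_negint_of_nat: "bij negint_of_nat"
  by (rule bij_betw_byWitness[of _ nat_of_negint]) auto

lemma bij_nat_of_negint: "bij nat_of_negint"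
  by (rule bij_betw_byWitness[of _ negint_of_nat]) auto

text \<open>
  Convergence of the infinite sums that define \<open>toeplitz_minus F\<close> comes from recognizing it, up to
  the order of the indices, as the adjoint of the Toeplitz operator of the adjoint symbols.
\<close>

context toeplitz_symbols
begin

lemma toeplitz_minus_properties:
  shows bounded_clinear_toeplitz_minus: "bounded_clinear (toeplitz_minus F)"
    and norm_toeplitz_minus: "norm (toeplitz_minus F u) \<le> norm u"
    and toeplitz_minus_has_sum: "((\<lambda>i. F (i - m) (ell2_nth u (negint_of_nat i)))
      has_sum ell2_nth (toeplitz_minus F u) (negint_of_nat m)) {m..}"
proof -
  interpret dual: toeplitz_symbols "\<lambda>n. cadjoint (F n)"
    by standard (intro bounded_clinear_cadjoint F toeplitz_contractive_cadjoint contr)+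
  define T where "T = toeplitz_plus (\<lambda>n. cadjoint (F n))"
  define L where "L u = ell2_reindex nat_of_negint (cadjoint T (ell2_reindex negint_of_nat u))" for u
  note re = ell2_nth_reindex[OF bij_negint_of_nat] ell2_nth_reindex[OF bij_nat_of_negint]
  have sum_L: "((\<lambda>i. F (i - m) (ell2_nth u (negint_of_nat i))) has_sum
      ell2_nth (L u) (negint_of_nat m)) {m..}" for u m
    using dual.cadjoint_toeplitz_plus_has_sum[of m "ell2_reindex negint_of_nat u"]
    by (simp add: L_def T_def re cadjoint_cadjoint[OF F])
  have "toeplitz_minus F u = L u" for u
  proof -
    have "(\<Sum>\<^sub>\<infinity>j\<in>{j. int_of_negint j \<le> int_of_negint i}.
        F (nat (int_of_negint i - int_of_negint j)) (ell2_nth u j)) = ell2_nth (L u) i" for i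
    proof -
      define m where "m = nat_of_negint i"
      have i: "i = negint_of_nat m"
        by (simp add: m_def)
      have "bij_betw negint_of_nat {m..} {j. int_of_negint j \<le> int_of_negint i}"
        by (rule bij_betw_byWitness[of _ nat_of_negint])
          (auto simp: i int_of_negint_of_nat, simp add: nat_of_negint_def)
      then have "(\<Sum>\<^sub>\<infinity>j\<in>{j. int_of_negint j \<le> int_of_negint i}.
          F (nat (int_of_negint i - int_of_negint j)) (ell2_nth u j))
        = (\<Sum>\<^sub>\<infinity>k\<in>{m..}. F (nat (int_of_negint i - int_of_negint (negint_of_nat k)))
            (ell2_nth u (negint_of_nat k)))"
        by (rule infsum_reindex_bij_betw[symmetric])
      also have "\<dots> = (\<Sum>\<^sub>\<infinity>k\<in>{m..}. F (k - m) (ell2_nth u (negint_of_nat k)))"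
        by (rule infsum_cong) (auto simp: i int_of_negint_of_nat nat_diff_distrib)
      also have "\<dots> = ell2_nth (L u) i"
        unfolding i by (rule infsumI[OF sum_L])
      finally show ?thesis .
    qed
    then show ?thesis
      by (simp add: toeplitz_minus_def ell2_nth_inverse)
  qed
  then have eq: "toeplitz_minus F = L"
    by (rule ext)
  show "bounded_clinear (toeplitz_minus F)"
    unfolding eq L_def[abs_def] T_def
    by (rule bounded_clinear_comp[OF bounded_clinear_ell2_reindex[OF bij_nat_of_negint]
        bounded_clinear_comp[OF bounded_clinear_cadjoint[OF dual.bounded_clinear_toeplitz_plus]
          bounded_clinear_ell2_reindex[OF bij_negint_of_nat]]])
  show "norm (toeplitz_minus F u) \<le> norm u"
    using dual.norm_cadjoint_toeplitz_plus[of "ell2_reindex negint_of_nat u"]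
    by (simp add: eq L_def T_def norm_ell2_reindex[OF bij_negint_of_nat] norm_ell2_reindex[OF bij_nat_of_negint])
  show "((\<lambda>i. F (i - m) (ell2_nth u (negint_of_nat i)))
      has_sum ell2_nth (toeplitz_minus F u) (negint_of_nat m)) {m..}"
    unfolding eq by (rule sum_L)
qed

end


section \<open>Schur functions have contractive Toeplitz operators\<close>

lemma sum_roots_of_unity_orthogonal:
  fixes M i j :: nat
  assumes "j < i + M" "i < j + M"
  defines "\<omega> s \<equiv> cis (2 * pi * real s / real M)"
  shows "(\<Sum>s<M. \<omega> s ^ j * cnj (\<omega> s) ^ i) = (if i = j then of_nat M else 0)"
proof (cases "i = j")
  case True
  have "\<omega> s ^ j * cnj (\<omega> s) ^ j = 1" for s
    by (simp add: \<omega>_def power_mult_distrib[symmetric] complex_norm_square[symmetric])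
  then show ?thesis
    using True by simp
next
  case False
  have M: "M > 0"
    using assms by simp
  define d where "d = real j - real i"
  define \<zeta> where "\<zeta> = cis (2 * pi * d / real M)"
  have pow: "\<omega> s ^ j * cnj (\<omega> s) ^ i = \<zeta> ^ s" for s
  proof -
    have "\<omega> s ^ j * cnj (\<omega> s) ^ i = cis (real j * (2 * pi * real s / real M) + real i * - (2 * pi * real s / real M))"
      by (simp only: \<omega>_def cis_cnj Complex.DeMoivre cis_mult)
    also have "real j * (2 * pi * real s / real M) + real i * - (2 * pi * real s / real M)
        = real s * (2 * pi * d / real M)"
      by (simp add: d_def algebra_simps diff_divide_distrib)
    finally show ?thesis
      by (simp add: \<zeta>_def Complex.DeMoivre)
  qed
  have "\<zeta> ^ M = cis (2 * pi * d)"
    using M by (simp add: \<zeta>_def Complex.DeMoivre)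
  also have "\<dots> = 1"
    by (rule cis_multiple_2pi) (simp add: d_def)
  finally have root: "\<zeta> ^ M = 1" .
  have "\<zeta> \<noteq> 1"
  proof
    assume "\<zeta> = 1"
    then have "cos (2 * pi * d / real M) = 1"
      by (metis \<zeta>_def cis.sel(1) one_complex.sel(1))
    then obtain n :: int where "2 * pi * d / real M = of_int n * 2 * pi"
      using cos_one_2pi_int by blast
    then have "d = of_int n * real M"
      using M by (simp add: field_simps)
    then have "real_of_int (int j - int i) = real_of_int (n * int M)"
      by (simp add: d_def)
    then have eq: "int j - int i = n * int M"
      using of_int_eq_iff by blast
    then have "n \<noteq> 0"
      using False by auto
    then have "1 * int M \<le> \<bar>n\<bar> * int M"
      by (intro mult_right_mono) auto
    then have "int M \<le> \<bar>n * int M\<bar>"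
      by (simp add: abs_mult)
    then show False
      using assms(1,2) eq by linarith
  qed
  then have "(\<Sum>s<M. \<zeta> ^ s) = 0"
    using root by (simp add: geometric_sum)
  then show ?thesis
    using False by (simp add: pow)
qed

lemma sum_swap_inner:
  "(\<Sum>i\<in>I. \<Sum>j\<in>J. \<Sum>s\<in>S. f i j s) = (\<Sum>s\<in>S. \<Sum>i\<in>I. \<Sum>j\<in>J. f i j s)"
proof -
  have "(\<Sum>j\<in>J. \<Sum>s\<in>S. f i j s) = (\<Sum>s\<in>S. \<Sum>j\<in>J. f i j s)" for i
    by (rule sum.swap)
  then show ?thesis
    by simp (rule sum.swap)
qed

lemma parseval_roots_of_unity:
  fixes p :: "nat \<Rightarrow> 'a::complex_inner"
  assumes "N \<le> M"
  defines "\<omega> s \<equiv> cis (2 * pi * real s / real M)"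
  shows "(\<Sum>s<M. (norm (\<Sum>j<N. \<omega> s ^ j *\<^sub>C p j))\<^sup>2) = real M * (\<Sum>j<N. (norm (p j))\<^sup>2)"
proof -
  have "(\<Sum>s<M. cinner (\<Sum>j<N. \<omega> s ^ j *\<^sub>C p j) (\<Sum>i<N. \<omega> s ^ i *\<^sub>C p i))
      = (\<Sum>s<M. \<Sum>i<N. \<Sum>j<N. \<omega> s ^ j * cnj (\<omega> s) ^ i * cinner (p j) (p i))"
    by (simp add: cinner_sum_left cinner_sum_right cinner_scaleC_left cinner_scaleC_right
        sum_distrib_left mult_ac)
  also have "\<dots> = (\<Sum>i<N. \<Sum>j<N. (\<Sum>s<M. \<omega> s ^ j * cnj (\<omega> s) ^ i) * cinner (p j) (p i))"
    by (subst sum.swap, rule sum.cong[OF refl], subst sum.swap) (simp add: sum_distrib_right)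
  also have "\<dots> = (\<Sum>i<N. \<Sum>j<N. if i = j then of_nat M * cinner (p j) (p i) else 0)"
    unfolding \<omega>_def using assms(1) by (intro sum.cong refl) (subst sum_roots_of_unity_orthogonal, auto)
  also have "\<dots> = of_nat M * (\<Sum>i<N. cinner (p i) (p i))"
    by (simp add: sum_distrib_left)
  finally have "Re (\<Sum>s<M. cinner (\<Sum>j<N. \<omega> s ^ j *\<^sub>C p j) (\<Sum>i<N. \<omega> s ^ i *\<^sub>C p i))
      = Re (of_nat M * (\<Sum>i<N. cinner (p i) (p i)))"
    by simp
  then show ?thesis
    by (simp add: Re_cinner_self)
qed

text \<open>
  Averages over the \<open>M\<close>-th roots of unity recover the Taylor coefficients up to aliasing, which
  only involves coefficients of order at least \<open>M - (i + j + 1)\<close>.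
\<close>

lemma roots_of_unity_average_tendsto:
  fixes c :: "nat \<Rightarrow> complex" and h :: "complex \<Rightarrow> complex"
  assumes h: "\<And>z. z \<in> ball 0 1 \<Longrightarrow> (\<lambda>n. c n * z ^ n) sums h z" and r: "0 < r" "r < 1"
  defines "\<omega> M s \<equiv> cis (2 * pi * real s / real M)"
  shows "(\<lambda>M. (\<Sum>s<M. \<omega> M s ^ j * cnj (\<omega> M s) ^ i * h (of_real r * \<omega> M s)) / of_nat M)
    \<longlonglongrightarrow> (if j \<le> i then of_real r ^ (i - j) * c (i - j) else 0)" (is "?E \<longlonglongrightarrow> ?l")
proof -
  define N where "N = i + j + 1"
  define a where "a n = norm (c n * of_real r ^ n)" for n
  have "ereal (norm (of_real ((1 + r) / 2) :: complex)) \<le> conv_radius c"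
    using h[of "of_real ((1 + r) / 2)"] r by (intro conv_radius_geI) (auto simp: sums_iff simp del: of_real_divide)
  moreover have "norm (of_real r :: complex) < norm (of_real ((1 + r) / 2) :: complex)"
    using r by (simp del: of_real_divide of_real_add)
  ultimately have summ: "summable a"
    unfolding a_def by (intro abs_summable_in_conv_radius) (meson ereal_less(1) less_ereal.simps(1) less_le_trans)
  define \<tau> where "\<tau> L = suminf a - sum a {..<L}" for L
  have \<tau>_lim: "\<tau> \<longlonglongrightarrow> 0"
    unfolding \<tau>_def using tendsto_diff[OF tendsto_const summable_LIMSEQ[OF summ], of "suminf a"] by simp
  have est: "norm (?E M - ?l) \<le> \<tau> (M - N)" if M: "M \<ge> 2 * N" for M
  proof -
    \<comment> \<open>Below order \<open>L\<close> all exponents \<open>j + n - i\<close> have modulus less than \<open>M\<close>, so there is no aliasing.\<close>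
    define L where "L = M - N"
    have M0: "M > 0"
      using M by (simp add: N_def)
    define t where "t s = h (of_real r * \<omega> M s) - (\<Sum>n<L. c n * (of_real r * \<omega> M s) ^ n)" for s
    have t_le: "norm (t s) \<le> \<tau> L" for s
    proof -
      have "(\<lambda>n. c n * (of_real r * \<omega> M s) ^ n) sums h (of_real r * \<omega> M s)"
        using r by (intro h) (simp add: norm_mult \<omega>_def)
      from sums_split_initial_segment[OF this, of L]
      have "(\<lambda>n. c (n + L) * (of_real r * \<omega> M s) ^ (n + L)) sums t s"
        by (simp add: t_def)
      moreover have nrm: "norm (c (n + L) * (of_real r * \<omega> M s) ^ (n + L)) = a (n + L)" for n
        by (simp add: a_def norm_mult norm_power \<omega>_def)
      moreover have "summable (\<lambda>n. a (n + L))"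
        using summ by (rule summable_ignore_initial_segment)
      ultimately have "norm (t s) \<le> (\<Sum>n. a (n + L))"
        using summable_norm[of "\<lambda>n. c (n + L) * (of_real r * \<omega> M s) ^ (n + L)"] by (simp add: sums_iff)
      also have "\<dots> = \<tau> L"
        by (simp add: \<tau>_def suminf_minus_initial_segment[OF summ])
      finally show ?thesis .
    qed
    have "(\<Sum>s<M. \<omega> M s ^ j * cnj (\<omega> M s) ^ i * (\<Sum>n<L. c n * (of_real r * \<omega> M s) ^ n))
        = (\<Sum>s<M. \<Sum>n<L. \<omega> M s ^ (j + n) * cnj (\<omega> M s) ^ i * (c n * of_real r ^ n))"
      by (simp add: sum_distrib_left power_add power_mult_distrib mult_ac)
    also have "\<dots> = (\<Sum>n<L. (\<Sum>s<M. \<omega> M s ^ (j + n) * cnj (\<omega> M s) ^ i) * (c n * of_real r ^ n))"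
      by (subst sum.swap) (simp add: sum_distrib_right)
    also have "\<dots> = (\<Sum>n<L. (if i = j + n then of_nat M else 0) * (c n * of_real r ^ n))"
      unfolding \<omega>_def using M
      by (intro sum.cong refl) (subst sum_roots_of_unity_orthogonal, auto simp: L_def N_def)
    also have "\<dots> = (\<Sum>n<L. if n = i - j then of_nat M * ?l else 0)"
      by (intro sum.cong refl) (auto simp: mult_ac)
    also have "\<dots> = of_nat M * ?l"
      using M by (simp add: L_def N_def)
    finally have main: "(\<Sum>s<M. \<omega> M s ^ j * cnj (\<omega> M s) ^ i * (\<Sum>n<L. c n * (of_real r * \<omega> M s) ^ n))
        = of_nat M * ?l" .
    have "(\<Sum>s<M. \<omega> M s ^ j * cnj (\<omega> M s) ^ i * h (of_real r * \<omega> M s))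
        = of_nat M * ?l + (\<Sum>s<M. \<omega> M s ^ j * cnj (\<omega> M s) ^ i * t s)"
      unfolding main[symmetric] sum.distrib[symmetric]
      by (intro sum.cong refl) (simp add: t_def algebra_simps)
    then have "?E M - ?l = (\<Sum>s<M. \<omega> M s ^ j * cnj (\<omega> M s) ^ i * t s) / of_nat M"
      using M0 by (simp add: field_simps)
    moreover have "norm (\<Sum>s<M. \<omega> M s ^ j * cnj (\<omega> M s) ^ i * t s) \<le> (\<Sum>s<M. \<tau> L)"
      by (rule sum_norm_le) (use t_le in \<open>simp add: norm_mult norm_power \<omega>_def\<close>)
    ultimately show ?thesis
      using M0 by (simp add: norm_divide field_simps L_def)
  qed
  have "(\<lambda>M. \<tau> (M - N)) \<longlonglongrightarrow> 0"
    by (rule LIMSEQ_offset[of _ N]) (simp add: \<tau>_lim)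
  with eventually_sequentiallyI[of "2 * N", OF est] have "(\<lambda>M. ?E M - ?l) \<longlonglongrightarrow> 0"
    by (rule Lim_null_comparison)
  then show ?thesis
    by (rule LIM_zero_cancel)
qed

text \<open>
  Let \<open>p(\<omega>) = \<Sum>\<^sub>j \<omega>\<^sup>j p\<^sub>j\<close> and \<open>q(\<omega>) = \<Sum>\<^sub>i \<omega>\<^sup>i q\<^sub>i\<close>. The average of \<open>\<langle>F(r \<omega>) p(\<omega>), q(\<omega>)\<rangle>\<close> over
  roots of unity tends to \<open>\<Sum>\<^sub>j\<^sub>\<le>\<^sub>i r\<^sup>i\<^sup>-\<^sup>j \<langle>F\<^sub>i\<^sub>-\<^sub>j p\<^sub>j, q\<^sub>i\<rangle>\<close> and is bounded by the averages of \<open>\<parallel>p(\<omega>)\<parallel>\<^sup>2\<close>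
  and \<open>\<parallel>q(\<omega>)\<parallel>\<^sup>2\<close>; then \<open>r \<rightarrow> 1\<close>.
\<close>

lemma toeplitz_contractive_if_power_series:
  fixes \<Phi> :: "complex \<Rightarrow> 'u::complex_inner \<Rightarrow> 'y::complex_inner"
  assumes lin: "\<And>z. z \<in> ball 0 1 \<Longrightarrow> bounded_clinear (\<Phi> z)"
    and le: "\<And>z u. z \<in> ball 0 1 \<Longrightarrow> norm (\<Phi> z u) \<le> norm u"
    and series: "\<And>z u y. z \<in> ball 0 1 \<Longrightarrow> (\<lambda>n. cinner (F n u) y * z ^ n) sums cinner (\<Phi> z u) y"
  shows "toeplitz_contractive F"
proof (rule toeplitz_contractiveI)
  fix N and p :: "nat \<Rightarrow> 'u" and q :: "nat \<Rightarrow> 'y"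
  define B where "B = ((\<Sum>j<N. (norm (p j))\<^sup>2) + (\<Sum>i<N. (norm (q i))\<^sup>2)) / 2"
  have r_bound: "Re (\<Sum>i<N. \<Sum>j<N. if j \<le> i then of_real r ^ (i - j) * cinner (F (i - j) (p j)) (q i) else 0) \<le> B"
    if r: "0 < r" "r < 1" for r :: real
  proof -
    define \<omega> where "\<omega> M s = cis (2 * pi * real s / real M)" for M s :: nat
    define E where "E i j M = (\<Sum>s<M. \<omega> M s ^ j * cnj (\<omega> M s) ^ i *
        cinner (\<Phi> (of_real r * \<omega> M s) (p j)) (q i)) / of_nat M" for i j M
    have "E i j \<longlonglongrightarrow> (if j \<le> i then of_real r ^ (i - j) * cinner (F (i - j) (p j)) (q i) else 0)" for i j
      unfolding E_def \<omega>_def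
      using roots_of_unity_average_tendsto[OF series[of _ "p j" "q i"] r, of j i] by simp
    then have lim: "(\<lambda>M. Re (\<Sum>i<N. \<Sum>j<N. E i j M))
        \<longlonglongrightarrow> Re (\<Sum>i<N. \<Sum>j<N. if j \<le> i then of_real r ^ (i - j) * cinner (F (i - j) (p j)) (q i) else 0)"
      by (intro tendsto_Re tendsto_sum)
    have "Re (\<Sum>i<N. \<Sum>j<N. E i j M) \<le> B" if M: "M \<ge> N" "M > 0" for M
    proof -
      define P where "P s = (\<Sum>j<N. \<omega> M s ^ j *\<^sub>C p j)" for s
      define Q where "Q s = (\<Sum>i<N. \<omega> M s ^ i *\<^sub>C q i)" for s
      have disc: "of_real r * \<omega> M s \<in> ball 0 1" for s
        using r by (simp add: norm_mult \<omega>_def)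
      have pair: "cinner (\<Phi> (of_real r * \<omega> M s) (P s)) (Q s)
          = (\<Sum>i<N. \<Sum>j<N. \<omega> M s ^ j * cnj (\<omega> M s) ^ i * cinner (\<Phi> (of_real r * \<omega> M s) (p j)) (q i))" for s
        unfolding P_def Q_def
        by (simp add: bounded_clinear_sum[OF lin[OF disc]] bounded_clinear_scaleC[OF lin[OF disc]]
            cinner_sum_left cinner_sum_right cinner_scaleC_left
            cinner_scaleC_right sum_distrib_left mult_ac)
      have "(\<Sum>i<N. \<Sum>j<N. E i j M)
          = (\<Sum>s<M. cinner (\<Phi> (of_real r * \<omega> M s) (P s)) (Q s)) / of_nat M"
        unfolding E_def pair sum_divide_distrib[symmetric] by (subst sum_swap_inner) simp
      then have "Re (\<Sum>i<N. \<Sum>j<N. E i j M)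
          = Re (\<Sum>s<M. cinner (\<Phi> (of_real r * \<omega> M s) (P s)) (Q s)) / real M"
        by simp
      also have "\<dots> \<le> (((\<Sum>s<M. (norm (\<Phi> (of_real r * \<omega> M s) (P s)))\<^sup>2) + (\<Sum>s<M. (norm (Q s))\<^sup>2)) / 2) / real M"
        by (intro divide_right_mono sum_cinner_le_half) simp
      also have "\<dots> \<le> (((\<Sum>s<M. (norm (P s))\<^sup>2) + (\<Sum>s<M. (norm (Q s))\<^sup>2)) / 2) / real M"
        by (intro divide_right_mono add_right_mono sum_mono power_mono le disc) auto
      also have "\<dots> = B"
        using M(2) unfolding P_def Q_def \<omega>_def parseval_roots_of_unity[OF M(1)] B_def
        by (simp add: field_simps)
      finally show ?thesis .
    qed
    then show ?thesis
      by (intro LIMSEQ_le_const2[OF lim] exI[of _ "Suc N"]) auto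
  qed
  have "((\<lambda>r. Re (\<Sum>i<N. \<Sum>j<N. if j \<le> i then of_real r ^ (i - j) * cinner (F (i - j) (p j)) (q i) else 0))
      \<longlongrightarrow> Re (\<Sum>i<N. \<Sum>j<N. if j \<le> i then of_real 1 ^ (i - j) * cinner (F (i - j) (p j)) (q i) else 0)) (at_left (1::real))"
    by (intro tendsto_Re tendsto_sum) (auto intro!: tendsto_eq_intros)
  moreover have "\<forall>\<^sub>F r in at_left (1::real). Re (\<Sum>i<N. \<Sum>j<N. if j \<le> i then of_real r ^ (i - j) * cinner (F (i - j) (p j)) (q i) else 0) \<le> B"
    unfolding eventually_at_left_field using r_bound by (intro exI[of _ 0]) auto
  ultimately have "Re (\<Sum>i<N. \<Sum>j<N. if j \<le> i then of_real 1 ^ (i - j) * cinner (F (i - j) (p j)) (q i) else 0) \<le> B"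
    by (rule tendsto_upperbound) simp
  also have "(\<Sum>i<N. \<Sum>j<N. if j \<le> i then of_real 1 ^ (i - j) * cinner (F (i - j) (p j)) (q i) else 0)
      = (\<Sum>i<N. \<Sum>j\<le>i. cinner (F (i - j) (p j)) (q i))"
    by (intro sum.cong sum.mono_neutral_cong_right refl) auto
  finally show "Re (\<Sum>i<N. \<Sum>j\<le>i. cinner (F (i - j) (p j)) (q i))
      \<le> ((\<Sum>j<N. (norm (p j))\<^sup>2) + (\<Sum>i<N. (norm (q i))\<^sup>2)) / 2"
    by (simp add: B_def)
qed

lemma op_holomorphic_cinner:
  fixes \<Phi> :: "complex \<Rightarrow> 'u::complex_inner \<Rightarrow> 'y::complex_inner"
  assumes hol: "op_holomorphic_on \<Phi> S" and S: "open S"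
  shows "(\<lambda>z. cinner (\<Phi> z u) y) holomorphic_on S"
proof -
  have "\<exists>D. ((\<lambda>z. cinner (\<Phi> z u) y) has_field_derivative D) (at z)" if z: "z \<in> S" for z
  proof -
    have lin: "bounded_clinear (\<Phi> w)" if "w \<in> S" for w
      using hol that by (auto simp: op_holomorphic_on_def)
    obtain F' where F': "bounded_clinear F'"
      and lim: "((\<lambda>h. onorm (\<lambda>u. inverse h *\<^sub>C (\<Phi> (z + h) u - \<Phi> z u) - F' u)) \<longlongrightarrow> 0) (at 0)"
      using hol z by (auto simp: op_holomorphic_on_def)
    have "\<forall>\<^sub>F h in at 0. z + h \<in> S"
    proof -
      have "((\<lambda>h. z + h) \<longlongrightarrow> z + 0) (at 0)"
        by (intro tendsto_intros)
      then show ?thesis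
        using topological_tendstoD[OF _ S, of "\<lambda>h. z + h" "z + 0"] z by simp
    qed
    then have ev: "\<forall>\<^sub>F h in at 0. norm ((cinner (\<Phi> (z + h) u) y - cinner (\<Phi> z u) y) / h - cinner (F' u) y)
        \<le> onorm (\<lambda>u. inverse h *\<^sub>C (\<Phi> (z + h) u - \<Phi> z u) - F' u) * norm u * norm y"
    proof eventually_elim
      case (elim h)
      define L where "L u = inverse h *\<^sub>C (\<Phi> (z + h) u - \<Phi> z u) - F' u" for u
      have "bounded_clinear (\<lambda>u. inverse h *\<^sub>C (\<Phi> (z + h) u - \<Phi> z u))"
      proof (rule bounded_clinear_comp[of "\<lambda>x. inverse h *\<^sub>C x"])
        show "bounded_clinear (\<lambda>x :: 'y. inverse h *\<^sub>C x)"
          by (rule bounded_clinearI[of _ "cmod (inverse h)"])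
            (simp_all add: scaleC_add_right scaleC_scaleC mult.commute norm_scaleC)
      qed (intro bounded_clinear_sub lin elim z)
      then have "bounded_linear L"
        unfolding L_def by (intro bounded_clinear_linear bounded_clinear_sub F')
      have "(cinner (\<Phi> (z + h) u) y - cinner (\<Phi> z u) y) / h - cinner (F' u) y = cinner (L u) y"
        by (simp add: L_def cinner_diff_left cinner_scaleC_left divide_inverse mult.commute)
      then have "norm ((cinner (\<Phi> (z + h) u) y - cinner (\<Phi> z u) y) / h - cinner (F' u) y) \<le> norm (L u) * norm y"
        using norm_cinner_le by simp
      also have "\<dots> \<le> onorm L * norm u * norm y"
        by (intro mult_right_mono onorm \<open>bounded_linear L\<close>) simp
      finally show ?case
        by (simp add: L_def[abs_def])
    qed
    have "((\<lambda>h. onorm (\<lambda>u. inverse h *\<^sub>C (\<Phi> (z + h) u - \<Phi> z u) - F' u) * norm u * norm y) \<longlongrightarrow> 0) (at 0)"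
      using tendsto_mult_right[OF tendsto_mult_right[OF lim, of "norm u"], of "norm y"]
      by (simp add: mult_ac)
    from Lim_null_comparison[OF ev this]
    have "((\<lambda>h. (cinner (\<Phi> (z + h) u) y - cinner (\<Phi> z u) y) / h) \<longlongrightarrow> cinner (F' u) y) (at 0)"
      by (rule LIM_zero_cancel)
    then show ?thesis
      unfolding DERIV_def by blast
  qed
  then show ?thesis
    using S by (auto simp: holomorphic_on_open)
qed

text \<open>The Neumann series of \<open>(I - z A)\<^bsup>-1\<^esup>\<close>, valid for \<open>|z| \<parallel>A\<parallel> < 1\<close>.\<close>

lemma transfer_function_power_series:
  fixes A :: "'x::chilbert_space \<Rightarrow> 'x" and B :: "'u::complex_inner \<Rightarrow> 'x"
    and C :: "'x \<Rightarrow> 'y::complex_inner"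
  assumes A: "bounded_clinear A" and C: "bounded_clinear C"
  shows "\<forall>\<^sub>F z in nhds 0. \<forall>u y. (\<lambda>n. cinner (markov_param A B C D n u) y * z ^ n)
    sums cinner (transfer_function A B C D z u) y"
proof -
  obtain K where K: "K > 0" "\<And>x. norm (A x) \<le> K * norm x"
    using bounded_clinear_bound[OF A] by metis
  have "\<forall>\<^sub>F z :: complex in nhds 0. z \<in> ball 0 (1 / K)"
    using K(1) by (intro eventually_nhds_in_open) auto
  then show ?thesis
  proof eventually_elim
    case (elim z)
    then have zK: "cmod z * K < 1"
      using K(1) by (simp add: field_simps)
    have neumann: "(\<lambda>n. z ^ n *\<^sub>C (A ^^ n) b) sums inv (\<lambda>x. x - z *\<^sub>C A x) b" for b
    proof -
      have "norm ((A ^^ n) b) \<le> K ^ n * norm b" for n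
      proof (induction n)
        case (Suc n)
        have "norm (A ((A ^^ n) b)) \<le> K * (K ^ n * norm b)"
          by (rule order_trans[OF K(2)]) (use Suc K(1) in simp)
        then show ?case
          by (simp add: mult_ac)
      qed simp
      then have "norm (z ^ n *\<^sub>C (A ^^ n) b) \<le> (cmod z * K) ^ n * norm b" for n
        using mult_left_mono[of "norm ((A ^^ n) b)" "K ^ n * norm b" "cmod z ^ n"]
        by (simp add: norm_scaleC norm_power power_mult_distrib mult_ac)
      moreover have "summable (\<lambda>n. (cmod z * K) ^ n * norm b)"
        using zK K(1) by (intro summable_mult2 summable_geometric) simp
      ultimately have "summable (\<lambda>n. z ^ n *\<^sub>C (A ^^ n) b)"
        by (rule summable_comparison_test'[rotated])
      then obtain x where x: "(\<lambda>n. z ^ n *\<^sub>C (A ^^ n) b) sums x"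
        by (auto simp: summable_def)
      have "bounded_linear (\<lambda>x. z *\<^sub>C A x)"
        by (rule bounded_linear_compose[OF bounded_bilinear.bounded_linear_right[OF bounded_bilinear_scaleC]
              bounded_clinear_linear[OF A]])
      from bounded_linear.sums[OF this x] have "(\<lambda>n. z ^ Suc n *\<^sub>C (A ^^ Suc n) b) sums (z *\<^sub>C A x)"
        by (simp add: bounded_clinear_scaleC[OF A] scaleC_scaleC)
      from sums_Suc[OF this] have "(\<lambda>n. z ^ n *\<^sub>C (A ^^ n) b) sums (z *\<^sub>C A x + b)"
        by simp
      from sums_unique2[OF x this] have sol: "x - z *\<^sub>C A x = b"
        by (metis add_diff_cancel_left')
      have "inj (\<lambda>x. x - z *\<^sub>C A x)"
      proof (rule injI)
        fix x y
        assume "x - z *\<^sub>C A x = y - z *\<^sub>C A y"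
        then have "x - y = z *\<^sub>C A (x - y)"
          by (simp add: bounded_clinear_diff[OF A] scaleC_diff_right algebra_simps)
        then have "norm (x - y) = cmod z * norm (A (x - y))"
          by (metis norm_scaleC)
        also have "\<dots> \<le> cmod z * (K * norm (x - y))"
          by (intro mult_left_mono K) simp
        finally have "(1 - cmod z * K) * norm (x - y) \<le> 0"
          by (simp add: algebra_simps)
        then have "norm (x - y) \<le> 0"
          using zK by (simp add: mult_le_0_iff)
        then show "x = y"
          by simp
      qed
      then have "inv (\<lambda>x. x - z *\<^sub>C A x) b = x"
        using sol by (intro inv_f_eq)
      then show ?thesis
        using x by simp
    qed
    show ?case
    proof (intro allI)
      fix u y
      define x where "x = inv (\<lambda>x. x - z *\<^sub>C A x) (B u)"
      have "bounded_linear (\<lambda>x. z * cinner (C x) y)"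
        by (intro bounded_linear_compose[OF bounded_linear_mult_right]
            bounded_linear_compose[OF bounded_bilinear.bounded_linear_left[OF bounded_bilinear_cinner]]
            bounded_clinear_linear C)
      from bounded_linear.sums[OF this neumann[of "B u"]]
      have "(\<lambda>n. cinner (markov_param A B C D (Suc n) u) y * z ^ Suc n) sums (z * cinner (C x) y)"
        by (simp add: x_def bounded_clinear_scaleC[OF C] cinner_scaleC_left mult_ac)
      from sums_Suc[OF this]
      show "(\<lambda>n. cinner (markov_param A B C D n u) y * z ^ n) sums cinner (transfer_function A B C D z u) y"
        by (simp add: transfer_function_def x_def cinner_add_left cinner_scaleC_left add.commute)
    qed
  qed
qed

text \<open>
  Each scalar function \<open>\<langle>\<Phi> z u, y\<rangle>\<close> is holomorphic on the unit disc, so its Taylor series converges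
  there. The coefficients are determined near \<open>0\<close>, where they are the Markov parameters.
\<close>

theorem schur_continuation_toeplitz_contractive:
  fixes A :: "'x::chilbert_space \<Rightarrow> 'x" and B :: "'u::complex_inner \<Rightarrow> 'x"
    and C :: "'x \<Rightarrow> 'y::complex_inner"
  assumes A: "bounded_clinear A" and C: "bounded_clinear C"
    and "has_schur_continuation (transfer_function A B C D)"
  shows "toeplitz_contractive (markov_param A B C D)"
proof -
  obtain \<Phi> where schur: "\<Phi> \<in> schur_class" and near: "\<forall>\<^sub>F z in nhds 0. \<Phi> z = transfer_function A B C D z"
    using assms(3) by (auto simp: has_schur_continuation_def)
  have hol: "op_holomorphic_on \<Phi> (ball 0 1)" and on: "\<And>z. z \<in> ball 0 1 \<Longrightarrow> onorm (\<Phi> z) \<le> 1"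
    using schur by (auto simp: schur_class_def)
  have lin: "bounded_clinear (\<Phi> z)" if "z \<in> ball 0 1" for z
    using hol that by (auto simp: op_holomorphic_on_def)
  show ?thesis
  proof (rule toeplitz_contractive_if_power_series[OF lin])
    fix z :: complex and u y
    assume z: "z \<in> ball 0 1"
    have "norm (\<Phi> z u) \<le> onorm (\<Phi> z) * norm u"
      by (rule onorm[OF bounded_clinear_linear[OF lin[OF z]]])
    also have "\<dots> \<le> 1 * norm u"
      by (intro mult_right_mono on z) simp
    finally show "norm (\<Phi> z u) \<le> norm u"
      by simp
    define h where "h z = cinner (\<Phi> z u) y" for z
    define c where "c n = cinner (markov_param A B C D n u) y" for n
    have "\<forall>\<^sub>F z in nhds 0. (\<lambda>n. fps_nth (Abs_fps c) n * z ^ n) sums h z"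
      using near transfer_function_power_series[OF A C, of B D]
      by eventually_elim (simp add: h_def c_def)
    then have "h has_fps_expansion Abs_fps c"
      by (rule has_fps_expansionI)
    from fps_nth_fps_expansion[OF this] have coeff: "c n = (deriv ^^ n) h 0 / fact n" for n
      by simp
    have "h holomorphic_on ball 0 1"
      unfolding h_def by (intro op_holomorphic_cinner hol) simp
    from holomorphic_power_series[OF this z] show
      "(\<lambda>n. cinner (markov_param A B C D n u) y * z ^ n) sums cinner (\<Phi> z u) y"
      by (simp add: coeff[symmetric] c_def h_def)
  qed
qed


section \<open>Bounds for the extremal storage operators\<close>

lemma cinner_funpow_cadjoint:
  fixes A :: "'x::chilbert_space \<Rightarrow> 'x"
  assumes A: "bounded_clinear A"
  shows "cinner ((A ^^ k) x) y = cinner x ((cadjoint A ^^ k) y)"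
  by (induction k arbitrary: x y) (simp_all add: cinner_cadjoint[OF A] funpow_swap1)

text \<open>Used to see that the images of \<open>W\<^sub>c\<close> and \<open>W\<^sub>o\<^sup>*\<close> contain those of \<open>Z'\<close> and \<open>Z\<close>, so are dense.\<close>

lemma subset_graph_adjoint_graph_adjoint: "G \<subseteq> graph_adjoint (graph_adjoint G)"
proof clarify
  fix x y
  assume xy: "(x, y) \<in> G"
  have "cinner w x = cinner z y" if "(z, w) \<in> graph_adjoint G" for z w
  proof -
    have "cinner y z = cinner x w"
      using that xy by (auto simp: graph_adjoint_def)
    then show ?thesis
      by (metis cinner_commute)
  qed
  then show "(x, y) \<in> graph_adjoint (graph_adjoint G)"
    by (auto simp: graph_adjoint_def)
qed

lemma bounded_clinear_markov_param:
  fixes A :: "'x::complex_inner \<Rightarrow> 'x"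
  assumes "bounded_clinear A" "bounded_clinear B" "bounded_clinear C" "bounded_clinear D"
  shows "bounded_clinear (markov_param A B C D n)"
proof (cases n)
  case (Suc m)
  have "markov_param A B C D n = (\<lambda>u. C ((A ^^ m) (B u)))"
    using Suc by (simp add: fun_eq_iff)
  then show ?thesis
    using bounded_clinear_comp[OF assms(3) bounded_clinear_comp[OF bounded_clinear_funpow[OF assms(1)] assms(2)]]
    by simp
qed (use assms in simp)

theorem proposition6p3:
  fixes A :: "'x::chilbert_space \<Rightarrow> 'x"
    and B :: "'u::chilbert_space \<Rightarrow> 'x"
    and C :: "'x \<Rightarrow> 'y::chilbert_space"
    and D :: "'u \<Rightarrow> 'y"
  assumes "bounded_clinear A" and "bounded_clinear B" and "bounded_clinear C" and "bounded_clinear D"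
    and "minimal_system A B C"
    and "has_schur_continuation (transfer_function A B C D)"
  shows "(ell2_exactly_controllable A B \<longrightarrow>
            bounded_operator (H_a A B C D) \<and> bounded_operator (H_r A B C D)) \<and>
         (ell2_exactly_observable A C \<longrightarrow>
            boundedly_invertible (H_a A B C D) \<and> boundedly_invertible (H_r A B C D)) \<and>
         (ell2_exactly_minimal A B C \<longrightarrow>
            bounded_operator (H_a A B C D) \<and> boundedly_invertible (H_a A B C D) \<and>
            bounded_operator (H_r A B C D) \<and> boundedly_invertible (H_r A B C D))"
proof -
  note A = assms(1) and B = assms(2) and C = assms(3) and D = assms(4)
  note A' = bounded_clinear_cadjoint[OF A] and B' = bounded_clinear_cadjoint[OF B]
    and C' = bounded_clinear_cadjoint[OF C]
  define F where "F = markov_param A B C D"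
  interpret F: toeplitz_symbols F
    unfolding F_def
    by standard (intro bounded_clinear_markov_param A B C D
        schur_continuation_toeplitz_contractive[OF A C assms(6)])+
  interpret F': toeplitz_symbols "\<lambda>n. cadjoint (F n)"
    by standard (intro bounded_clinear_cadjoint F.F toeplitz_contractive_cadjoint F.contr)+
  define T where "T = toeplitz_plus F"
  define T' where "T' = toeplitz_minus F"
  define G where "G k = (cadjoint A ^^ k) \<circ> cadjoint C" for k
  define G' where "G' k = (A ^^ k) \<circ> B" for k
  have G: "bounded_clinear (G k)" and G': "bounded_clinear (G' k)" for k
    using bounded_clinear_comp[OF bounded_clinear_funpow[OF A'] C']
      bounded_clinear_comp[OF bounded_clinear_funpow[OF A] B] by (simp_all add: G_def G'_def o_def)
  interpret G: synthesis id G
    by standard (simp_all add: G bij_id)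
  interpret G': synthesis negint_of_nat G'
    by standard (simp_all add: G' bij_negint_of_nat)
  \<comment> \<open>The adjoints of \<open>Z\<close> and \<open>Z'\<close> are \<open>W\<^sub>o\<close> and \<open>W\<^sub>c\<^sup>*\<close>.\<close>
  define Z where "Z = finite_synthesis id G"
  define Z' where "Z' = finite_synthesis negint_of_nat G'"

  have adj_G: "cinner (G k y) x = cinner y (C ((A ^^ k) x))" for k x y
    by (metis G_def cinner_commute cinner_funpow_cadjoint[OF A] cinner_cadjoint[OF C] comp_apply)
  have adj_G': "cinner (G' k u) x = cinner u (cadjoint B ((cadjoint A ^^ k) x))" for k x u
    by (simp add: G'_def cinner_funpow_cadjoint[OF A] cinner_cadjoint[OF B])
  have W: "graph_adjoint Z = W_obs A C"
    unfolding Z_def G.graph_adjoint_finite_synthesis[OF adj_G] by (simp add: W_obs_def)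
  have W': "graph_adjoint Z' = W_con_star A B"
  proof -
    have "(\<forall>k. ell2_nth u (negint_of_nat k) = cadjoint B ((cadjoint A ^^ k) x)) \<longleftrightarrow>
        (\<forall>n. ell2_nth u n = cadjoint B ((cadjoint A ^^ nat_of_negint n) x))" for x u
      by (metis nat_of_negint_of_nat negint_of_nat_of_negint)
    then show ?thesis
      unfolding Z'_def G'.graph_adjoint_finite_synthesis[OF adj_G']
      by (simp add: W_con_star_def nat_of_negint_def)
  qed
  have range_Z: "closure (Range Z) = UNIV" and range_Z': "closure (Range Z') = UNIV"
    unfolding Z_def Z'_def using assms(5)
    by (auto intro!: G.finite_synthesis_dense_range G'.finite_synthesis_dense_range
        simp: minimal_system_def G_def G'_def)
  have "closure (Range Z) \<subseteq> closure (Range (graph_adjoint (W_obs A C)))"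
    unfolding W[symmetric] using subset_graph_adjoint_graph_adjoint[of Z] by (intro closure_mono) blast
  then have range_obs: "closure (Range (graph_adjoint (W_obs A C))) = UNIV"
    using range_Z by auto
  have "closure (Range Z') \<subseteq> closure (Range (graph_adjoint (W_con_star A B)))"
    unfolding W'[symmetric] using subset_graph_adjoint_graph_adjoint[of Z'] by (intro closure_mono) blast
  then have range_con: "closure (Range (graph_adjoint (W_con_star A B))) = UNIV"
    using range_Z' by auto

  \<comment> \<open>The Hankel matrix factors through the state space, in both directions.\<close>
  have hankel: "C ((A ^^ k) (G' i u)) = F (i + k + 1) u" for i k u
    by (simp add: G'_def F_def funpow_add add.commute[of i k])
  have hankel': "cadjoint B ((cadjoint A ^^ k) (G i y)) = cadjoint (F (i + k + 1)) y" for i k y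
  proof (rule cinner_eqI)
    fix u
    have "cinner u (cadjoint B ((cadjoint A ^^ k) (G i y))) = cinner (G' k u) (G i y)"
      by (simp add: adj_G')
    also have "\<dots> = cinner (C ((A ^^ i) (G' k u))) y"
      using adj_G[of i y "G' k u"] by (metis cinner_commute)
    also have "\<dots> = cinner u (cadjoint (F (i + k + 1)) y)"
      by (simp add: hankel cinner_cadjoint[OF F.F] add.commute[of i k])
    finally show "cinner u (cadjoint B ((cadjoint A ^^ k) (G i y))) = cinner u (cadjoint (F (i + k + 1)) y)" .
  qed

  have T: "bounded_clinear (cadjoint T)" "\<And>v. norm (cadjoint T v) \<le> norm v"
    unfolding T_def
    by (intro bounded_clinear_cadjoint F.bounded_clinear_toeplitz_plus F.norm_cadjoint_toeplitz_plus)+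
  note defect_T = defect_op_contraction[OF T]
  have T': "bounded_clinear T'" "\<And>u. norm (T' u) \<le> norm u"
    unfolding T'_def by (intro F.bounded_clinear_toeplitz_minus F.norm_toeplitz_minus)+
  note defect_T' = defect_op_contraction[OF T']

  interpret a: defect_factorization Z "W_con_star A B" "defect_op (cadjoint T)"
  proof
    show "norm (defect_op (cadjoint T) v) \<le> norm v" for v
      using defect_T(3)[of v] by (auto intro: power2_le_imp_le[OF _ norm_ge_zero])
    show "\<exists>w. (z, w) \<in> W_con_star A B \<and> norm w \<le> norm (defect_op (cadjoint T) v)"
      if "(v, z) \<in> Z" for v z
    proof -
      have "\<exists>w :: (negint, 'u) ell2. (\<forall>k. ell2_nth w (negint_of_nat k) = cadjoint B ((cadjoint A ^^ k) z))
          \<and> norm w \<le> norm (defect_op (cadjoint T) v)"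
        by (rule F'.finite_synthesis_dominated[OF bij_id bij_id bij_negint_of_nat T _
              bounded_clinear_comp[OF B' bounded_clinear_funpow[OF A']] hankel'])
          (use that F.cadjoint_toeplitz_plus_has_sum in \<open>simp_all add: T_def Z_def\<close>)
      then show ?thesis
        unfolding W'[symmetric] Z'_def G'.graph_adjoint_finite_synthesis[OF adj_G'] by simp
    qed
  qed (use G.finite_synthesis_linear G.finite_synthesis_dense_domain range_Z range_con defect_T in
      \<open>simp_all add: Z_def\<close>)
  interpret r: defect_factorization Z' "W_obs A C" "defect_op T'"
  proof
    show "norm (defect_op T' v) \<le> norm v" for v
      using defect_T'(3)[of v] by (auto intro: power2_le_imp_le[OF _ norm_ge_zero])
    show "\<exists>w. (z, w) \<in> W_obs A C \<and> norm w \<le> norm (defect_op T' v)" if "(v, z) \<in> Z'" for v z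
    proof -
      have "\<exists>w :: (nat, 'y) ell2. (\<forall>k. ell2_nth w (id k) = C ((A ^^ k) z))
          \<and> norm w \<le> norm (defect_op T' v)"
        by (rule F.finite_synthesis_dominated[OF bij_negint_of_nat bij_negint_of_nat bij_id T' _
              bounded_clinear_comp[OF C bounded_clinear_funpow[OF A]] hankel])
          (use that F.toeplitz_minus_has_sum in \<open>simp_all add: T'_def Z'_def\<close>)
      then show ?thesis
        by (simp add: W_obs_def)
    qed
  qed (use G'.finite_synthesis_linear G'.finite_synthesis_dense_domain range_Z' range_obs defect_T' in
      \<open>simp_all add: Z'_def\<close>)

  have a_W: "a.W = W_obs A C" and r_W: "r.W = W_con_star A B"
    by (simp_all add: a.W_def r.W_def W W')
  have a_R: "a.R = Range (W_con A B)" and r_R: "r.R = Range (W_obs_star A C)"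
    by (simp_all add: a.R_def r.R_def W_con_def W_obs_star_def)
  have "X_a A B C D = a.X"
    unfolding X_a_def Let_def F_def[symmetric] T_def[symmetric] a_R[symmetric] a_W[symmetric]
    by (rule a.X_eq_THE)
  then have H_a: "H_a A B C D = a.H"
    by (simp add: H_a_def)
  have "X_r A B C D = r.X"
    unfolding X_r_def Let_def F_def[symmetric] T'_def[symmetric] r_R[symmetric] r_W[symmetric]
    by (rule r.X_eq_THE)
  then have H_r: "H_r A B C D = r.H\<inverse>"
    by (simp add: H_r_def)

  \<comment> \<open>Controllability makes the domain of \<open>X\<^sub>a\<close> everything and the adjoint of \<open>W\<^sub>c\<^sup>*\<close> onto.\<close>
  have con: "bounded_operator (H_a A B C D) \<and> bounded_operator (H_r A B C D)"
    if "ell2_exactly_controllable A B"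
  proof -
    have R: "Range (W_con A B) = UNIV"
      using that by (simp add: ell2_exactly_controllable_def)
    have "boundedly_invertible r.H"
      using R by (intro r.boundedly_invertible_if_adjoint_range_UNIV) (simp add: r_W W_con_def)
    then show ?thesis
      using a.bounded_if_range_UNIV(1) R by (simp add: H_a H_r a_R boundedly_invertible_def)
  qed
  \<comment> \<open>Observability makes the domain of \<open>X\<^sub>r\<close> everything and the adjoint of \<open>W\<^sub>o\<close> onto.\<close>
  have obs: "boundedly_invertible (H_a A B C D) \<and> boundedly_invertible (H_r A B C D)"
    if "ell2_exactly_observable A C"
  proof -
    have R: "Range (W_obs_star A C) = UNIV"
      using that by (simp add: ell2_exactly_observable_def)
    have "boundedly_invertible a.H"
      using R by (intro a.boundedly_invertible_if_adjoint_range_UNIV) (simp add: a_W W_obs_star_def)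
    then show ?thesis
      using r.bounded_if_range_UNIV R by (simp add: H_a H_r r_R boundedly_invertible_def)
  qed
  show ?thesis
    using con obs by (auto simp: ell2_exactly_minimal_def)
qed

end
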